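(* Let $F$ be a locally projectively flat Finsler metric (on an $n$-dimensional manifold $M$) with almost isotropic S-curvature, i.e. $$\mathbf S=(n+1)(cF+\eta),$$ where $c=c(x)$ is a scalar function and $\eta=\eta_i(x)y^i$ is a closed $1$-form. If $c(x)$ is not a constant, then $F$ is a Randers metric.
   Context: A Finsler metric on a $C^\infty$ $n$-dimensional manifold $M$ is a function $F=F(x,y)$ on $TM$, $C^\infty$ on $TM\setminus\{0\}$, with $F\ge 0$ and $F(x,y)=0$ iff $y=0$, $F(x,\lambda y)=\lambda F(x,y)$ for $\lambda\ge 0$, and with $g_{ij}=\frac12 [F^2]_{y^iy^j}$ positive definite for $y\ne0$. Geodesic coefficients: $G^i=\frac14 g^{il}\{[F^2]_{x^my^l}y^m-[F^2]_{x^l}\}$. A Finsler metric on an open domain $\mathcal U\subset\mathbb R^n$ is projectively flat if all its geodesics are straight lines (equivalently $G^i=P(x,y)y^i$ for some function $P$). $F$ on $M$ is locally projectively flat if around every point there are local coordinates in which $F$ is projectively flat. The S-curvature is $\mathbf S=\frac{\partial G^m}{\partial y^m}-y^m\frac{\partial\ln\sigma_F}{\partial x^m}$, where $dV_F=\sigma_F(x)dx^1\cdots dx^n$ is the Busemann-Hausdorff volume form, $\sigma_F(x)=\mathrm{Vol}(\mathbb B^n(1))/\mathrm{Vol}\{(y^i)\in\mathbb R^n: F(x,y)<1\}$ (Euclidean volumes). A Randers metric is a Finsler metric $F=\alpha+\beta$ with $\alpha=\sqrt{a_{ij}(x)y^iy^j}$ a Riemannian metric and $\beta=b_i(x)y^i$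 a $1$-form with $\|\beta\|_\alpha<1$ at every point.
   Formalization: The manifold M is assumed connected; otherwise the claim fails, e.g. for the disjoint union of the Funk ball (c = 1/2) and a non-Randers Minkowski space (c = 0), where c is not constant but F is not Randers. *)

theory Defs
  imports "HOL-Analysis.Analysis"
begin

section \<open>Smooth maps and partial derivatives\<close>

text \<open>Only used for open sets \<open>S\<close> in finite-dimensional spaces, where it is the usual notion of
  a \<open>C\<^sup>k\<close> map.\<close>

primrec Ck_on :: "nat \<Rightarrow> 'a::real_normed_vector set \<Rightarrow> ('a \<Rightarrow> 'b::real_normed_vector) \<Rightarrow> bool" where
  "Ck_on 0 S f \<longleftrightarrow> continuous_on S f"
| "Ck_on (Suc k) S f \<longleftrightarrow>
     (\<forall>x\<in>S. f differentiable at x) \<and> (\<forall>v. Ck_on k S (\<lambda>x. frechet_derivative f (at x) v))"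

definition smooth_on :: "'a::real_normed_vector set \<Rightarrow> ('a \<Rightarrow> 'b::real_normed_vector) \<Rightarrow> bool" where
  "smooth_on S f \<longleftrightarrow> (\<forall>k. Ck_on k S f)"

definition partial_deriv :: "'n::finite \<Rightarrow> (real^'n \<Rightarrow> real) \<Rightarrow> real^'n \<Rightarrow> real" where
  "partial_deriv i f x = frechet_derivative f (at x) (axis i 1)"

section \<open>Finsler metrics on domains of \<open>\<real>\<^sup>n\<close>\<close>

definition fundamental_tensor ::
    "(real^'n \<Rightarrow> real^'n \<Rightarrow> real) \<Rightarrow> real^'n \<Rightarrow> real^'n \<Rightarrow> real^'n^'n" where
  "fundamental_tensor F x y =
     (\<chi> i j. 1/2 * partial_deriv j (partial_deriv i (\<lambda>y. (F x y)\<^sup>2)) y)"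

definition finsler_on :: "(real^'n) set \<Rightarrow> (real^'n \<Rightarrow> real^'n \<Rightarrow> real) \<Rightarrow> bool" where
  "finsler_on V F \<longleftrightarrow>
     smooth_on (V \<times> (UNIV - {0})) (\<lambda>(x, y). F x y) \<and>
     (\<forall>x\<in>V. \<forall>y. F x y \<ge> 0 \<and> (F x y = 0 \<longleftrightarrow> y = 0)) \<and>
     (\<forall>x\<in>V. \<forall>y. \<forall>r\<ge>0. F x (r *\<^sub>R y) = r * F x y) \<and>
     (\<forall>x\<in>V. \<forall>y. y \<noteq> 0 \<longrightarrow> (\<forall>v. v \<noteq> 0 \<longrightarrow> v \<bullet> (fundamental_tensor F x y *v v) > 0))"

definition geodesic_coeffs ::
    "(real^'n \<Rightarrow> real^'n \<Rightarrow> real) \<Rightarrow> real^'n \<Rightarrow> real^'n \<Rightarrow> real^'n" where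
  "geodesic_coeffs F x y =
     (\<chi> i. 1/4 * (\<Sum>l\<in>UNIV. matrix_inv (fundamental_tensor F x y) $ i $ l *
        ((\<Sum>m\<in>UNIV. partial_deriv m (\<lambda>x. partial_deriv l (\<lambda>y. (F x y)\<^sup>2) y) x * y $ m)
          - partial_deriv l (\<lambda>x. (F x y)\<^sup>2) x)))"

text \<open>Constant-speed geodesics on an open interval: \<open>\<gamma>'' + 2 G(\<gamma>, \<gamma>') = 0\<close> with \<open>\<gamma>' \<noteq> 0\<close>.\<close>

definition geodesic_on ::
    "(real^'n) set \<Rightarrow> (real^'n \<Rightarrow> real^'n \<Rightarrow> real) \<Rightarrow> real set \<Rightarrow> (real \<Rightarrow> real^'n) \<Rightarrow> bool" where
  "geodesic_on V F I \<gamma> \<longleftrightarrow> open I \<and> is_interval I \<and> \<gamma> ` I \<subseteq> V \<and>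
     (\<exists>\<gamma>'. \<forall>t\<in>I. (\<gamma> has_vector_derivative \<gamma>' t) (at t) \<and> \<gamma>' t \<noteq> 0 \<and>
        (\<gamma>' has_vector_derivative - 2 *\<^sub>R geodesic_coeffs F (\<gamma> t) (\<gamma>' t)) (at t))"

definition projectively_flat_on ::
    "(real^'n) set \<Rightarrow> (real^'n \<Rightarrow> real^'n \<Rightarrow> real) \<Rightarrow> bool" where
  "projectively_flat_on V F \<longleftrightarrow> (\<forall>I \<gamma>. geodesic_on V F I \<gamma> \<longrightarrow> collinear (\<gamma> ` I))"

definition busemann_hausdorff ::
    "(real^'n \<Rightarrow> real^'n \<Rightarrow> real) \<Rightarrow> real^'n \<Rightarrow> real" where
  "busemann_hausdorff F x =
     measure lebesgue (ball (0 :: real^'n) 1) / measure lebesgue {y. F x y < 1}"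

definition S_curvature ::
    "(real^'n \<Rightarrow> real^'n \<Rightarrow> real) \<Rightarrow> real^'n \<Rightarrow> real^'n \<Rightarrow> real" where
  "S_curvature F x y =
     (\<Sum>m\<in>UNIV. partial_deriv m (\<lambda>y. geodesic_coeffs F x y $ m) y)
     - (\<Sum>m\<in>UNIV. y $ m * partial_deriv m (\<lambda>x. ln (busemann_hausdorff F x)) x)"

section \<open>Smooth manifolds\<close>

text \<open>A chart is its domain together with the coordinate map (whose values outside of the domain
  are irrelevant).\<close>

type_synonym ('a, 'n) chart = "'a set \<times> ('a \<Rightarrow> real^'n)"

definition chart_image :: "('a, 'n) chart \<Rightarrow> (real^'n) set" where
  "chart_image \<kappa> = snd \<kappa> ` fst \<kappa>"

definition chart_inv :: "('a, 'n) chart \<Rightarrow> real^'n \<Rightarrow> 'a" where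
  "chart_inv \<kappa> = inv_into (fst \<kappa>) (snd \<kappa>)"

definition is_chart :: "'a topology \<Rightarrow> ('a, 'n::finite) chart \<Rightarrow> bool" where
  "is_chart T \<kappa> \<longleftrightarrow> openin T (fst \<kappa>) \<and> open (chart_image \<kappa>) \<and>
     homeomorphic_map (subtopology T (fst \<kappa>)) (top_of_set (chart_image \<kappa>)) (snd \<kappa>)"

definition transition :: "('a, 'n) chart \<Rightarrow> ('a, 'n) chart \<Rightarrow> real^'n \<Rightarrow> real^'n" where
  "transition \<kappa> \<mu> = snd \<mu> \<circ> chart_inv \<kappa>"

definition compatible :: "('a, 'n::finite) chart \<Rightarrow> ('a, 'n) chart \<Rightarrow> bool" where
  "compatible \<kappa> \<mu> \<longleftrightarrow>
     smooth_on (snd \<kappa> ` (fst \<kappa> \<inter> fst \<mu>)) (transition \<kappa> \<mu>) \<and>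
     smooth_on (snd \<mu> ` (fst \<kappa> \<inter> fst \<mu>)) (transition \<mu> \<kappa>)"

text \<open>The smooth structure \<open>A\<close> is a maximal atlas, so its elements are exactly the local coordinate
  systems of the manifold.\<close>

definition smooth_manifold :: "'a topology \<Rightarrow> ('a, 'n::finite) chart set \<Rightarrow> bool" where
  "smooth_manifold T A \<longleftrightarrow>
     Hausdorff_space T \<and> second_countable T \<and>
     (\<forall>\<kappa>\<in>A. is_chart T \<kappa>) \<and> (\<Union>\<kappa>\<in>A. fst \<kappa>) = topspace T \<and>
     (\<forall>\<kappa>\<in>A. \<forall>\<mu>\<in>A. compatible \<kappa> \<mu>) \<and>
     (\<forall>\<kappa>. is_chart T \<kappa> \<and> (\<forall>\<mu>\<in>A. compatible \<kappa> \<mu>) \<longrightarrow> \<kappa> \<in> A)"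

text \<open>A tangent vector at \<open>p\<close> is the family of its components with respect to all charts around
  \<open>p\<close>, subject to the contravariant transformation rule; components for all other charts are
  set to 0.\<close>

type_synonym ('a, 'n) tvec = "('a, 'n) chart \<Rightarrow> real^'n"

definition tangent_space :: "('a, 'n::finite) chart set \<Rightarrow> 'a \<Rightarrow> ('a, 'n) tvec set" where
  "tangent_space A p = {v.
     (\<forall>\<kappa>\<in>A. \<forall>\<mu>\<in>A. p \<in> fst \<kappa> \<and> p \<in> fst \<mu> \<longrightarrow>
        v \<mu> = frechet_derivative (transition \<kappa> \<mu>) (at (snd \<kappa> p)) (v \<kappa>)) \<and>
     (\<forall>\<kappa>. \<not> (\<kappa> \<in> A \<and> p \<in> fst \<kappa>) \<longrightarrow> v \<kappa> = 0)}"

text \<open>The tangent vector \<open>y\<^sup>i \<partial>/\<partial>x\<^sup>i\<close> at \<open>p\<close> in the coordinates \<open>x\<close> given by the chart \<open>\<kappa>\<close>.\<close>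

definition tangent_vector ::
    "('a, 'n::finite) chart set \<Rightarrow> ('a, 'n) chart \<Rightarrow> 'a \<Rightarrow> real^'n \<Rightarrow> ('a, 'n) tvec" where
  "tangent_vector A \<kappa> p y =
     (\<lambda>\<mu>. if \<mu> \<in> A \<and> p \<in> fst \<mu>
          then frechet_derivative (transition \<kappa> \<mu>) (at (snd \<kappa> p)) y else 0)"

lemma tangent_space_eq_tangent_vector:
  assumes "\<kappa> \<in> A" "p \<in> fst \<kappa>" "v \<in> tangent_space A p"
  shows "v = tangent_vector A \<kappa> p (v \<kappa>)"
proof (rule ext)
  fix \<mu>
  have "v \<mu> = frechet_derivative (transition \<kappa> \<mu>) (at (snd \<kappa> p)) (v \<kappa>)"
    if "\<mu> \<in> A \<and> p \<in> fst \<mu>"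
    using assms that unfolding tangent_space_def mem_Collect_eq by blast
  moreover have "v \<mu> = 0" if "\<not> (\<mu> \<in> A \<and> p \<in> fst \<mu>)"
    using assms(3) that unfolding tangent_space_def mem_Collect_eq by blast
  ultimately show "v \<mu> = tangent_vector A \<kappa> p (v \<kappa>) \<mu>"
    unfolding tangent_vector_def by presburger
qed

lemma tangent_vector_in_tangent_space:
  assumes M: "smooth_manifold T A" and \<kappa>: "\<kappa> \<in> A" "p \<in> fst \<kappa>"
  shows "tangent_vector A \<kappa> p y \<in> tangent_space A p" "tangent_vector A \<kappa> p y \<kappa> = y"
proof -
  have chart: "openin T (fst \<mu>)" "open (chart_image \<mu>)" "inj_on (snd \<mu>) (fst \<mu>)"
      "homeomorphic_map (subtopology T (fst \<mu>)) (top_of_set (chart_image \<mu>)) (snd \<mu>)"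
      "topspace (subtopology T (fst \<mu>)) = fst \<mu>"
    if "\<mu> \<in> A" for \<mu>
  proof -
    have c: "is_chart T \<mu>" using M that by (auto simp: smooth_manifold_def)
    show o: "openin T (fst \<mu>)" "open (chart_image \<mu>)"
      and h: "homeomorphic_map (subtopology T (fst \<mu>)) (top_of_set (chart_image \<mu>)) (snd \<mu>)"
      using c by (auto simp: is_chart_def)
    show t: "topspace (subtopology T (fst \<mu>)) = fst \<mu>"
      using openin_subset[OF o(1)] by auto
    show "inj_on (snd \<mu>) (fst \<mu>)"
      using homeomorphic_imp_injective_map[OF h] t by simp
  qed
  have op: "open (snd \<mu> ` (fst \<mu> \<inter> fst \<nu>))" if "\<mu> \<in> A" "\<nu> \<in> A" for \<mu> \<nu>
  proof -
    have "openin (subtopology T (fst \<mu>)) (fst \<mu> \<inter> fst \<nu>)"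
      by (metis chart(1) inf_commute openin_subtopology_Int that(2))
    then have "openin (top_of_set (chart_image \<mu>)) (snd \<mu> ` (fst \<mu> \<inter> fst \<nu>))"
      using homeomorphic_imp_open_map[OF chart(4)[OF that(1)]] by (simp add: open_map_def)
    then show ?thesis using chart(2)[OF that(1)] openin_open_trans by blast
  qed
  have inv: "chart_inv \<mu> (snd \<mu> q) = q" if "\<mu> \<in> A" "q \<in> fst \<mu>" for \<mu> q
    using that chart(3) by (simp add: chart_inv_def)
  have diff: "(transition \<mu> \<nu> has_derivative frechet_derivative (transition \<mu> \<nu>) (at (snd \<mu> p)))
      (at (snd \<mu> p))"
    if "\<mu> \<in> A" "\<nu> \<in> A" "p \<in> fst \<mu>" "p \<in> fst \<nu>" for \<mu> \<nu>
  proof -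
    have "compatible \<mu> \<nu>" using M that by (auto simp: smooth_manifold_def)
    then have "Ck_on (Suc 0) (snd \<mu> ` (fst \<mu> \<inter> fst \<nu>)) (transition \<mu> \<nu>)"
      unfolding compatible_def smooth_on_def by blast
    then have "transition \<mu> \<nu> differentiable at (snd \<mu> p)"
      using that by auto
    then show ?thesis by (simp only: frechet_derivative_works)
  qed
  have "frechet_derivative (transition \<kappa> \<kappa>) (at (snd \<kappa> p)) = id"
  proof (rule frechet_derivative_at[symmetric])
    have "(id has_derivative id) (at (snd \<kappa> p))" by (simp add: has_derivative_id id_def)
    then show "(transition \<kappa> \<kappa> has_derivative id) (at (snd \<kappa> p))"
      by (rule has_derivative_transform_within_open[OF _ op[OF \<kappa>(1) \<kappa>(1)]])
        (use \<kappa> in \<open>auto simp: transition_def inv\<close>)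
  qed
  then show "tangent_vector A \<kappa> p y \<kappa> = y" using \<kappa> by (simp add: tangent_vector_def)
  have "frechet_derivative (transition \<kappa> \<nu>) (at (snd \<kappa> p)) =
      frechet_derivative (transition \<mu> \<nu>) (at (snd \<mu> p)) \<circ>
      frechet_derivative (transition \<kappa> \<mu>) (at (snd \<kappa> p))"
    if "\<mu> \<in> A" "\<nu> \<in> A" "p \<in> fst \<mu>" "p \<in> fst \<nu>" for \<mu> \<nu>
  proof (rule frechet_derivative_at[symmetric])
    let ?W = "(snd \<kappa> ` (fst \<kappa> \<inter> fst \<mu>)) \<inter> (snd \<kappa> ` (fst \<kappa> \<inter> fst \<nu>))"
    have tr: "transition \<kappa> \<mu> (snd \<kappa> p) = snd \<mu> p"
      using inv \<kappa> by (simp add: transition_def)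
    have "((transition \<mu> \<nu> \<circ> transition \<kappa> \<mu>) has_derivative
        (frechet_derivative (transition \<mu> \<nu>) (at (snd \<mu> p)) \<circ>
         frechet_derivative (transition \<kappa> \<mu>) (at (snd \<kappa> p)))) (at (snd \<kappa> p))"
      using diff_chain_at[OF diff[OF \<kappa>(1) that(1) \<kappa>(2) that(3)], of "transition \<mu> \<nu>"]
        diff[OF that] tr by simp
    then show "(transition \<kappa> \<nu> has_derivative
        (frechet_derivative (transition \<mu> \<nu>) (at (snd \<mu> p)) \<circ>
         frechet_derivative (transition \<kappa> \<mu>) (at (snd \<kappa> p)))) (at (snd \<kappa> p))"
    proof (rule has_derivative_transform_within_open)
      show "open ?W" using op \<kappa> that by blast
      show "snd \<kappa> p \<in> ?W" using \<kappa> that by blast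
      fix x assume "x \<in> ?W"
      then obtain q where q: "x = snd \<kappa> q" "q \<in> fst \<kappa>" "q \<in> fst \<mu>" by blast
      show "(transition \<mu> \<nu> \<circ> transition \<kappa> \<mu>) x = transition \<kappa> \<nu> x"
        using inv[OF \<kappa>(1) q(2)] inv[OF that(1) q(3)] by (simp only: transition_def o_apply q(1))
    qed
  qed
  note comp = this
  have chain: "frechet_derivative (transition \<kappa> \<nu>) (at (snd \<kappa> p)) y =
      frechet_derivative (transition \<mu> \<nu>) (at (snd \<mu> p))
        (frechet_derivative (transition \<kappa> \<mu>) (at (snd \<kappa> p)) y)"
    if "\<mu> \<in> A" "\<nu> \<in> A" "p \<in> fst \<mu>" "p \<in> fst \<nu>" for \<mu> \<nu>
    using fun_cong[OF comp[OF that], of y] by (simp only: comp_apply)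
  show "tangent_vector A \<kappa> p y \<in> tangent_space A p"
    unfolding tangent_space_def mem_Collect_eq
  proof (intro conjI ballI allI impI)
    fix \<mu> \<nu> assume *: "\<mu> \<in> A" "\<nu> \<in> A" "p \<in> fst \<mu> \<and> p \<in> fst \<nu>"
    then have "tangent_vector A \<kappa> p y \<mu> = frechet_derivative (transition \<kappa> \<mu>) (at (snd \<kappa> p)) y"
      "tangent_vector A \<kappa> p y \<nu> = frechet_derivative (transition \<kappa> \<nu>) (at (snd \<kappa> p)) y"
      by (simp_all only: tangent_vector_def simp_thms if_True)
    then show "tangent_vector A \<kappa> p y \<nu> =
        frechet_derivative (transition \<mu> \<nu>) (at (snd \<mu> p)) (tangent_vector A \<kappa> p y \<mu>)"
      using chain[OF *(1,2) conjunct1[OF *(3)] conjunct2[OF *(3)]] by (simp only:)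
  qed (simp only: tangent_vector_def if_False)
qed

text \<open>Local coordinate expression \<open>F(x, y)\<close> of a function on the tangent bundle.\<close>

definition in_chart ::
    "('a, 'n::finite) chart set \<Rightarrow> ('a, 'n) chart \<Rightarrow> ('a \<Rightarrow> ('a, 'n) tvec \<Rightarrow> real)
      \<Rightarrow> real^'n \<Rightarrow> real^'n \<Rightarrow> real" where
  "in_chart A \<kappa> F x y = F (chart_inv \<kappa> x) (tangent_vector A \<kappa> (chart_inv \<kappa> x) y)"

definition smooth_function :: "('a, 'n::finite) chart set \<Rightarrow> ('a \<Rightarrow> real) \<Rightarrow> bool" where
  "smooth_function A c \<longleftrightarrow> (\<forall>\<kappa>\<in>A. smooth_on (chart_image \<kappa>) (c \<circ> chart_inv \<kappa>))"

definition one_form ::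
    "('a, 'n::finite) chart set \<Rightarrow> ('a \<Rightarrow> ('a, 'n) tvec \<Rightarrow> real) \<Rightarrow> bool" where
  "one_form A \<eta> \<longleftrightarrow> (\<forall>\<kappa>\<in>A.
     (\<forall>x\<in>chart_image \<kappa>. linear (in_chart A \<kappa> \<eta> x)) \<and>
     (\<forall>i. smooth_on (chart_image \<kappa>) (\<lambda>x. in_chart A \<kappa> \<eta> x (axis i 1))))"

definition closed_one_form ::
    "('a, 'n::finite) chart set \<Rightarrow> ('a \<Rightarrow> ('a, 'n) tvec \<Rightarrow> real) \<Rightarrow> bool" where
  "closed_one_form A \<eta> \<longleftrightarrow> one_form A \<eta> \<and>
     (\<forall>\<kappa>\<in>A. \<forall>x\<in>chart_image \<kappa>. \<forall>i j.
        partial_deriv i (\<lambda>x. in_chart A \<kappa> \<eta> x (axis j 1)) x =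
        partial_deriv j (\<lambda>x. in_chart A \<kappa> \<eta> x (axis i 1)) x)"

definition riemannian_metric ::
    "('a, 'n::finite) chart set \<Rightarrow> ('a \<Rightarrow> ('a, 'n) tvec \<Rightarrow> ('a, 'n) tvec \<Rightarrow> real) \<Rightarrow> bool" where
  "riemannian_metric A a \<longleftrightarrow> (\<forall>\<kappa>\<in>A. \<exists>h :: real^'n \<Rightarrow> real^'n^'n.
     (\<forall>i j. smooth_on (chart_image \<kappa>) (\<lambda>x. h x $ i $ j)) \<and>
     (\<forall>x\<in>chart_image \<kappa>. transpose (h x) = h x \<and>
        (\<forall>y. y \<noteq> 0 \<longrightarrow> y \<bullet> (h x *v y) > 0) \<and>
        (\<forall>y z. a (chart_inv \<kappa> x) (tangent_vector A \<kappa> (chart_inv \<kappa> x) y)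
                  (tangent_vector A \<kappa> (chart_inv \<kappa> x) z) = y \<bullet> (h x *v z))))"

section \<open>Finsler metrics on manifolds\<close>

definition finsler_metric ::
    "('a, 'n::finite) chart set \<Rightarrow> ('a \<Rightarrow> ('a, 'n) tvec \<Rightarrow> real) \<Rightarrow> bool" where
  "finsler_metric A F \<longleftrightarrow> (\<forall>\<kappa>\<in>A. finsler_on (chart_image \<kappa>) (in_chart A \<kappa> F))"

definition locally_projectively_flat ::
    "'a topology \<Rightarrow> ('a, 'n::finite) chart set \<Rightarrow> ('a \<Rightarrow> ('a, 'n) tvec \<Rightarrow> real) \<Rightarrow> bool" where
  "locally_projectively_flat T A F \<longleftrightarrow>
     (\<forall>p\<in>topspace T. \<exists>\<kappa>\<in>A. p \<in> fst \<kappa> \<and> projectively_flat_on (chart_image \<kappa>) (in_chart A \<kappa> F))"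

text \<open>\<open>S = (n + 1) (c F + \<eta>)\<close> on the slit tangent bundle.\<close>

definition almost_isotropic_S_curvature ::
    "('a, 'n::finite) chart set \<Rightarrow> ('a \<Rightarrow> ('a, 'n) tvec \<Rightarrow> real) \<Rightarrow> ('a \<Rightarrow> real)
      \<Rightarrow> ('a \<Rightarrow> ('a, 'n) tvec \<Rightarrow> real) \<Rightarrow> bool" where
  "almost_isotropic_S_curvature A F c \<eta> \<longleftrightarrow>
     smooth_function A c \<and> closed_one_form A \<eta> \<and>
     (\<forall>\<kappa>\<in>A. \<forall>x\<in>chart_image \<kappa>. \<forall>y. y \<noteq> 0 \<longrightarrow>
        S_curvature (in_chart A \<kappa> F) x y =
          (real CARD('n) + 1) * (c (chart_inv \<kappa> x) * in_chart A \<kappa> F x y + in_chart A \<kappa> \<eta> x y))"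

definition one_form_norm ::
    "('a, 'n::finite) chart set \<Rightarrow> ('a \<Rightarrow> ('a, 'n) tvec \<Rightarrow> ('a, 'n) tvec \<Rightarrow> real)
      \<Rightarrow> ('a \<Rightarrow> ('a, 'n) tvec \<Rightarrow> real) \<Rightarrow> 'a \<Rightarrow> real" where
  "one_form_norm A a \<beta> p =
     Sup {\<bar>\<beta> p v\<bar> / sqrt (a p v v) | v. v \<in> tangent_space A p \<and> v \<noteq> (\<lambda>_. 0)}"

definition randers_metric ::
    "'a topology \<Rightarrow> ('a, 'n::finite) chart set \<Rightarrow> ('a \<Rightarrow> ('a, 'n) tvec \<Rightarrow> real) \<Rightarrow> bool" where
  "randers_metric T A F \<longleftrightarrow> finsler_metric A F \<and>
     (\<exists>a \<beta>. riemannian_metric A a \<and> one_form A \<beta> \<and>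
        (\<forall>p\<in>topspace T. one_form_norm A a \<beta> p < 1 \<and>
           (\<forall>v\<in>tangent_space A p. F p v = sqrt (a p v v) + \<beta> p v)))"

end

theory Submission
  imports Defs
begin

text \<open>In projectively flat coordinates the \<open>S\<close>-curvature condition becomes
  \<open>F\<^sub>x = ((c F + \<theta>) F)\<^sub>y\<close> with a closed 1-form \<open>\<theta>\<close>. Its integrability condition gives, for
  \<open>n \<ge> 2\<close>, a quadratic equation \<open>\<Theta>(y, y) = 4 dc(y) F + \<tau> F\<^sup>2\<close> with \<open>\<Theta> = \<theta>\<^sup>2 - \<partial>\<theta>\<close> and
  \<open>\<tau>\<close> depending on \<open>x\<close> only, so \<open>F\<close> is of Randers type wherever \<open>\<tau> \<noteq> 0\<close>. Comparing \<open>y\<close>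
  with \<open>-y\<close> gives \<open>4 dc(y) = \<tau> (F(-y) - F(y))\<close>, and in the differentiated quadratic equation it gives
  \<open>d\<tau> = 8 c dc\<close> where \<open>\<tau> \<noteq> 0\<close>. Hence \<open>\<tau>\<close> solves a linear ODE along segments, and it vanishes
  near each of its zeros. There \<open>c\<close> is constant, and the indicatrices at nearby
  points are affine images of each other, so that being of Randers type is locally constant. Therefore the set of points of
  Randers type is open and closed; were it empty, \<open>c\<close> would be locally constant.\<close>

section \<open>Calculus of smooth functions\<close>

text \<open>The definitions create two analytic obstacles. Projective flatness speaks of the images
  of geodesics, so a geodesic with each initial velocity must be constructed before \<open>G\<close>
  is known to be a multiple of \<open>y\<close>. And \<open>S_curvature\<close> differentiates the
  volume of the moving set \<open>F x y < 1\<close>, while \<open>F\<close> need not be smooth at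
  \<open>y = 0\<close>; the volume is therefore expressed as an integral of a cutoff of
  \<open>F\<close> over a fixed box. This yields first derivatives only. Higher regularity of
  \<open>ln \<sigma>\<close>, needed for closedness of \<theta>, comes from the S-curvature identity
  itself, in which all other terms are smooth.

  At a zero of \<tau> the quadratic equation collapses to \<Theta> = 0 and dc = 0 and says nothing
  about \<open>F\<close>; this is why Randers type has to be carried over from neighbouring points.

  The restriction to n \<ge> 2 has two sources: the punctured space must be connected, and a linear
  form must have a nonzero kernel vector. On a line every metric is of Randers type.

  The Riemannian metric and the 1-form are read off from the even and odd parts of \<open>F\<close>,
  so they are smooth and globally defined without any choice.\<close>

definition dird :: "'a::real_normed_vector \<Rightarrow> ('a \<Rightarrow> 'b::real_normed_vector) \<Rightarrow> 'a \<Rightarrow> 'b" where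
  "dird v f x = frechet_derivative f (at x) v"

lemma frechet_derivative_cong_open:
  assumes "open S" "x \<in> S" "\<And>y. y \<in> S \<Longrightarrow> f y = g y"
  shows "frechet_derivative f (at x) = frechet_derivative g (at x)"
proof -
  have "(f has_derivative D) (at x) \<longleftrightarrow> (g has_derivative D) (at x)" for D
    using has_derivative_transform_within_open[of f D x UNIV S g]
      has_derivative_transform_within_open[of g D x UNIV S f] assms by auto
  then show ?thesis by (simp add: frechet_derivative_def)
qed

lemma differentiable_cong_open:
  assumes "open S" "x \<in> S" "\<And>y. y \<in> S \<Longrightarrow> f y = g y" "f differentiable (at x)"
  shows "g differentiable (at x)"
  using has_derivative_transform_within_open[of f _ x UNIV S g] assms
  unfolding differentiable_def by metis

lemma dird_cong_open:
  assumes "open S" "x \<in> S" "\<And>y. y \<in> S \<Longrightarrow> f y = g y"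
  shows "dird v f x = dird v g x"
  using frechet_derivative_cong_open[OF assms] by (simp add: dird_def)

lemma dird_eqI: "(f has_derivative D) (at x) \<Longrightarrow> dird v f x = D v"
  unfolding dird_def using frechet_derivative_at by metis

lemma has_derivative_dird:
  "f differentiable (at x) \<Longrightarrow> (f has_derivative (\<lambda>v. dird v f x)) (at x)"
  unfolding dird_def by (simp add: frechet_derivative_works)

lemma linear_dird: "f differentiable (at x) \<Longrightarrow> linear (\<lambda>v. dird v f x)"
  using has_derivative_dird has_derivative_linear by blast

lemma Ck_on_Suc_dird:
  "Ck_on (Suc k) S f \<longleftrightarrow> (\<forall>x\<in>S. f differentiable at x) \<and> (\<forall>v. Ck_on k S (dird v f))"
  by (simp add: dird_def[abs_def])

declare Ck_on.simps(2) [simp del]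

lemma Ck_on_SucD: "Ck_on (Suc k) S f \<Longrightarrow> Ck_on k S f"
proof (induction k arbitrary: f)
  case 0
  then show ?case
    by (auto simp: Ck_on_Suc_dird intro!: continuous_at_imp_continuous_on differentiable_imp_continuous_within)
next
  case (Suc k)
  then show ?case by (simp add: Ck_on_Suc_dird)
qed

lemma Ck_on_cong:
  assumes "open S" "\<And>x. x \<in> S \<Longrightarrow> f x = g x" "Ck_on k S f"
  shows "Ck_on k S g"
  using assms(2,3)
proof (induction k arbitrary: f g)
  case 0
  then show ?case using continuous_on_cong by (metis Ck_on.simps(1))
next
  case (Suc k)
  show ?case unfolding Ck_on_Suc_dird
  proof (intro conjI ballI allI)
    show "g differentiable (at x)" if "x \<in> S" for x
      by (rule differentiable_cong_open[OF assms(1) that Suc.prems(1)])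
        (use Suc.prems(2) that in \<open>auto simp: Ck_on_Suc_dird\<close>)
    show "Ck_on k S (dird v g)" for v
    proof (rule Suc.IH)
      show "dird v f x = dird v g x" if "x \<in> S" for x
        by (rule dird_cong_open[OF assms(1) that Suc.prems(1)])
      show "Ck_on k S (dird v f)" using Suc.prems(2) by (simp add: Ck_on_Suc_dird)
    qed
  qed
qed

lemma Ck_on_const: "Ck_on k S (\<lambda>x. a)"
proof (induction k arbitrary: a)
  case (Suc k)
  have "dird v (\<lambda>x::'a. a) = (\<lambda>x. 0)" for v by (rule ext, rule dird_eqI) (auto intro: derivative_eq_intros)
  then show ?case unfolding Ck_on_Suc_dird using Suc by simp
qed simp

lemma Ck_on_linear:
  assumes "bounded_linear L" shows "Ck_on k S L"
proof (cases k)
  case 0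
  then show ?thesis using assms by (simp add: linear_continuous_on)
next
  case (Suc j)
  have "dird v L = (\<lambda>x. L v)" for v
    by (rule ext, rule dird_eqI) (use assms bounded_linear_imp_has_derivative in auto)
  then show ?thesis unfolding Suc Ck_on_Suc_dird
    using assms Ck_on_const bounded_linear_imp_differentiable by metis
qed

lemma dird_add:
  "f differentiable (at x) \<Longrightarrow> g differentiable (at x) \<Longrightarrow> dird v (\<lambda>x. f x + g x) x = dird v f x + dird v g x"
  by (rule dird_eqI) (auto intro!: derivative_eq_intros has_derivative_dird)

lemma dird_mult:
  fixes f g :: "'a::real_normed_vector \<Rightarrow> real"
  shows "f differentiable (at x) \<Longrightarrow> g differentiable (at x) \<Longrightarrow>
    dird v (\<lambda>x. f x * g x) x = dird v f x * g x + f x * dird v g x"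
  by (subst dird_eqI[OF has_derivative_mult[OF has_derivative_dird has_derivative_dird]]) auto

lemma dird_sum:
  "finite I \<Longrightarrow> (\<And>i. i \<in> I \<Longrightarrow> f i differentiable (at x)) \<Longrightarrow>
    dird v (\<lambda>x. \<Sum>i\<in>I. f i x) x = (\<Sum>i\<in>I. dird v (f i) x)"
  by (rule dird_eqI) (auto intro!: derivative_eq_intros has_derivative_dird)

lemma dird_const: "dird v (\<lambda>x. a) x = 0"
  by (rule dird_eqI) (auto intro: derivative_eq_intros)

lemma dird_inverse:
  fixes f :: "'a::real_normed_vector \<Rightarrow> real"
  shows "f differentiable (at x) \<Longrightarrow> f x \<noteq> 0 \<Longrightarrow>
    dird v (\<lambda>x. inverse (f x)) x = - (dird v f x * (inverse (f x) * inverse (f x)))"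
  by (subst dird_eqI[OF Deriv.has_derivative_inverse[OF _ has_derivative_dird]]) auto

lemma Ck_on_add:
  assumes S: "open S"
  shows "Ck_on k S f \<Longrightarrow> Ck_on k S g \<Longrightarrow> Ck_on k S (\<lambda>x. f x + g x)"
proof (induction k arbitrary: f g)
  case 0
  then show ?case by (auto intro: continuous_on_add)
next
  case (Suc k)
  have "Ck_on k S (dird v (\<lambda>x. f x + g x))" for v
    by (rule Ck_on_cong[OF S _ Suc.IH[of "dird v f" "dird v g"]])
      (use Suc.prems in \<open>auto simp: Ck_on_Suc_dird dird_add\<close>)
  then show ?case using Suc.prems by (auto simp: Ck_on_Suc_dird)
qed

lemma Ck_on_sum:
  assumes S: "open S" and "finite I" "\<And>i. i \<in> I \<Longrightarrow> Ck_on k S (f i)"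
  shows "Ck_on k S (\<lambda>x. \<Sum>i\<in>I. f i x)"
  using assms(2,3) by (induction I rule: finite_induct) (auto intro: Ck_on_const Ck_on_add[OF S])

lemma Ck_on_mult:
  fixes f g :: "'a::real_normed_vector \<Rightarrow> real"
  assumes S: "open S"
  shows "Ck_on k S f \<Longrightarrow> Ck_on k S g \<Longrightarrow> Ck_on k S (\<lambda>x. f x * g x)"
proof (induction k arbitrary: f g)
  case 0
  then show ?case by (auto intro: continuous_on_mult)
next
  case (Suc k)
  have "Ck_on k S (dird v (\<lambda>x. f x * g x))" for v
    by (rule Ck_on_cong[OF S _ Ck_on_add[OF S Suc.IH[of "dird v f" g] Suc.IH[of f "dird v g"]]])
      (use Suc.prems Ck_on_SucD in \<open>auto simp: Ck_on_Suc_dird dird_mult\<close>)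
  then show ?case using Suc.prems by (auto simp: Ck_on_Suc_dird)
qed

lemma Ck_on_minus:
  fixes f :: "'a::real_normed_vector \<Rightarrow> real"
  assumes S: "open S" and "Ck_on k S f" shows "Ck_on k S (\<lambda>x. - f x)"
  using Ck_on_mult[OF S Ck_on_const[of _ _ "-1"] assms(2)] by simp

lemma Ck_on_diff:
  fixes f g :: "'a::real_normed_vector \<Rightarrow> real"
  assumes S: "open S" and "Ck_on k S f" "Ck_on k S g" shows "Ck_on k S (\<lambda>x. f x - g x)"
  using Ck_on_add[OF S assms(2) Ck_on_minus[OF S assms(3)]] by simp

lemma Ck_on_prod:
  fixes f :: "'i \<Rightarrow> 'a::real_normed_vector \<Rightarrow> real"
  assumes S: "open S" and "finite I" "\<And>i. i \<in> I \<Longrightarrow> Ck_on k S (f i)"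
  shows "Ck_on k S (\<lambda>x. \<Prod>i\<in>I. f i x)"
  using assms(2,3) by (induction I rule: finite_induct) (auto intro: Ck_on_const Ck_on_mult[OF S])

lemma Ck_on_inverse:
  fixes f :: "'a::real_normed_vector \<Rightarrow> real"
  assumes S: "open S" and nz: "\<And>x. x \<in> S \<Longrightarrow> f x \<noteq> 0"
  shows "Ck_on k S f \<Longrightarrow> Ck_on k S (\<lambda>x. inverse (f x))"
proof (induction k)
  case 0
  then show ?case using nz by (auto intro: continuous_on_inverse)
next
  case (Suc k)
  have 1: "Ck_on k S (\<lambda>x. inverse (f x))" using Suc Ck_on_SucD by blast
  have "Ck_on k S (dird v (\<lambda>x. inverse (f x)))" for v
    by (rule Ck_on_cong[OF S _ Ck_on_minus[OF S Ck_on_mult[OF S _ Ck_on_mult[OF S 1 1]], of "dird v f"]])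
      (use Suc.prems nz in \<open>auto simp: Ck_on_Suc_dird dird_inverse\<close>)
  then show ?case using Suc.prems nz by (auto simp: Ck_on_Suc_dird intro: differentiable_inverse)
qed

lemma dird_affine:
  assumes "f differentiable (at (a + L x))" "bounded_linear L"
  shows "dird v (\<lambda>x. f (a + L x)) x = dird (L v) f (a + L x)"
    and "(\<lambda>x. f (a + L x)) differentiable (at x)"
proof -
  have "((\<lambda>x. a + L x) has_derivative L) (at x)"
    by (auto intro!: derivative_eq_intros bounded_linear_imp_has_derivative assms)
  from diff_chain_at[OF this has_derivative_dird[OF assms(1)]]
  have *: "((\<lambda>x. f (a + L x)) has_derivative (\<lambda>v. dird (L v) f (a + L x))) (at x)"
    by (simp add: o_def)
  show "dird v (\<lambda>x. f (a + L x)) x = dird (L v) f (a + L x)"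
    by (rule dird_eqI[OF *])
  show "(\<lambda>x. f (a + L x)) differentiable (at x)" using * differentiable_def by blast
qed

text \<open>An affine inner map has constant derivative, so \<open>dird v\<close> of the composite
  is again a composite of the same kind and the induction closes. It serves the slices of a function
  on pairs at a fixed \<open>y\<close>.\<close>

lemma Ck_on_affine:
  assumes T: "open T" "\<And>x. x \<in> T \<Longrightarrow> a + L x \<in> S" and L: "bounded_linear L"
  shows "Ck_on k S f \<Longrightarrow> Ck_on k T (\<lambda>x. f (a + L x))"
proof (induction k arbitrary: f)
  case 0
  have "continuous_on T (\<lambda>x. a + L x)"
    by (intro continuous_intros linear_continuous_on L)
  then show ?case using 0 T(2) by (auto intro: continuous_on_compose2)
next
  case (Suc k)
  have "Ck_on k T (dird v (\<lambda>x. f (a + L x)))" for v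
    by (rule Ck_on_cong[OF T(1) _ Suc.IH[of "dird (L v) f"]])
      (use Suc.prems T in \<open>auto simp: Ck_on_Suc_dird dird_affine(1)[OF _ L]\<close>)
  then show ?case using Suc.prems T by (auto simp: Ck_on_Suc_dird intro!: dird_affine(2)[OF _ L])
qed

lemma smooth_on_differentiable: "smooth_on S f \<Longrightarrow> x \<in> S \<Longrightarrow> f differentiable (at x)"
  unfolding smooth_on_def using Ck_on_Suc_dird by blast

lemma smooth_on_dird: "smooth_on S f \<Longrightarrow> smooth_on S (dird v f)"
  unfolding smooth_on_def using Ck_on_Suc_dird by blast

lemma smooth_on_continuous: "smooth_on S f \<Longrightarrow> continuous_on S f"
  unfolding smooth_on_def using Ck_on.simps(1) by blast

lemma smooth_on_const: "smooth_on S (\<lambda>x. a)"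
  by (simp add: smooth_on_def Ck_on_const)

lemma smooth_on_linear: "bounded_linear L \<Longrightarrow> smooth_on S L"
  by (simp add: smooth_on_def Ck_on_linear)

lemma smooth_on_cong:
  "smooth_on S f \<Longrightarrow> open S \<Longrightarrow> (\<And>x. x \<in> S \<Longrightarrow> f x = g x) \<Longrightarrow> smooth_on S g"
  unfolding smooth_on_def using Ck_on_cong by metis

lemma smooth_on_add: "open S \<Longrightarrow> smooth_on S f \<Longrightarrow> smooth_on S g \<Longrightarrow> smooth_on S (\<lambda>x. f x + g x)"
  by (simp add: smooth_on_def Ck_on_add)

lemma smooth_on_sum:
  "open S \<Longrightarrow> finite I \<Longrightarrow> (\<And>i. i \<in> I \<Longrightarrow> smooth_on S (f i)) \<Longrightarrow> smooth_on S (\<lambda>x. \<Sum>i\<in>I. f i x)"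
  by (simp add: smooth_on_def Ck_on_sum)

lemma smooth_on_real_ops:
  fixes f g :: "'a::real_normed_vector \<Rightarrow> real"
  assumes "open S" "smooth_on S f" "smooth_on S g"
  shows smooth_on_mult: "smooth_on S (\<lambda>x. f x * g x)"
    and smooth_on_diff: "smooth_on S (\<lambda>x. f x - g x)"
  using assms by (simp_all add: smooth_on_def Ck_on_mult Ck_on_diff)

lemma smooth_on_prod:
  fixes f :: "'i \<Rightarrow> 'a::real_normed_vector \<Rightarrow> real"
  shows "open S \<Longrightarrow> finite I \<Longrightarrow> (\<And>i. i \<in> I \<Longrightarrow> smooth_on S (f i)) \<Longrightarrow> smooth_on S (\<lambda>x. \<Prod>i\<in>I. f i x)"
  by (simp add: smooth_on_def Ck_on_prod)

lemma smooth_on_divide: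
  fixes f g :: "'a::real_normed_vector \<Rightarrow> real"
  assumes "open S" "smooth_on S f" "smooth_on S g" "\<And>x. x \<in> S \<Longrightarrow> g x \<noteq> 0"
  shows "smooth_on S (\<lambda>x. f x / g x)"
  using assms by (simp add: smooth_on_def Ck_on_mult Ck_on_inverse divide_inverse)

lemma smooth_on_affine:
  assumes "open T" "\<And>x. x \<in> T \<Longrightarrow> a + L x \<in> S" "bounded_linear L" "smooth_on S f"
  shows "smooth_on T (\<lambda>x. f (a + L x))"
  using Ck_on_affine assms unfolding smooth_on_def by blast

lemma real_has_derivative_line:
  fixes f :: "'a::real_normed_vector \<Rightarrow> real"
  assumes "f differentiable (at (a + s *\<^sub>R u))"
  shows "((\<lambda>s. f (a + s *\<^sub>R u)) has_real_derivative dird u f (a + s *\<^sub>R u)) (at s)"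
proof -
  have "((\<lambda>s. a + s *\<^sub>R u) has_derivative (\<lambda>h. h *\<^sub>R u)) (at s)"
    by (auto intro!: derivative_eq_intros)
  from diff_chain_at[OF this has_derivative_dird[OF assms]]
  have "((\<lambda>s. f (a + s *\<^sub>R u)) has_derivative (\<lambda>h. dird (h *\<^sub>R u) f (a + s *\<^sub>R u))) (at s)"
    by (simp add: o_def)
  moreover have "dird (h *\<^sub>R u) f (a + s *\<^sub>R u) = dird u f (a + s *\<^sub>R u) * h" for h
    using linear_cmul[OF linear_dird[OF assms], of h u] by simp
  ultimately show ?thesis by (simp add: has_field_derivative_def)
qed

text \<open>The second difference \<open>f(x+hu+hv) - f(x+hu) - f(x+hv) + f(x)\<close> is \<open>h\<^sup>2\<close> times the mixed second
  derivative at some intermediate point, in either order of differentiation.\<close>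

lemma second_difference_mvt:
  fixes f :: "'a::real_normed_vector \<Rightarrow> real"
  assumes B: "\<And>s t. 0 \<le> s \<Longrightarrow> s \<le> h \<Longrightarrow> 0 \<le> t \<Longrightarrow> t \<le> h \<Longrightarrow> x + s *\<^sub>R u + t *\<^sub>R v \<in> S"
    and f: "Ck_on 2 S f" and h: "h > 0"
  shows "\<exists>s t. 0 \<le> s \<and> s \<le> h \<and> 0 \<le> t \<and> t \<le> h \<and>
    f (x + h *\<^sub>R u + h *\<^sub>R v) - f (x + h *\<^sub>R u) - f (x + h *\<^sub>R v) + f x =
    h * h * dird v (dird u f) (x + s *\<^sub>R u + t *\<^sub>R v)"
proof -
  have d: "f differentiable (at y)" "dird w f differentiable (at y)" if "y \<in> S" for y w
    using f that by (auto simp: numeral_2_eq_2 Ck_on_Suc_dird)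
  define \<phi> where "\<phi> s = f ((x + h *\<^sub>R v) + s *\<^sub>R u) - f (x + s *\<^sub>R u)" for s
  have "(\<phi> has_real_derivative dird u f ((x + h *\<^sub>R v) + s *\<^sub>R u) - dird u f (x + s *\<^sub>R u)) (at s)"
    if "0 \<le> s" "s \<le> h" for s
    unfolding \<phi>_def
    by (rule DERIV_diff; rule real_has_derivative_line; rule d)
      (use B[OF that, of h] B[OF that, of 0] h in \<open>auto simp: algebra_simps\<close>)
  from MVT2[OF h this] obtain s where s: "0 < s" "s < h"
    and 1: "\<phi> h - \<phi> 0 = (h - 0) * (dird u f ((x + h *\<^sub>R v) + s *\<^sub>R u) - dird u f (x + s *\<^sub>R u))"
    by auto
  have "((\<lambda>t. dird u f ((x + s *\<^sub>R u) + t *\<^sub>R v)) has_real_derivative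
      dird v (dird u f) ((x + s *\<^sub>R u) + t *\<^sub>R v)) (at t)" if "0 \<le> t" "t \<le> h" for t
    by (rule real_has_derivative_line; rule d) (use B[of s t] s that in auto)
  from MVT2[OF h this] obtain t where t: "0 < t" "t < h"
    and 2: "dird u f ((x + s *\<^sub>R u) + h *\<^sub>R v) - dird u f ((x + s *\<^sub>R u) + 0 *\<^sub>R v) =
      (h - 0) * dird v (dird u f) ((x + s *\<^sub>R u) + t *\<^sub>R v)"
    by auto
  have "f (x + h *\<^sub>R u + h *\<^sub>R v) - f (x + h *\<^sub>R u) - f (x + h *\<^sub>R v) + f x = \<phi> h - \<phi> 0"
    by (simp add: \<phi>_def algebra_simps)
  also have "\<dots> = h * h * dird v (dird u f) (x + s *\<^sub>R u + t *\<^sub>R v)"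
    using 1 2 by (simp add: algebra_simps)
  finally show ?thesis using s t less_imp_le by metis
qed

text \<open>One and the same second difference is \<open>h * h\<close> times either mixed derivative
  at some point close to \<open>x\<close>, so by continuity the two values at \<open>x\<close>
  cannot differ. Stated for \<open>C^2\<close> because \<open>ln \<sigma>\<close> is at first known
  only to that order.\<close>

lemma dird_commute:
  fixes f :: "'a::real_normed_vector \<Rightarrow> real"
  assumes S: "open S" "x \<in> S" and f: "Ck_on 2 S f"
  shows "dird u (dird v f) x = dird v (dird u f) x"
proof (rule ccontr)
  assume ne: "dird u (dird v f) x \<noteq> dird v (dird u f) x"
  define e where "e = \<bar>dird u (dird v f) x - dird v (dird u f) x\<bar> / 2"
  have e: "e > 0" using ne by (simp add: e_def)
  have cont: "continuous_on S (dird a (dird b f))" for a b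
    using f by (auto simp: numeral_2_eq_2 Ck_on_Suc_dird)
  obtain d1 where d1: "d1 > 0" "\<And>y. y \<in> S \<Longrightarrow> dist y x < d1 \<Longrightarrow> dist (dird u (dird v f) y) (dird u (dird v f) x) < e"
    using cont[of u v] S e unfolding continuous_on_iff by blast
  obtain d2 where d2: "d2 > 0" "\<And>y. y \<in> S \<Longrightarrow> dist y x < d2 \<Longrightarrow> dist (dird v (dird u f) y) (dird v (dird u f) x) < e"
    using cont[of v u] S e unfolding continuous_on_iff by blast
  obtain d3 where d3: "d3 > 0" "ball x d3 \<subseteq> S" using S open_contains_ball by blast
  define d where "d = min d1 (min d2 d3)"
  \<comment> \<open>Keeps the whole parallelogram spanned by \<open>h u\<close> and
    \<open>h v\<close> within distance \<open>d\<close> of \<open>x\<close>; the summand 1 guards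
    against \<open>u = v = 0\<close>.\<close>
  define h where "h = d / (2 * (norm u + norm v + 1))"
  have d: "d > 0" using d1 d2 d3 by (simp add: d_def)
  have N: "norm u + norm v + 1 > 0" by (simp add: add_nonneg_pos)
  have h: "h > 0" using d N by (simp add: h_def)
  have near: "dist (x + s *\<^sub>R a + t *\<^sub>R b) x < d"
    if "0 \<le> s" "s \<le> h" "0 \<le> t" "t \<le> h" "a = u \<and> b = v \<or> a = v \<and> b = u" for s t a b
  proof -
    have "dist (x + s *\<^sub>R a + t *\<^sub>R b) x = norm (s *\<^sub>R a + t *\<^sub>R b)"
      by (simp add: dist_norm algebra_simps)
    also have "\<dots> \<le> s * norm a + t * norm b"
      using norm_triangle_ineq[of "s *\<^sub>R a" "t *\<^sub>R b"] that by simp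
    also have "\<dots> \<le> h * norm a + h * norm b" using that by (intro add_mono mult_right_mono) auto
    also have "\<dots> = h * (norm u + norm v)" using that(5) by (auto simp: algebra_simps)
    also have "\<dots> < h * (2 * (norm u + norm v + 1))" using h by (simp add: algebra_simps add_strict_increasing)
    also have "\<dots> = d" using N unfolding h_def by simp
    finally show ?thesis .
  qed
  have inS: "y \<in> S" if "dist y x < d" for y
    using that d3 by (auto simp: d_def dist_commute)
  have 1: "\<exists>s t. 0 \<le> s \<and> s \<le> h \<and> 0 \<le> t \<and> t \<le> h \<and>
    f (x + h *\<^sub>R u + h *\<^sub>R v) - f (x + h *\<^sub>R u) - f (x + h *\<^sub>R v) + f x =
    h * h * dird v (dird u f) (x + s *\<^sub>R u + t *\<^sub>R v)"
    by (rule second_difference_mvt[OF inS f h]) (rule near, auto)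
  have 2: "\<exists>s t. 0 \<le> s \<and> s \<le> h \<and> 0 \<le> t \<and> t \<le> h \<and>
    f (x + h *\<^sub>R v + h *\<^sub>R u) - f (x + h *\<^sub>R v) - f (x + h *\<^sub>R u) + f x =
    h * h * dird u (dird v f) (x + s *\<^sub>R v + t *\<^sub>R u)"
    by (rule second_difference_mvt[OF inS f h]) (rule near, auto)
  obtain y where y: "dist y x < d"
    "f (x + h *\<^sub>R u + h *\<^sub>R v) - f (x + h *\<^sub>R u) - f (x + h *\<^sub>R v) + f x = h * h * dird v (dird u f) y"
    using 1 near by blast
  obtain z where z: "dist z x < d"
    "f (x + h *\<^sub>R v + h *\<^sub>R u) - f (x + h *\<^sub>R v) - f (x + h *\<^sub>R u) + f x = h * h * dird u (dird v f) z"
    using 2 near by blast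
  have "h * h * dird v (dird u f) y = h * h * dird u (dird v f) z"
    using y(2) z(2) by (simp add: algebra_simps)
  then have eq: "dird v (dird u f) y = dird u (dird v f) z" using h by simp
  have "dist (dird v (dird u f) y) (dird v (dird u f) x) < e"
    using d2(2)[OF inS[OF y(1)]] y(1) by (simp add: d_def)
  moreover have "dist (dird u (dird v f) z) (dird u (dird v f) x) < e"
    using d1(2)[OF inS[OF z(1)]] z(1) by (simp add: d_def)
  ultimately have "\<bar>dird u (dird v f) x - dird v (dird u f) x\<bar> < 2 * e"
    using eq by (simp add: dist_real_def)
  then show False by (simp add: e_def)
qed

lemma smooth_on_dird_commute:
  fixes f :: "'a::real_normed_vector \<Rightarrow> real"
  shows "open S \<Longrightarrow> x \<in> S \<Longrightarrow> smooth_on S f \<Longrightarrow> dird u (dird v f) x = dird v (dird u f) x"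
  using dird_commute unfolding smooth_on_def by blast

section \<open>Local existence for ordinary differential equations\<close>

text \<open>Continuity is known only for \<open>dird b f\<close> with \<open>b\<close> fixed. The
  bounds for the finitely many basis directions add up to a bound of the whole derivative, and the
  ball is convex.\<close>

lemma C1_imp_locally_lipschitz_real:
  fixes f :: "'a::euclidean_space \<Rightarrow> real"
  assumes S: "cball x0 r \<subseteq> S" and f: "Ck_on 1 S f"
  shows "\<exists>L\<ge>0. \<forall>x\<in>cball x0 r. \<forall>y\<in>cball x0 r. \<bar>f x - f y\<bar> \<le> L * dist x y"
proof -
  have d: "f differentiable (at x)" if "x \<in> cball x0 r" for x
    using f that S by (auto simp: Ck_on_Suc_dird)
  have "\<exists>K. \<forall>x\<in>cball x0 r. \<bar>dird b f x\<bar> \<le> K" for b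
  proof -
    have "continuous_on (cball x0 r) (dird b f)"
      using f S by (auto simp: Ck_on_Suc_dird intro: continuous_on_subset)
    then have "bounded (dird b f ` cball x0 r)"
      by (intro compact_imp_bounded compact_continuous_image) auto
    then show ?thesis by (auto simp: bounded_iff)
  qed
  then obtain K where K: "\<And>b x. x \<in> cball x0 r \<Longrightarrow> \<bar>dird b f x\<bar> \<le> K b" by metis
  define L where "L = (\<Sum>b\<in>Basis. \<bar>K b\<bar>)"
  have L0: "L \<ge> 0" by (simp add: L_def sum_nonneg)
  have bnd: "norm (dird v f x) \<le> L * norm v" if x: "x \<in> cball x0 r" for v x
  proof -
    have "dird v f x = dird (\<Sum>b\<in>Basis. (v \<bullet> b) *\<^sub>R b) f x" by (simp add: euclidean_representation)
    also have "\<dots> = (\<Sum>b\<in>Basis. (v \<bullet> b) * dird b f x)"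
      by (simp add: linear_sum[OF linear_dird[OF d[OF x]]] linear_cmul[OF linear_dird[OF d[OF x]]])
    finally have "norm (dird v f x) \<le> (\<Sum>b\<in>Basis. norm ((v \<bullet> b) * dird b f x))"
      by (simp only: norm_sum)
    also have "\<dots> \<le> (\<Sum>b\<in>Basis. norm v * \<bar>K b\<bar>)"
    proof (rule sum_mono)
      fix b :: 'a assume "b \<in> Basis"
      then have "\<bar>v \<bullet> b\<bar> \<le> norm v" by (simp add: Basis_le_norm)
      moreover have "\<bar>dird b f x\<bar> \<le> \<bar>K b\<bar>" using K[OF x, of b] by simp
      ultimately show "norm ((v \<bullet> b) * dird b f x) \<le> norm v * \<bar>K b\<bar>"
        by (simp add: abs_mult mult_mono)
    qed
    also have "\<dots> = L * norm v" by (simp add: L_def sum_distrib_left sum_distrib_right mult.commute)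
    finally show ?thesis .
  qed
  have "norm (f x - f y) \<le> L * norm (x - y)" if "x \<in> cball x0 r" "y \<in> cball x0 r" for x y
  proof (rule differentiable_bound[OF convex_cball _ _ that])
    fix z assume z: "z \<in> cball x0 r"
    show "(f has_derivative (\<lambda>v. dird v f z)) (at z within cball x0 r)"
      using has_derivative_dird[OF d[OF z]] has_derivative_at_withinI by blast
    show "onorm (\<lambda>v. dird v f z) \<le> L" by (rule onorm_bound[OF L0 bnd[OF z]])
  qed
  then show ?thesis using L0 by (auto simp: dist_norm)
qed

lemma C1_imp_locally_lipschitz:
  fixes f :: "'a::euclidean_space \<Rightarrow> 'b::euclidean_space"
  assumes S: "cball x0 r \<subseteq> S" and f: "\<And>b. b \<in> Basis \<Longrightarrow> Ck_on 1 S (\<lambda>x. f x \<bullet> b)"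
  shows "\<exists>L\<ge>0. \<forall>x\<in>cball x0 r. \<forall>y\<in>cball x0 r. dist (f x) (f y) \<le> L * dist x y"
proof -
  have "\<forall>b\<in>Basis. \<exists>L\<ge>0. \<forall>x\<in>cball x0 r. \<forall>y\<in>cball x0 r. \<bar>f x \<bullet> b - f y \<bullet> b\<bar> \<le> L * dist x y"
    using C1_imp_locally_lipschitz_real[OF S f] by blast
  then obtain L where L: "\<And>b. b \<in> Basis \<Longrightarrow> L b \<ge> 0"
    "\<And>b x y. b \<in> Basis \<Longrightarrow> x \<in> cball x0 r \<Longrightarrow> y \<in> cball x0 r \<Longrightarrow>
      \<bar>f x \<bullet> b - f y \<bullet> b\<bar> \<le> L b * dist x y"
    by metis
  have "dist (f x) (f y) \<le> (\<Sum>b\<in>Basis. L b) * dist x y" if "x \<in> cball x0 r" "y \<in> cball x0 r" for x y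
  proof -
    have "dist (f x) (f y) \<le> (\<Sum>b\<in>Basis. \<bar>(f x - f y) \<bullet> b\<bar>)"
      unfolding dist_norm by (rule norm_le_l1)
    also have "\<dots> \<le> (\<Sum>b\<in>Basis. L b * dist x y)"
      by (rule sum_mono) (use L(2) that in \<open>simp add: inner_diff_left\<close>)
    finally show ?thesis by (simp add: sum_distrib_right)
  qed
  moreover have "(\<Sum>b\<in>Basis. L b) \<ge> 0" using L(1) by (simp add: sum_nonneg)
  ultimately show ?thesis by blast
qed

text \<open>Picard iteration as a contraction of the bounded continuous curves on the whole real
  line. Time is clamped to \<open>[-e, e]\<close> by \<open>cl\<close>, so the iterates are constant
  outside this interval and hence bounded.\<close>

lemma local_flow_exists_global:
  fixes f :: "'a::euclidean_space \<Rightarrow> 'a"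
  assumes lip: "\<And>x y. dist (f x) (f y) \<le> L * dist x y" and L: "L \<ge> 0"
    and bnd: "\<And>x. norm (f x) \<le> M" and e: "e > 0" "3 * e * L \<le> 1/2"
  shows "\<exists>\<gamma>. \<gamma> 0 = x0 \<and> (\<forall>t\<in>{-e<..<e}. dist (\<gamma> t) x0 \<le> 3 * e * M \<and>
    (\<gamma> has_vector_derivative f (\<gamma> t)) (at t))"
proof -
  define cl where "cl t = max (-e) (min e t)" for t :: real
  have cl: "cl t \<in> {-e..e}" for t using e by (auto simp: cl_def)
  have clc: "continuous_on UNIV cl" unfolding cl_def by (intro continuous_intros)
  have fc: "continuous_on UNIV f"
    by (rule lipschitz_on_continuous_on[of L]) (use lip L in \<open>auto simp: lipschitz_on_def\<close>)
  have M: "M \<ge> 0" using bnd[of undefined] norm_ge_zero order_trans by blast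
  \<comment> \<open>The difference of two integrals starting at \<open>-e\<close> is the oriented
    integral from 0 to \<open>cl t\<close>, also for negative times. The two intervals have lengths
    at most \<open>2 e\<close> and \<open>e\<close>, which is the origin of the factor 3 in the
    estimates.\<close>
  define T where "T \<gamma> t = x0 + (integral {-e..cl t} (\<lambda>s. f (\<gamma> s)) - integral {-e..0} (\<lambda>s. f (\<gamma> s)))"
    for \<gamma> t
  have fg: "continuous_on A (\<lambda>s. f (\<gamma> s))" if "continuous_on UNIV \<gamma>" for \<gamma> and A :: "real set"
    using continuous_on_compose2[OF fc that] continuous_on_subset by blast
  have int: "(\<lambda>s. f (\<gamma> s)) integrable_on {a..b}" if "continuous_on UNIV \<gamma>" for \<gamma> and a b :: real
    by (rule integrable_continuous_real[OF fg[OF that]])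
  have ib: "norm (integral {-e..b} g) \<le> (b + e) * K"
    if "g integrable_on {-e..b}" "\<And>s. norm (g s) \<le> K" "-e \<le> b" for g :: "real \<Rightarrow> 'a" and b K
  proof -
    have "norm (integral {-e..b} g) \<le> integral {-e..b} (\<lambda>s. K)"
      by (rule integral_norm_bound_integral) (use that in auto)
    then show ?thesis using that by (simp add: algebra_simps)
  qed
  have ib2: "norm (integral {-e..cl t} g - integral {-e..0} g) \<le> 3 * e * K"
    if "\<And>b. g integrable_on {-e..b}" "\<And>s. norm (g s) \<le> K" for g :: "real \<Rightarrow> 'a" and t K
  proof -
    have K: "K \<ge> 0" using that(2)[of 0] norm_ge_zero order_trans by blast
    have "norm (integral {-e..cl t} g - integral {-e..0} g) \<le> (cl t + e) * K + (0 + e) * K"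
      using norm_triangle_ineq4[of "integral {-e..cl t} g" "integral {-e..0} g"]
        ib[OF that, of "cl t"] ib[OF that, of 0] cl[of t] e by auto
    also have "\<dots> \<le> (e + e) * K + (0 + e) * K"
      using cl[of t] K by (intro add_mono mult_right_mono) auto
    finally show ?thesis by (simp add: algebra_simps)
  qed
  have Tb: "dist (T \<gamma> t) x0 \<le> 3 * e * M" if "continuous_on UNIV \<gamma>" for \<gamma> t
    using ib2[OF int[OF that] bnd] by (simp add: T_def dist_norm)
  have Tc: "T \<gamma> \<in> bcontfun" if c: "continuous_on UNIV \<gamma>" for \<gamma>
  proof -
    have "continuous_on {-e..e} (\<lambda>u. integral {-e..u} (\<lambda>s. f (\<gamma> s)))"
      by (rule indefinite_integral_continuous_1[OF int[OF c]])
    then have "continuous_on UNIV (\<lambda>t. integral {-e..cl t} (\<lambda>s. f (\<gamma> s)))"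
      by (rule continuous_on_compose2[OF _ clc]) (use cl in blast)
    then have "continuous_on UNIV (T \<gamma>)" unfolding T_def by (intro continuous_intros)
    moreover have "bounded (range (T \<gamma>))"
      unfolding bounded_def using Tb[OF c] by (auto simp: dist_commute)
    ultimately show ?thesis by (simp add: bcontfun_def)
  qed
  have cont: "continuous_on UNIV (apply_bcontfun g)" for g :: "real \<Rightarrow>\<^sub>C 'a"
    using apply_bcontfun[of g] by (simp add: bcontfun_def)
  define \<Phi> where "\<Phi> g = Bcontfun (T (apply_bcontfun g))" for g :: "real \<Rightarrow>\<^sub>C 'a"
  have \<Phi>: "apply_bcontfun (\<Phi> g) = T (apply_bcontfun g)" for g
    unfolding \<Phi>_def using Tc[OF cont] by (simp add: Bcontfun_inverse)
  have contr: "dist (\<Phi> g) (\<Phi> h) \<le> 1/2 * dist g h" for g h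
  proof (rule dist_bound)
    fix t
    let ?d = "\<lambda>s. f (apply_bcontfun g s) - f (apply_bcontfun h s)"
    have id: "integral {-e..b} ?d = integral {-e..b} (\<lambda>s. f (apply_bcontfun g s)) -
        integral {-e..b} (\<lambda>s. f (apply_bcontfun h s))" for b
      by (rule integral_diff[OF int[OF cont] int[OF cont]])
    have "dist (apply_bcontfun (\<Phi> g) t) (apply_bcontfun (\<Phi> h) t) =
        norm (integral {-e..cl t} ?d - integral {-e..0} ?d)"
      unfolding \<Phi> T_def dist_norm id by (rule arg_cong[of _ _ norm]) simp
    also have "\<dots> \<le> 3 * e * (L * dist g h)"
    proof (rule ib2)
      show "?d integrable_on {-e..b}" for b by (intro integrable_diff int cont)
      show "norm (?d s) \<le> L * dist g h" for s
        using order_trans[OF lip[of "apply_bcontfun g s" "apply_bcontfun h s"]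
            mult_left_mono[OF dist_bounded[of g s h] L]] unfolding dist_norm .
    qed
    also have "\<dots> = (3 * e * L) * dist g h" by simp
    also have "\<dots> \<le> 1/2 * dist g h" by (rule mult_right_mono[OF e(2)]) simp
    finally show "dist (apply_bcontfun (\<Phi> g) t) (apply_bcontfun (\<Phi> h) t) \<le> 1/2 * dist g h" .
  qed
  have "\<exists>!g. \<Phi> g = g"
    by (rule banach_fix_type[of "1/2"]) (simp_all only: contr, simp_all)
  then obtain g where g: "\<Phi> g = g" by (rule ex1E)
  define \<gamma> where "\<gamma> = apply_bcontfun g"
  have \<gamma>: "\<gamma> t = T \<gamma> t" for t using \<Phi>[of g] g by (simp add: \<gamma>_def)
  have c: "continuous_on UNIV \<gamma>" using cont by (simp add: \<gamma>_def)
  have "(\<gamma> has_vector_derivative f (\<gamma> t)) (at t)" if t: "t \<in> {-e<..<e}" for t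
  proof -
    have "((\<lambda>u. integral {-e..u} (\<lambda>s. f (\<gamma> s))) has_vector_derivative f (\<gamma> t)) (at t within {-e..e})"
      by (rule integral_has_vector_derivative[OF fg[OF c]]) (use t in auto)
    then have "((\<lambda>u. integral {-e..u} (\<lambda>s. f (\<gamma> s))) has_vector_derivative f (\<gamma> t)) (at t)"
      using at_within_Icc_at[of "-e" t e] t by simp
    then have "((\<lambda>u. x0 + (integral {-e..u} (\<lambda>s. f (\<gamma> s)) - integral {-e..0} (\<lambda>s. f (\<gamma> s))))
        has_vector_derivative f (\<gamma> t)) (at t)"
      by (auto intro!: derivative_eq_intros)
    then show ?thesis
    proof (rule has_vector_derivative_transform_within_open)
      show "x0 + (integral {-e..u} (\<lambda>s. f (\<gamma> s)) - integral {-e..0} (\<lambda>s. f (\<gamma> s))) = \<gamma> u"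
        if "u \<in> {-e<..<e}" for u
      proof -
        have "cl u = u" using that by (auto simp: cl_def)
        then show ?thesis by (simp only: \<gamma>[of u] T_def)
      qed
    qed (use t in auto)
  qed
  moreover have "\<gamma> 0 = x0" using e by (subst \<gamma>) (simp add: T_def cl_def)
  moreover have "dist (\<gamma> t) x0 \<le> 3 * e * M" for t using Tb[OF c, of t] by (simp only: \<gamma>[symmetric])
  ultimately show ?thesis by blast
qed

text \<open>Composing with the (1-Lipschitz) nearest-point projection onto the ball makes the field global.\<close>

lemma local_flow_exists:
  fixes f :: "'a::euclidean_space \<Rightarrow> 'a"
  assumes lip: "\<And>x y. x \<in> cball x0 r \<Longrightarrow> y \<in> cball x0 r \<Longrightarrow> dist (f x) (f y) \<le> L * dist x y"
    and L: "L \<ge> 0" and r: "r > 0"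
  shows "\<exists>e>0. \<exists>\<gamma>. \<gamma> 0 = x0 \<and> (\<forall>t\<in>{-e<..<e}. \<gamma> t \<in> cball x0 r \<and>
    (\<gamma> has_vector_derivative f (\<gamma> t)) (at t))"
proof -
  define g where "g x = f (closest_point (cball x0 r) x)" for x
  have p: "closest_point (cball x0 r) x \<in> cball x0 r" for x
    by (rule closest_point_in_set) (use r in auto)
  have glip: "dist (g x) (g y) \<le> L * dist x y" for x y
  proof -
    have "dist (g x) (g y) \<le> L * dist (closest_point (cball x0 r) x) (closest_point (cball x0 r) y)"
      unfolding g_def using p by (intro lip)
    also have "\<dots> \<le> L * dist x y"
      using L r by (intro mult_left_mono closest_point_lipschitz) auto
    finally show ?thesis .
  qed
  define M where "M = norm (f x0) + L * r"
  have gb: "norm (g x) \<le> M" for x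
  proof -
    have "norm (g x - f x0) \<le> L * dist (closest_point (cball x0 r) x) x0"
      unfolding g_def dist_norm[symmetric] using p r by (intro lip) auto
    also have "\<dots> \<le> L * r" using L p[of x] by (intro mult_left_mono) (auto simp: dist_commute)
    finally show ?thesis unfolding M_def using norm_triangle_sub[of "g x" "f x0"] by linarith
  qed
  have M: "M \<ge> 0" using gb[of x0] norm_ge_zero order_trans by blast
  \<comment> \<open>The first term yields \<open>3 * e * L \<le> 1/2\<close>, the contraction
    condition; the second yields \<open>3 * e * M \<le> r\<close>, so that the curve stays in the
    ball, where \<open>g\<close> and \<open>f\<close> agree.\<close>
  define e where "e = min (1 / (6 * (L + 1))) (r / (3 * (M + 1)))"
  have e: "e > 0" using L M r by (simp add: e_def)
  have "e \<le> 1 / (6 * (L + 1))" by (simp add: e_def)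
  then have "e * (6 * (L + 1)) \<le> 1" using L by (subst (asm) pos_le_divide_eq) auto
  then have eL: "3 * e * L \<le> 1/2" using e by (simp add: algebra_simps)
  have "e \<le> r / (3 * (M + 1))" by (simp add: e_def)
  then have "e * (3 * (M + 1)) \<le> r" using M by (subst (asm) pos_le_divide_eq) auto
  then have eM: "3 * e * M \<le> r" using e by (simp add: algebra_simps)
  obtain \<gamma> where \<gamma>: "\<gamma> 0 = x0" "\<And>t. t \<in> {-e<..<e} \<Longrightarrow> dist (\<gamma> t) x0 \<le> 3 * e * M"
    "\<And>t. t \<in> {-e<..<e} \<Longrightarrow> (\<gamma> has_vector_derivative g (\<gamma> t)) (at t)"
    using local_flow_exists_global[OF glip L gb e eL, of x0] by blast
  have in_ball: "\<gamma> t \<in> cball x0 r" if "t \<in> {-e<..<e}" for t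
    using \<gamma>(2)[OF that] eM by (simp add: dist_commute)
  then have "(\<gamma> has_vector_derivative f (\<gamma> t)) (at t)" if "t \<in> {-e<..<e}" for t
    using \<gamma>(3)[OF that] that by (simp add: g_def closest_point_self)
  then show ?thesis using e \<gamma>(1) in_ball by blast
qed

section \<open>Geodesics of projectively flat metrics\<close>

lemma partial_deriv_dird: "partial_deriv i g x = dird (axis i 1) g x"
  by (simp add: partial_deriv_def dird_def)

lemma dird_slice_fst:
  assumes "f differentiable (at (x, y))"
  shows "dird v (\<lambda>x. f (x, y)) x = dird (v, 0) f (x, y)" "(\<lambda>x. f (x, y)) differentiable (at x)"
proof -
  have L: "bounded_linear (\<lambda>v::'a. (v, 0::'b))"
    by (intro bounded_linear_Pair bounded_linear_ident bounded_linear_zero)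
  show "dird v (\<lambda>x. f (x, y)) x = dird (v, 0) f (x, y)" "(\<lambda>x. f (x, y)) differentiable (at x)"
    using dird_affine[of f "(0, y)", OF _ L] assms by simp_all
qed

lemma dird_slice_snd:
  assumes "f differentiable (at (x, y))"
  shows "dird w (\<lambda>y. f (x, y)) y = dird (0, w) f (x, y)" "(\<lambda>y. f (x, y)) differentiable (at y)"
proof -
  have L: "bounded_linear (\<lambda>v::'b. (0::'a, v))"
    by (intro bounded_linear_Pair bounded_linear_ident bounded_linear_zero)
  show "dird w (\<lambda>y. f (x, y)) y = dird (0, w) f (x, y)" "(\<lambda>y. f (x, y)) differentiable (at y)"
    using dird_affine[of f "(x, 0)", OF _ L] assms by simp_all
qed

lemma vec_expand: "(v::real^'n) = (\<Sum>i\<in>UNIV. (v $ i) *\<^sub>R axis i 1)"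
  by (simp add: vec_eq_iff axis_def if_distrib[where f="\<lambda>a. _ * a"] cong: if_cong)

lemma linear_vec_expand:
  fixes h :: "real^'n \<Rightarrow> real"
  assumes "linear h" shows "h v = (\<Sum>i\<in>UNIV. v $ i * h (axis i 1))"
  by (subst vec_expand) (simp add: linear_sum[OF assms] linear_cmul[OF assms])

lemma dird_fst_expand:
  fixes f :: "(real^'n) \<times> 'b::real_normed_vector \<Rightarrow> real"
  assumes "f differentiable (at p)"
  shows "dird (v, 0) f p = (\<Sum>i\<in>UNIV. v $ i * dird (axis i 1, 0) f p)"
proof -
  have "linear (\<lambda>v. dird (v, 0) f p)"
    using linear_compose[OF _ linear_dird[OF assms], of "\<lambda>v. (v, 0)"]
    by (simp add: o_def linear_iff)
  then show ?thesis by (rule linear_vec_expand)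
qed

lemma dird_snd_expand:
  fixes f :: "'b::real_normed_vector \<times> (real^'n) \<Rightarrow> real"
  assumes "f differentiable (at p)"
  shows "dird (0, v) f p = (\<Sum>i\<in>UNIV. v $ i * dird (0, axis i 1) f p)"
proof -
  have "linear (\<lambda>v. dird (0, v) f p)"
    using linear_compose[OF _ linear_dird[OF assms], of "\<lambda>v. (0, v)"]
    by (simp add: o_def linear_iff)
  then show ?thesis by (rule linear_vec_expand)
qed

lemma bounded_linear_nth_snd: "bounded_linear (\<lambda>p::'b::real_normed_vector \<times> (real^'n). snd p $ i)"
  by (rule bounded_linear_compose[OF bounded_linear_vec_nth bounded_linear_snd])

lemma smooth_on_det:
  fixes M :: "'a::real_normed_vector \<Rightarrow> real^'n^'n"
  assumes "open S" "\<And>i j. smooth_on S (\<lambda>x. M x $ i $ j)"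
  shows "smooth_on S (\<lambda>x. det (M x))"
  unfolding det_def
  by (intro smooth_on_sum smooth_on_mult smooth_on_const smooth_on_prod assms finite_permutations) auto

locale finsler_domain =
  fixes V :: "(real^'n) set" and F :: "real^'n \<Rightarrow> real^'n \<Rightarrow> real"
  assumes open_V: "open V" and finsler: "finsler_on V F"
begin

definition W :: "((real^'n) \<times> (real^'n)) set" where "W = V \<times> (UNIV - {0})"
text \<open>Uncurried, so that x- and y-derivatives are \<open>dird (v, 0)\<close> and
  \<open>dird (0, w)\<close> of a single smooth function on an open set and commute by the general
  rule.\<close>

definition f :: "(real^'n) \<times> (real^'n) \<Rightarrow> real" where "f = (\<lambda>(x, y). F x y)"
definition E :: "(real^'n) \<times> (real^'n) \<Rightarrow> real" where "E = (\<lambda>p. (f p)\<^sup>2)"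

lemma f_eq: "f (x, y) = F x y" by (simp add: f_def)

lemma open_W: "open W" unfolding W_def by (intro open_Times open_V) auto

lemma in_W: "(x, y) \<in> W \<longleftrightarrow> x \<in> V \<and> y \<noteq> 0" by (simp add: W_def)

lemma smooth_f: "smooth_on W f" using finsler by (simp add: finsler_on_def W_def f_def)

lemma smooth_E: "smooth_on W E"
  unfolding E_def power2_eq_square by (rule smooth_on_mult[OF open_W smooth_f smooth_f])

lemma f_nonneg: "x \<in> V \<Longrightarrow> f (x, y) \<ge> 0"
  and f_eq_0: "x \<in> V \<Longrightarrow> f (x, y) = 0 \<longleftrightarrow> y = 0"
  and f_scale: "x \<in> V \<Longrightarrow> r \<ge> 0 \<Longrightarrow> f (x, r *\<^sub>R y) = r * f (x, y)"
  and pos_def: "x \<in> V \<Longrightarrow> y \<noteq> 0 \<Longrightarrow> v \<noteq> 0 \<Longrightarrow> v \<bullet> (fundamental_tensor F x y *v v) > 0"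
  using finsler by (simp_all add: finsler_on_def f_eq)

lemma f_pos: "(x, y) \<in> W \<Longrightarrow> f (x, y) > 0"
  using f_nonneg[of x y] f_eq_0[of x y] by (auto simp: in_W less_le)

lemma f_diff: "p \<in> W \<Longrightarrow> f differentiable (at p)"
  by (rule smooth_on_differentiable[OF smooth_f])

lemma E_diff: "p \<in> W \<Longrightarrow> E differentiable (at p)"
  by (rule smooth_on_differentiable[OF smooth_E])

lemma dE_diff: "p \<in> W \<Longrightarrow> dird v E differentiable (at p)"
  by (rule smooth_on_differentiable[OF smooth_on_dird[OF smooth_E]])

lemma df_diff: "p \<in> W \<Longrightarrow> dird v f differentiable (at p)"
  by (rule smooth_on_differentiable[OF smooth_on_dird[OF smooth_f]])

lemma euler: assumes "(x, y) \<in> W" shows "dird (0, y) f (x, y) = f (x, y)"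
proof -
  have "((\<lambda>s. f ((x, y) + s *\<^sub>R (0, y))) has_real_derivative dird (0, y) f ((x, y) + 0 *\<^sub>R (0, y))) (at 0)"
    by (rule real_has_derivative_line) (use f_diff[OF assms] in simp)
  then have 1: "((\<lambda>s. f ((x, y) + s *\<^sub>R (0, y))) has_real_derivative dird (0, y) f (x, y)) (at 0)"
    by simp
  have "((\<lambda>s. (1 + s) * f (x, y)) has_real_derivative f (x, y)) (at 0)"
    by (auto intro!: derivative_eq_intros)
  then have 2: "((\<lambda>s. f ((x, y) + s *\<^sub>R (0, y))) has_real_derivative f (x, y)) (at 0)"
  proof (rule has_field_derivative_transform_within_open)
    show "(1 + s) * f (x, y) = f ((x, y) + s *\<^sub>R (0, y))" if "s \<in> {-1<..<1}" for s
      using f_scale[of x "1 + s" y] that assms by (simp add: in_W scaleR_left_distrib)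
  qed auto
  show ?thesis by (rule DERIV_unique[OF 1 2])
qed

lemma dird_E: "p \<in> W \<Longrightarrow> dird v E p = 2 * f p * dird v f p"
  unfolding E_def power2_eq_square by (subst dird_mult) (auto simp: f_diff)

lemma dird_dird_E:
  assumes "p \<in> W"
  shows "dird u (dird v E) p = 2 * (dird u f p * dird v f p + f p * dird u (dird v f) p)"
proof -
  have "dird u (dird v E) p = dird u (\<lambda>p. (2 * f p) * dird v f p) p"
    by (rule dird_cong_open[OF open_W assms]) (simp add: dird_E)
  also have "\<dots> = 2 * dird u f p * dird v f p + 2 * f p * dird u (dird v f) p"
    using assms by (simp add: dird_mult dird_const f_diff df_diff)
  finally show ?thesis by (simp add: algebra_simps)
qed

lemma fundamental_tensor_eq:
  assumes "(x, y) \<in> W"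
  shows "fundamental_tensor F x y $ i $ j = 1/2 * dird (0, axis j 1) (dird (0, axis i 1) E) (x, y)"
proof -
  have x: "x \<in> V" and y: "y \<noteq> 0" using assms by (auto simp: in_W)
  have "dird (axis j 1) (\<lambda>y. dird (axis i 1) (\<lambda>y. E (x, y)) y) y = dird (axis j 1) (\<lambda>y. dird (0, axis i 1) E (x, y)) y"
    by (rule dird_cong_open[of "UNIV - {0}"]) (use x y in \<open>auto simp: dird_slice_snd(1)[OF E_diff] in_W\<close>)
  also have "\<dots> = dird (0, axis j 1) (dird (0, axis i 1) E) (x, y)"
    by (rule dird_slice_snd(1)[OF dE_diff[OF assms]])
  finally show ?thesis
    by (simp add: fundamental_tensor_def partial_deriv_dird[abs_def] E_def f_eq)
qed

text \<open>The covector \<open>[F^2]_{x^m y^l} y^m - [F^2]_{x^l}\<close>, that is, four times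
  \<open>G\<close> with its index lowered by the fundamental tensor.\<close>

definition spray_rhs :: "real^'n \<Rightarrow> real^'n \<Rightarrow> real^'n" where
  "spray_rhs x y = (\<chi> l. dird (y, 0) (dird (0, axis l 1) E) (x, y) - dird (axis l 1, 0) E (x, y))"

lemma geodesic_coeffs_eq:
  assumes "(x, y) \<in> W"
  shows "geodesic_coeffs F x y = (1/4) *\<^sub>R (matrix_inv (fundamental_tensor F x y) *v spray_rhs x y)"
proof -
  have x: "x \<in> V" and y: "y \<noteq> 0" using assms by (auto simp: in_W)
  have 1: "partial_deriv m (\<lambda>x. partial_deriv l (\<lambda>y. (F x y)\<^sup>2) y) x =
      dird (axis m 1, 0) (dird (0, axis l 1) E) (x, y)" for l m
  proof -
    have "dird (axis m 1) (\<lambda>x. dird (axis l 1) (\<lambda>y. E (x, y)) y) x =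
        dird (axis m 1) (\<lambda>x. dird (0, axis l 1) E (x, y)) x"
      by (rule dird_cong_open[OF open_V x]) (use y in \<open>auto simp: dird_slice_snd(1)[OF E_diff] in_W\<close>)
    also have "\<dots> = dird (axis m 1, 0) (dird (0, axis l 1) E) (x, y)"
      by (rule dird_slice_fst(1)[OF dE_diff[OF assms]])
    finally show ?thesis by (simp add: partial_deriv_dird E_def f_eq)
  qed
  have 2: "partial_deriv l (\<lambda>x. (F x y)\<^sup>2) x = dird (axis l 1, 0) E (x, y)" for l
    using dird_slice_fst(1)[OF E_diff[OF assms], of "axis l 1"] by (simp add: partial_deriv_dird E_def f_eq)
  have 3: "(\<Sum>m\<in>UNIV. partial_deriv m (\<lambda>x. partial_deriv l (\<lambda>y. (F x y)\<^sup>2) y) x * y $ m)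
      - partial_deriv l (\<lambda>x. (F x y)\<^sup>2) x = spray_rhs x y $ l" for l
    by (simp add: 1 2 spray_rhs_def dird_fst_expand[OF dE_diff[OF assms], of y] mult.commute)
  show ?thesis
    unfolding geodesic_coeffs_def 3 by (simp add: vec_eq_iff matrix_vector_mult_def)
qed

lemma fundamental_tensor_invertible:
  assumes "(x, y) \<in> W" shows "invertible (fundamental_tensor F x y)"
proof -
  have "v = 0" if "fundamental_tensor F x y *v v = 0" for v
    using pos_def[of x y v] assms that by (auto simp: in_W)
  then show ?thesis
    by (simp add: invertible_left_inverse matrix_left_invertible_ker)
qed

lemma fundamental_tensor_geodesic_coeffs:
  assumes "(x, y) \<in> W"
  shows "fundamental_tensor F x y *v geodesic_coeffs F x y = (1/4) *\<^sub>R spray_rhs x y"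
proof -
  have "fundamental_tensor F x y ** matrix_inv (fundamental_tensor F x y) = mat 1"
    using fundamental_tensor_invertible[OF assms] unfolding invertible_def matrix_inv_def
    by (rule someI_ex[THEN conjunct1])
  then show ?thesis
    by (simp add: geodesic_coeffs_eq[OF assms] matrix_vector_mult_scaleR matrix_vector_mul_assoc)
qed

text \<open>By Cramer's rule each component of \<open>G\<close> is a quotient of two determinants
  with smooth entries, so \<open>matrix_inv\<close> never has to be differentiated.\<close>

lemma smooth_geodesic_coeffs: "smooth_on W (\<lambda>p. geodesic_coeffs F (fst p) (snd p) $ k)"
proof -
  let ?g = "\<lambda>p. fundamental_tensor F (fst p) (snd p)"
  let ?b = "\<lambda>p. (1/4) *\<^sub>R spray_rhs (fst p) (snd p)"
  have g: "smooth_on W (\<lambda>p. ?g p $ i $ j)" for i j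
    by (rule smooth_on_cong[OF smooth_on_mult[OF open_W smooth_on_const[of _ "1/2"]
        smooth_on_dird[OF smooth_on_dird[OF smooth_E]]] open_W])
      (auto simp: fundamental_tensor_eq)
  have dd: "smooth_on W (dird v (dird w E))" for v w by (intro smooth_on_dird smooth_E)
  have y: "smooth_on W (\<lambda>p. snd p $ m)" for m by (rule smooth_on_linear[OF bounded_linear_nth_snd])
  have b: "smooth_on W (\<lambda>p. ?b p $ l)" for l
  proof (rule smooth_on_cong[OF _ open_W])
    show "smooth_on W (\<lambda>p. (1/4) * ((\<Sum>m\<in>UNIV. snd p $ m * dird (axis m 1, 0) (dird (0, axis l 1) E) p)
        - dird (axis l 1, 0) E p))"
      by (intro smooth_on_mult smooth_on_diff smooth_on_sum open_W smooth_on_const dd y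
          smooth_on_dird[OF smooth_E]) auto
    show "1/4 * ((\<Sum>m\<in>UNIV. snd p $ m * dird (axis m 1, 0) (dird (0, axis l 1) E) p)
        - dird (axis l 1, 0) E p) = ?b p $ l" if "p \<in> W" for p
      using dird_fst_expand[OF dE_diff[OF that], of "snd p"] by (simp add: spray_rhs_def)
  qed
  let ?C = "\<lambda>p. (\<chi> i j. if j = k then ?b p $ i else ?g p $ i $ j)"
  have "smooth_on W (\<lambda>p. ?C p $ i $ j)" for i j
    by (cases "j = k") (use b g in \<open>auto simp: fun_eq_iff\<close>)
  then have C: "smooth_on W (\<lambda>p. det (?C p))" by (intro smooth_on_det open_W)
  have D: "smooth_on W (\<lambda>p. det (?g p))" by (intro smooth_on_det open_W g)
  have nz: "det (?g p) \<noteq> 0" if "p \<in> W" for p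
    using fundamental_tensor_invertible[of "fst p" "snd p"] that by (simp add: invertible_det_nz)
  show ?thesis
  proof (rule smooth_on_cong[OF smooth_on_divide[OF open_W C D nz] open_W])
    fix p assume p: "p \<in> W"
    have "?g p *v geodesic_coeffs F (fst p) (snd p) = ?b p"
      using fundamental_tensor_geodesic_coeffs[of "fst p" "snd p"] p by simp
    then show "det (?C p) / det (?g p) = geodesic_coeffs F (fst p) (snd p) $ k"
      using cramer[OF nz[OF p]] by simp
  qed
qed

text \<open>The geodesic equation as a first order system for position and velocity. A flow that
  stays in a closed ball inside \<open>W\<close> keeps its velocity nonzero, as
  \<open>geodesic_on\<close> demands.\<close>

lemma geodesic_exists:
  assumes "(x, y) \<in> W"
  shows "\<exists>e>0. \<exists>X Y. X 0 = x \<and> Y 0 = y \<and> geodesic_on V F {-e<..<e} X \<and>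
    (\<forall>t\<in>{-e<..<e}. (X has_vector_derivative Y t) (at t) \<and>
      (Y has_vector_derivative - 2 *\<^sub>R geodesic_coeffs F (X t) (Y t)) (at t))"
proof -
  define \<Phi> where "\<Phi> p = (snd p, - 2 *\<^sub>R geodesic_coeffs F (fst p) (snd p))" for p
  obtain r where r: "r > 0" "cball (x, y) r \<subseteq> W"
    using open_W assms open_contains_cball by blast
  have comp: "Ck_on 1 W (\<lambda>p. \<Phi> p \<bullet> b)" if b: "b \<in> Basis" for b
  proof -
    have "smooth_on W (\<lambda>p. - 2 * geodesic_coeffs F (fst p) (snd p) $ k)" for k
      by (intro smooth_on_mult smooth_on_const open_W smooth_geodesic_coeffs)
    moreover have "smooth_on W (\<lambda>p. snd p $ k)" for k
      by (rule smooth_on_linear[OF bounded_linear_nth_snd])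
    moreover have "(\<exists>k. b = (axis k 1, 0)) \<or> (\<exists>k. b = (0, axis k 1))"
      using b by (auto simp: Basis_prod_def Basis_vec_def)
    ultimately show ?thesis
      by (auto simp: \<Phi>_def smooth_on_def inner_axis)
  qed
  obtain L where L: "L \<ge> 0"
    "\<And>p q. p \<in> cball (x, y) r \<Longrightarrow> q \<in> cball (x, y) r \<Longrightarrow> dist (\<Phi> p) (\<Phi> q) \<le> L * dist p q"
    using C1_imp_locally_lipschitz[OF r(2) comp] by blast
  obtain e \<gamma> where e: "e > 0" and \<gamma>: "\<gamma> 0 = (x, y)"
    "\<And>t. t \<in> {-e<..<e} \<Longrightarrow> \<gamma> t \<in> cball (x, y) r"
    "\<And>t. t \<in> {-e<..<e} \<Longrightarrow> (\<gamma> has_vector_derivative \<Phi> (\<gamma> t)) (at t)"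
    using local_flow_exists[OF L(2,1) r(1)] by blast
  have in_W': "\<gamma> t \<in> W" if "t \<in> {-e<..<e}" for t using \<gamma>(2)[OF that] r by blast
  define X Y where "X t = fst (\<gamma> t)" and "Y t = snd (\<gamma> t)" for t
  have X: "(X has_vector_derivative Y t) (at t)" if "t \<in> {-e<..<e}" for t
    using bounded_linear.has_vector_derivative[OF bounded_linear_fst \<gamma>(3)[OF that]]
    by (simp add: X_def[abs_def] Y_def \<Phi>_def)
  have Y: "(Y has_vector_derivative - 2 *\<^sub>R geodesic_coeffs F (X t) (Y t)) (at t)"
    if "t \<in> {-e<..<e}" for t
    using bounded_linear.has_vector_derivative[OF bounded_linear_snd \<gamma>(3)[OF that]]
    by (simp add: X_def Y_def[abs_def] \<Phi>_def)
  have "X t \<in> V \<and> Y t \<noteq> 0" if "t \<in> {-e<..<e}" for t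
    using in_W'[OF that] in_W[of "X t" "Y t"] by (simp add: X_def Y_def)
  then have "geodesic_on V F {-e<..<e} X"
    unfolding geodesic_on_def using X Y by (auto intro!: exI[of _ Y] is_interval_oo)
  moreover have "X 0 = x" "Y 0 = y" using \<gamma>(1) by (simp_all add: X_def Y_def)
  ultimately show ?thesis using e X Y by blast
qed

text \<open>A vector orthogonal to the direction \<open>u\<close> of the straight line is orthogonal
  to the velocity at all times and, after one more differentiation, to the acceleration. So
  \<open>y\<close> and \<open>G\<close> are both multiples of \<open>u\<close>, and
  \<open>y \<noteq> 0\<close> makes \<open>G\<close> a multiple of \<open>y\<close>.\<close>

lemma projectively_flat_spray:
  assumes pf: "projectively_flat_on V F" and xy: "(x, y) \<in> W"
  shows "\<exists>k. geodesic_coeffs F x y = k *\<^sub>R y"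
proof -
  obtain e X Y where e: "e > 0" and init: "X 0 = x" "Y 0 = y" and geo: "geodesic_on V F {-e<..<e} X"
    and X: "\<And>t. t \<in> {-e<..<e} \<Longrightarrow> (X has_vector_derivative Y t) (at t)"
    and Y: "\<And>t. t \<in> {-e<..<e} \<Longrightarrow> (Y has_vector_derivative - 2 *\<^sub>R geodesic_coeffs F (X t) (Y t)) (at t)"
    using geodesic_exists[OF xy] by blast
  let ?G = "geodesic_coeffs F x y"
  have "collinear (X ` {-e<..<e})" using pf geo by (simp add: projectively_flat_on_def)
  then obtain u where u: "\<And>s t. s \<in> {-e<..<e} \<Longrightarrow> t \<in> {-e<..<e} \<Longrightarrow> \<exists>c. X s - X t = c *\<^sub>R u"
    unfolding collinear_def by blast
  have perp: "w \<bullet> y = 0 \<and> w \<bullet> ?G = 0" if w: "w \<bullet> u = 0" for w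
  proof -
    have 1: "w \<bullet> Y t = 0" if t: "t \<in> {-e<..<e}" for t
    proof -
      have "((\<lambda>t. w \<bullet> X t) has_vector_derivative w \<bullet> Y t) (at t)"
        by (rule bounded_linear.has_vector_derivative[OF bounded_linear_inner_right X[OF t]])
      moreover have "((\<lambda>t. w \<bullet> X t) has_vector_derivative 0) (at t)"
      proof (rule has_vector_derivative_transform_within_open)
        show "((\<lambda>t. w \<bullet> X 0) has_vector_derivative 0) (at t)" by simp
        show "w \<bullet> X 0 = w \<bullet> X s" if "s \<in> {-e<..<e}" for s
        proof -
          obtain c where "X s - X 0 = c *\<^sub>R u" using u[OF \<open>s \<in> {-e<..<e}\<close>, of 0] e by auto
          then have "w \<bullet> (X s - X 0) = 0" using w by simp
          then show ?thesis by (simp add: inner_diff_right)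
        qed
      qed (use t in auto)
      ultimately show ?thesis by (rule vector_derivative_unique_at)
    qed
    have 0: "0 \<in> {-e<..<e}" using e by simp
    have "((\<lambda>t. w \<bullet> Y t) has_vector_derivative w \<bullet> (- 2 *\<^sub>R ?G)) (at 0)"
      using bounded_linear.has_vector_derivative[OF bounded_linear_inner_right Y[OF 0]] init by simp
    moreover have "((\<lambda>t. w \<bullet> Y t) has_vector_derivative 0) (at 0)"
      by (rule has_vector_derivative_transform_within_open[of "\<lambda>t. 0" _ _ "{-e<..<e}"])
        (use 0 1 in auto)
    ultimately have "w \<bullet> (- 2 *\<^sub>R ?G) = 0" by (rule vector_derivative_unique_at)
    then show ?thesis using 1[OF 0] init by simp
  qed
  \<comment> \<open>This includes \<open>u = 0\<close>: the quotient is then 0, and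
    \<open>z\<close>, being orthogonal to itself, vanishes.\<close>
  have par: "z = ((z \<bullet> u) / (u \<bullet> u)) *\<^sub>R u" if z: "\<And>w. w \<bullet> u = 0 \<Longrightarrow> w \<bullet> z = 0" for z
  proof -
    define w where "w = z - ((z \<bullet> u) / (u \<bullet> u)) *\<^sub>R u"
    have wu: "w \<bullet> u = 0" by (cases "u = 0") (simp_all add: w_def inner_diff_left)
    have "w \<bullet> w = w \<bullet> z - ((z \<bullet> u) / (u \<bullet> u)) * (w \<bullet> u)"
      by (subst (2) w_def) (simp add: inner_diff_right)
    then have "w \<bullet> w = 0" using wu z[OF wu] by simp
    then show ?thesis by (simp add: w_def)
  qed
  have y: "y = ((y \<bullet> u) / (u \<bullet> u)) *\<^sub>R u" using par[of y] perp by blast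
  have G: "?G = ((?G \<bullet> u) / (u \<bullet> u)) *\<^sub>R u" using par[of ?G] perp by blast
  have a: "(y \<bullet> u) / (u \<bullet> u) \<noteq> 0" using y xy by (metis in_W scaleR_zero_left)
  have "?G = (((?G \<bullet> u) / (u \<bullet> u)) / ((y \<bullet> u) / (u \<bullet> u))) *\<^sub>R y"
    by (subst G, subst (3) y) (use a in simp)
  then show ?thesis by blast
qed

end

section \<open>Projective factor, Rapcsak and Hamel equations\<close>

context finsler_domain
begin

text \<open>The direction of differentiation itself varies with \<open>y\<close>, so the product
  rule contributes the extra term with direction \<open>L w\<close>. Applied to \<open>f\<close>
  with both inclusions, it differentiates Euler's relation and the radial derivative
  \<open>F_{x^m} y^m\<close>.\<close>

lemma dird_radial:
  fixes g :: "(real^'n) \<times> (real^'n) \<Rightarrow> real" and L :: "real^'n \<Rightarrow> (real^'n) \<times> (real^'n)"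
  assumes g: "smooth_on W g" and p: "(x, y) \<in> W" and L: "linear L"
  shows "dird (0, w) (\<lambda>p. dird (L (snd p)) g p) (x, y) =
    dird (L w) g (x, y) + dird (0, w) (dird (L y) g) (x, y)"
proof -
  have d: "g differentiable (at p)" "dird v g differentiable (at p)" if "p \<in> W" for p v
    using smooth_on_differentiable[OF g that] smooth_on_differentiable[OF smooth_on_dird[OF g] that]
    by auto
  have ex: "dird (L v) g p = (\<Sum>i\<in>UNIV. v $ i * dird (L (axis i 1)) g p)" if "p \<in> W" for v p
    using linear_vec_expand[OF linear_compose[OF L linear_dird[OF d(1)[OF that]]], of v]
    unfolding o_def .
  have sd: "(\<lambda>p::(real^'n) \<times> (real^'n). snd p $ i) differentiable (at p)" for i p
    by (rule bounded_linear_imp_differentiable[OF bounded_linear_nth_snd])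
  have sd': "dird (0, w) (\<lambda>p::(real^'n) \<times> (real^'n). snd p $ i) (x, y) = w $ i" for i
    by (subst dird_eqI[OF bounded_linear_imp_has_derivative[OF bounded_linear_nth_snd]]) simp
  have dm: "(\<lambda>p. snd p $ i * dird (L (axis i 1)) g p) differentiable (at (x, y))" for i
    by (intro differentiable_mult sd d(2) p)
  have "dird (0, w) (\<lambda>p. dird (L (snd p)) g p) (x, y) =
      dird (0, w) (\<lambda>p. \<Sum>i\<in>UNIV. snd p $ i * dird (L (axis i 1)) g p) (x, y)"
    by (rule dird_cong_open[OF open_W p]) (rule ex)
  also have "\<dots> = (\<Sum>i\<in>UNIV. w $ i * dird (L (axis i 1)) g (x, y)
      + y $ i * dird (0, w) (dird (L (axis i 1)) g) (x, y))"
    by (simp add: dird_sum dm dird_mult sd d(2)[OF p] sd')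
  also have "\<dots> = dird (L w) g (x, y) + (\<Sum>i\<in>UNIV. y $ i * dird (0, w) (dird (L (axis i 1)) g) (x, y))"
    by (simp only: sum.distrib ex[OF p, of w, symmetric])
  also have "(\<Sum>i\<in>UNIV. y $ i * dird (0, w) (dird (L (axis i 1)) g) (x, y)) =
      dird (0, w) (dird (L y) g) (x, y)"
  proof -
    have "dird (0, w) (dird (L y) g) (x, y) =
        dird (0, w) (\<lambda>p. \<Sum>i\<in>UNIV. y $ i * dird (L (axis i 1)) g p) (x, y)"
      by (rule dird_cong_open[OF open_W p]) (rule ex)
    also have "\<dots> = (\<Sum>i\<in>UNIV. y $ i * dird (0, w) (dird (L (axis i 1)) g) (x, y))"
    proof -
      have c: "(\<lambda>p. y $ i * dird (L (axis i 1)) g p) differentiable (at (x, y))" for i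
        by (intro differentiable_mult d(2) p) simp
      show ?thesis by (simp add: dird_sum c dird_mult d(2)[OF p] dird_const)
    qed
    finally show ?thesis by simp
  qed
  finally show ?thesis .
qed

lemma linear_inj_fst: "linear (\<lambda>v::real^'n. (v, 0::real^'n))"
  and linear_inj_snd: "linear (\<lambda>v::real^'n. (0::real^'n, v))"
  by (simp_all add: linear_iff)

lemma dird_f_commute: "p \<in> W \<Longrightarrow> dird u (dird v f) p = dird v (dird u f) p"
  by (rule smooth_on_dird_commute[OF open_W _ smooth_f])

lemma euler_yy: assumes "(x, y) \<in> W" shows "dird (0, y) (dird (0, w) f) (x, y) = 0"
proof -
  have "dird (0, w) (\<lambda>p. dird (0, snd p) f p) (x, y) = dird (0, w) f (x, y)"
    by (rule dird_cong_open[OF open_W assms]) (metis euler prod.collapse)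
  then show ?thesis
    using dird_radial[OF smooth_f assms linear_inj_snd, of w] dird_f_commute[OF assms] by simp
qed

lemma euler_xy: assumes "(x, y) \<in> W" shows "dird (v, 0) (dird (0, y) f) (x, y) = dird (v, 0) f (x, y)"
proof -
  have "dird v (\<lambda>x. dird (0, y) f (x, y)) x = dird v (\<lambda>x. f (x, y)) x"
    by (rule dird_cong_open[OF open_V]) (use assms euler in \<open>auto simp: in_W\<close>)
  then show ?thesis
    using dird_slice_fst(1)[OF df_diff[OF assms]] dird_slice_fst(1)[OF f_diff[OF assms]] by simp
qed

text \<open>The projective factor: the only possible \<open>k\<close> in \<open>G = k y\<close>, as
  the next lemma shows.\<close>

definition P :: "(real^'n) \<times> (real^'n) \<Rightarrow> real" where
  "P p = dird (snd p, 0) f p / (2 * f p)"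

lemma P_f: "p \<in> W \<Longrightarrow> 2 * (P p * f p) = dird (snd p, 0) f p"
  using f_pos[of "fst p" "snd p"] by (simp add: P_def)

lemma smooth_P: "smooth_on W P"
proof (rule smooth_on_cong[OF _ open_W])
  show "smooth_on W (\<lambda>p. (\<Sum>i\<in>UNIV. snd p $ i * dird (axis i 1, 0) f p) / (2 * f p))"
    using f_pos by (intro smooth_on_divide smooth_on_sum smooth_on_mult open_W smooth_f smooth_on_dird
        smooth_on_const smooth_on_linear[OF bounded_linear_nth_snd]) (auto simp: less_le)
  show "(\<Sum>i\<in>UNIV. snd p $ i * dird (axis i 1, 0) f p) / (2 * f p) = P p" if "p \<in> W" for p
    using dird_fst_expand[OF f_diff[OF that], of "snd p"] by (simp add: P_def)
qed

lemma P_diff: "p \<in> W \<Longrightarrow> P differentiable (at p)"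
  by (rule smooth_on_differentiable[OF smooth_P])

text \<open>Homogeneity turns the fundamental tensor applied to \<open>y\<close> into
  \<open>F F_y\<close>, so \<open>G = k y\<close> becomes a covector equation between first and
  second derivatives of \<open>F\<close>. Its value in direction \<open>y\<close> determines
  \<open>k\<close>; what then remains in direction \<open>w\<close> is Rapcsak's equation.\<close>

lemma spray_and_rapcsak:
  assumes pf: "projectively_flat_on V F" and p: "(x, y) \<in> W"
  shows "geodesic_coeffs F x y = P (x, y) *\<^sub>R y"
    and "dird (y, 0) (dird (0, w) f) (x, y) = dird (w, 0) f (x, y)"
proof -
  obtain k where k: "geodesic_coeffs F x y = k *\<^sub>R y" using projectively_flat_spray[OF pf p] by blast
  let ?D = "dird (y, 0) f (x, y)"
  have gy: "(fundamental_tensor F x y *v y) $ i = f (x, y) * dird (0, axis i 1) f (x, y)" for i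
  proof -
    have "(fundamental_tensor F x y *v y) $ i =
        1/2 * (\<Sum>j\<in>UNIV. y $ j * dird (0, axis j 1) (dird (0, axis i 1) E) (x, y))"
      by (simp add: matrix_vector_mult_def fundamental_tensor_eq[OF p] sum_distrib_left mult_ac)
    also have "\<dots> = 1/2 * dird (0, y) (dird (0, axis i 1) E) (x, y)"
      by (simp add: dird_snd_expand[OF dE_diff[OF p], of y])
    also have "\<dots> = f (x, y) * dird (0, axis i 1) f (x, y)"
      by (simp add: dird_dird_E[OF p] euler[OF p] euler_yy[OF p])
    finally show ?thesis .
  qed
  have *: "2 * k * f (x, y) * dird (0, w) f (x, y) =
      ?D * dird (0, w) f (x, y) + f (x, y) * dird (y, 0) (dird (0, w) f) (x, y)
        - f (x, y) * dird (w, 0) f (x, y)" (is "?A w = ?B w") for w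
  proof -
    have lin: "linear (\<lambda>w. ?A w - ?B w)"
    proof -
      have 1: "linear (\<lambda>w. dird (0, w) f (x, y))" "linear (\<lambda>w. dird (w, 0) f (x, y))"
        using linear_compose[OF linear_inj_snd linear_dird[OF f_diff[OF p]]]
          linear_compose[OF linear_inj_fst linear_dird[OF f_diff[OF p]]] by (simp_all add: o_def)
      have 2: "linear (\<lambda>w. dird (y, 0) (dird (0, w) f) (x, y))"
        using linear_compose[OF linear_inj_snd linear_dird[OF df_diff[OF p, of "(y, 0)"]]]
        by (simp add: o_def dird_f_commute[OF p])
      show ?thesis
        by (intro linear_compose_sub linear_compose_add) (use 1 2 in \<open>simp_all add: linear_iff algebra_simps\<close>)
    qed
    have "?A (axis i 1) - ?B (axis i 1) = 0" for i
    proof -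
      have "(k *\<^sub>R (fundamental_tensor F x y *v y)) $ i = ((1/4) *\<^sub>R spray_rhs x y) $ i"
        using fundamental_tensor_geodesic_coeffs[OF p] k by (simp add: matrix_vector_mult_scaleR)
      then show ?thesis
        by (simp add: gy spray_rhs_def dird_dird_E[OF p] dird_E[OF p] algebra_simps)
    qed
    then have "?A w - ?B w = 0" using linear_vec_expand[OF lin, of w] by simp
    then show ?thesis by simp
  qed
  have f0: "f (x, y) > 0" by (rule f_pos[OF p])
  have "2 * k * f (x, y) * f (x, y) = ?D * f (x, y)"
    using *[of y] by (simp add: euler[OF p] euler_xy[OF p] mult.assoc)
  then have kD: "2 * k * f (x, y) = ?D"
    by (rule mult_right_cancel[THEN iffD1, rotated]) (use f0 in simp)
  then have "k = P (x, y)" using f0 by (simp add: P_def field_simps)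
  then show "geodesic_coeffs F x y = P (x, y) *\<^sub>R y" using k by simp
  show "dird (y, 0) (dird (0, w) f) (x, y) = dird (w, 0) f (x, y)"
    using *[of w, unfolded kD] f0 by simp
qed

text \<open>The y-derivative of \<open>2 P F = F_{x^m} y^m\<close>: one term is \<open>F_x\<close>
  in direction \<open>w\<close> by the product rule, the other equals it by Rapcsak's
  equation.\<close>

lemma hamel:
  assumes pf: "projectively_flat_on V F" and p: "(x, y) \<in> W"
  shows "dird (0, w) (\<lambda>p. P p * f p) (x, y) = dird (w, 0) f (x, y)"
proof -
  have pd: "(\<lambda>p. P p * f p) differentiable (at (x, y))"
    by (intro differentiable_mult P_diff f_diff p)
  have "2 * dird (0, w) (\<lambda>p. P p * f p) (x, y) = dird (0, w) (\<lambda>p. 2 * (P p * f p)) (x, y)"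
    by (subst dird_mult) (simp_all add: pd dird_const)
  also have "\<dots> = dird (0, w) (\<lambda>p. dird (snd p, 0) f p) (x, y)"
    by (rule dird_cong_open[OF open_W p]) (rule P_f)
  also have "\<dots> = dird (w, 0) f (x, y) + dird (0, w) (dird (y, 0) f) (x, y)"
    by (rule dird_radial[OF smooth_f p linear_inj_fst])
  also have "\<dots> = 2 * dird (w, 0) f (x, y)"
    using spray_and_rapcsak(2)[OF pf p] dird_f_commute[OF p] by simp
  finally show ?thesis by simp
qed

lemma S_curvature_eq:
  assumes pf: "projectively_flat_on V F" and p: "(x, y) \<in> W"
  shows "S_curvature F x y = (real CARD('n) + 1) * P (x, y)
    - (\<Sum>m\<in>UNIV. y $ m * partial_deriv m (\<lambda>x. ln (busemann_hausdorff F x)) x)"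
proof -
  have x: "x \<in> V" and y: "y \<noteq> 0" using p by (auto simp: in_W)
  \<comment> \<open>Hamel's equation in direction \<open>y\<close> shows that \<open>P\<close>
    satisfies Euler's relation of degree one; hence the divergence of \<open>P y\<close> is
    \<open>n + 1\<close> times \<open>P\<close>.\<close>
  have "dird (0, y) P (x, y) * f (x, y) + P (x, y) * f (x, y) = 2 * (P (x, y) * f (x, y))"
    using hamel[OF pf p, of y] P_f[OF p] by (simp add: dird_mult P_diff[OF p] f_diff[OF p] euler[OF p])
  then have euler_P: "dird (0, y) P (x, y) = P (x, y)" using f_pos[OF p] by (simp add: algebra_simps)
  have "partial_deriv m (\<lambda>y. geodesic_coeffs F x y $ m) y = y $ m * dird (0, axis m 1) P (x, y) + P (x, y)" for m
  proof -
    have "dird (axis m 1) (\<lambda>y. geodesic_coeffs F x y $ m) y = dird (axis m 1) (\<lambda>y. P (x, y) * y $ m) y"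
      by (rule dird_cong_open[of "UNIV - {0}"])
        (use x y in \<open>auto simp: spray_and_rapcsak(1)[OF pf] in_W\<close>)
    also have "\<dots> = dird (0, axis m 1) P (x, y) * y $ m + P (x, y) * dird (axis m 1) (\<lambda>y. y $ m) y"
      by (subst dird_mult) (simp_all add: dird_slice_snd[OF P_diff[OF p]]
          bounded_linear_imp_differentiable[OF bounded_linear_vec_nth])
    also have "dird (axis m 1) (\<lambda>y::real^'n. y $ m) y = 1"
      by (subst dird_eqI[OF bounded_linear_imp_has_derivative[OF bounded_linear_vec_nth]]) simp
    finally show ?thesis by (simp add: partial_deriv_dird mult.commute)
  qed
  then have "(\<Sum>m\<in>UNIV. partial_deriv m (\<lambda>y. geodesic_coeffs F x y $ m) y) =
      dird (0, y) P (x, y) + real CARD('n) * P (x, y)"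
    by (simp add: sum.distrib dird_snd_expand[OF P_diff[OF p], of y])
  then show ?thesis by (simp add: S_curvature_def euler_P algebra_simps)
qed

end

section \<open>Differentiability of the volume form\<close>

lemma DERIV_max_0_power2:
  "((\<lambda>u::real. (max 0 u)\<^sup>2) has_real_derivative 2 * max 0 u) (at u)"
proof -
  consider "u > 0" | "u < 0" | "u = 0" by linarith
  then show ?thesis
  proof cases
    case 1
    have "((\<lambda>u::real. u\<^sup>2) has_real_derivative 2 * max 0 u) (at u)"
      using 1 by (auto intro!: derivative_eq_intros)
    then show ?thesis
      by (rule has_field_derivative_transform_within_open[of _ _ _ "{0<..}"]) (use 1 in auto)
  next
    case 2
    have "((\<lambda>u::real. 0) has_real_derivative 2 * max 0 u) (at u)"
      using 2 by simp
    then show ?thesis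
      by (rule has_field_derivative_transform_within_open[of _ _ _ "{..<0}"]) (use 2 in auto)
  next
    case 3
    have "((\<lambda>h::real. max 0 h) \<longlongrightarrow> max 0 0) (at 0)" by (intro tendsto_intros)
    then have "((\<lambda>h::real. max 0 h) \<longlongrightarrow> 0) (at 0)" by simp
    then have "((\<lambda>h::real. (max 0 h)\<^sup>2 / h) \<longlongrightarrow> 0) (at 0)"
      by (rule Lim_transform_eventually)
        (auto simp: eventually_at_filter max_def power2_eq_square intro!: always_eventually)
    then show ?thesis using 3 by (simp add: DERIV_def)
  qed
qed

text \<open>A \<open>C\<^sup>1\<close> cutoff supported in \<open>[1, 2]\<close>: \<open>bump \<circ> F\<close> ignores the origin, where \<open>F\<close> is not smooth.\<close>

definition bump :: "real \<Rightarrow> real" where "bump s = (max 0 ((s - 1) * (2 - s)))\<^sup>2"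
definition bump' :: "real \<Rightarrow> real" where "bump' s = 2 * max 0 ((s - 1) * (2 - s)) * (3 - 2 * s)"

lemma DERIV_bump: "(bump has_real_derivative bump' s) (at s)"
proof -
  have "((\<lambda>s. (s - 1) * (2 - s)) has_real_derivative 3 - 2 * s) (at s)"
    by (auto intro!: derivative_eq_intros simp: algebra_simps)
  from DERIV_chain2[OF DERIV_max_0_power2 this] show ?thesis
    by (simp add: bump_def[abs_def] bump'_def)
qed

lemma continuous_bump: "continuous_on A bump" and continuous_bump': "continuous_on A bump'"
  unfolding bump_def bump'_def by (intro continuous_intros)+

lemma bump_outside: "s \<le> 1 \<or> s \<ge> 2 \<Longrightarrow> bump s = 0" "s \<le> 1 \<or> s \<ge> 2 \<Longrightarrow> bump' s = 0"
proof -
  have "(s - 1) * (2 - s) \<le> 0" if "s \<le> 1 \<or> s \<ge> 2"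
    using that mult_nonpos_nonneg[of "s - 1" "2 - s"] mult_nonneg_nonpos[of "s - 1" "2 - s"] by auto
  then show "s \<le> 1 \<or> s \<ge> 2 \<Longrightarrow> bump s = 0" "s \<le> 1 \<or> s \<ge> 2 \<Longrightarrow> bump' s = 0"
    by (simp_all only: bump_def bump'_def max_absorb1) simp_all
qed

lemma bump_nonneg: "bump s \<ge> 0" by (simp add: bump_def)

lemma bump_pos: "bump (3/2) \<noteq> 0" by (simp add: bump_def)

lemma emeasure_sublevel_scale:
  fixes G :: "'a::euclidean_space \<Rightarrow> real"
  assumes hom: "\<And>r y. r \<ge> 0 \<Longrightarrow> G (r *\<^sub>R y) = r * G y" and meas: "G \<in> borel_measurable borel"
    and s: "s > 0"
  shows "emeasure lborel {y. G y < s} = ennreal (s ^ DIM('a)) * emeasure lborel {y. G y < 1}"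
proof -
  have eq: "{y. G y < s} = (\<lambda>y. s *\<^sub>R y + 0) ` {y. G y < 1}"
  proof (intro equalityI subsetI)
    fix y assume "y \<in> {y. G y < s}"
    then have "G ((1/s) *\<^sub>R y) < 1" using hom[of "1/s" y] s by simp
    then show "y \<in> (\<lambda>y. s *\<^sub>R y + 0) ` {y. G y < 1}"
      using s by (intro image_eqI[of _ _ "(1/s) *\<^sub>R y"]) auto
  next
    fix y assume "y \<in> (\<lambda>y. s *\<^sub>R y + 0) ` {y. G y < 1}"
    then show "y \<in> {y. G y < s}" using hom[of s] s by auto
  qed
  have b: "{y. G y < t} \<in> sets borel" for t using meas by measurable
  have "emeasure lborel {y. G y < s} = emeasure lebesgue {y. G y < s}"
    using b by (simp add: emeasure_completion)
  also have "\<dots> = ennreal (\<bar>s\<bar> ^ DIM('a)) * emeasure lebesgue {y. G y < 1}"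
    unfolding eq by (rule emeasure_lebesgue_affine)
  finally show ?thesis using b s by (simp add: emeasure_completion)
qed

text \<open>The push-forward of Lebesgue measure under a positively homogeneous \<open>G\<close> is determined by the
  volume of the unit ball of \<open>G\<close>, because the ball of radius \<open>s\<close> has \<open>s\<^sup>n\<close> times that volume.\<close>

lemma integral_radial:
  fixes G :: "'a::euclidean_space \<Rightarrow> real" and h :: "real \<Rightarrow> real"
  assumes hom: "\<And>r y. r \<ge> 0 \<Longrightarrow> G (r *\<^sub>R y) = r * G y" and nn: "\<And>y. G y \<ge> 0"
    and meas: "G \<in> borel_measurable borel" and fin: "emeasure lborel {y. G y < 1} < \<infinity>"
    and h: "h \<in> borel_measurable borel"
  shows "(LINT y|lborel. h (G y)) * measure lborel (ball (0::'a) 1) =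
    measure lborel {y. G y < 1} * (LINT y|lborel. h (norm (y::'a)))"
proof -
  define a where "a = measure lborel {y. G y < 1}"
  define b where "b = measure lborel (ball (0::'a) 1)"
  have aE: "emeasure lborel {y. G y < 1} = ennreal a"
    using fin by (simp add: a_def emeasure_eq_ennreal_measure)
  have ball: "ball 0 1 = {y::'a. norm y < 1}" by auto
  have bE: "emeasure lborel {y::'a. norm y < 1} = ennreal b"
    using emeasure_lborel_ball_finite[of "0::'a" 1] unfolding b_def ball[symmetric]
    by (simp add: emeasure_eq_ennreal_measure)
  have b0: "b > 0" unfolding b_def using content_ball_pos[of 1 "0::'a"] by simp
  have a0: "a \<ge> 0" by (simp add: a_def)
  \<comment> \<open>The sign is reversed because \<open>measure_eqI_lessThan\<close> tests measures
    on half-lines \<open>{t<..}\<close>, whose preimages are then sublevel sets of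
    \<open>H\<close>.\<close>
  have level: "emeasure (distr lborel borel (\<lambda>y. - H y)) {t<..} =
      (if t \<ge> 0 then 0 else ennreal ((-t) ^ DIM('a)) * emeasure lborel {y. H y < 1})"
    if H: "\<And>r y. r \<ge> 0 \<Longrightarrow> H (r *\<^sub>R y) = r * H y" "\<And>y. H y \<ge> 0" "H \<in> borel_measurable borel"
    for H :: "'a \<Rightarrow> real" and t
  proof -
    have m: "(\<lambda>y. - H y) \<in> measurable lborel borel" using H(3) by measurable
    have "emeasure (distr lborel borel (\<lambda>y. - H y)) {t<..} = emeasure lborel ((\<lambda>y. - H y) -` {t<..} \<inter> space lborel)"
      by (rule emeasure_distr[OF m]) auto
    also have "(\<lambda>y. - H y) -` {t<..} \<inter> space lborel = {y. H y < - t}" by auto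
    finally have *: "emeasure (distr lborel borel (\<lambda>y. - H y)) {t<..} = emeasure lborel {y. H y < - t}" .
    show ?thesis
    proof (cases "t \<ge> 0")
      case True
      then have "{y. H y < - t} = {}" using H(2) by (auto simp: not_less intro: order_trans[of _ 0])
      then show ?thesis using * True by simp
    next
      case False
      then show ?thesis using * emeasure_sublevel_scale[OF H(1,3), of "-t"] by simp
    qed
  qed
  have nm: "(norm :: 'a \<Rightarrow> real) \<in> borel_measurable borel" by measurable
  let ?N = "distr lborel borel (\<lambda>y::'a. - norm y)"
  have meq: "distr lborel borel (\<lambda>y. - G y) = density ?N (\<lambda>_. ennreal (a / b))"
  proof (rule measure_eqI_lessThan)
    show "emeasure (distr lborel borel (\<lambda>y. - G y)) {t<..} < \<infinity>" for t
      using level[OF hom nn meas] aE by (simp add: ennreal_mult_less_top)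
    show "emeasure (distr lborel borel (\<lambda>y. - G y)) {t<..} =
        emeasure (density ?N (\<lambda>_. ennreal (a / b))) {t<..}" for t
    proof -
      have "emeasure (density ?N (\<lambda>_. ennreal (a / b))) {t<..} = ennreal (a / b) * emeasure ?N {t<..}"
        by (rule emeasure_density_const) auto
      then show ?thesis
        using level[OF hom nn meas, of t] level[of norm t] nm aE bE a0 b0
        by (auto simp: ennreal_mult[symmetric] mult_ac)
    qed
  qed auto
  have "(LINT y|lborel. h (G y)) = (LINT s|distr lborel borel (\<lambda>y. - G y). h (- s))"
    by (subst integral_distr) (use meas h in auto)
  also have "\<dots> = (LINT s|?N. (a / b) *\<^sub>R h (- s))"
    unfolding meq by (rule integral_density) (use h a0 b0 in auto)
  also have "\<dots> = (a / b) * (LINT s|?N. h (- s))" by simp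
  also have "(LINT s|?N. h (- s)) = (LINT y|lborel. h (norm (y::'a)))"
    by (subst integral_distr) (use h in auto)
  finally show ?thesis using b0 by (simp add: a_def b_def)
qed

lemma continuous_compact_support_integral:
  fixes g :: "'a::euclidean_space \<Rightarrow> real"
  assumes c: "continuous_on UNIV g" and z: "\<And>y. y \<notin> cbox a b \<Longrightarrow> g y = 0"
  shows "integral (cbox a b) g = (LINT y|lborel. g y)"
proof -
  have eq: "(\<lambda>y. indicator (cbox a b) y *\<^sub>R g y) = g"
    using z by (auto simp: fun_eq_iff indicator_def)
  have i: "integrable lborel g"
    using borel_integrable_compact[of "cbox a b" g] continuous_on_subset[OF c] unfolding eq by auto
  have "(g has_integral (LINT y|lborel. g y)) UNIV" by (rule has_integral_integral_lborel[OF i])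
  moreover have "(\<lambda>y. if y \<in> cbox a b then g y else 0) = g" using z by auto
  ultimately have "(g has_integral (LINT y|lborel. g y)) (cbox a b)"
    using has_integral_restrict_UNIV[of "cbox a b" g] by simp
  then show ?thesis by (rule integral_unique)
qed

text \<open>A continuous nonnegative function with zero integral vanishes, but \<open>bump\<close>
  does not vanish at 3/2. The volume formula divides by this integral.\<close>

lemma integral_bump_norm: "(LINT y|lborel. bump (norm (y::'a::euclidean_space))) \<noteq> 0"
proof
  assume 0: "(LINT y|lborel. bump (norm (y::'a))) = 0"
  define u :: 'a where "u = (\<Sum>i\<in>Basis. 2 *\<^sub>R i)"
  have box: "y \<in> cbox (-u) u" if "norm y < 2" for y
    using that Basis_le_norm[of _ y] by (fastforce simp: mem_box u_def abs_le_iff)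
  have c: "continuous_on UNIV (\<lambda>y::'a. bump (norm y))"
    by (rule continuous_on_compose2[OF continuous_bump[of UNIV]]) (auto intro: continuous_intros)
  have z: "bump (norm y) = 0" if "y \<notin> cbox (-u) u" for y
    using box[of y] that bump_outside(1) by (meson not_le_imp_less)
  have "((\<lambda>y. bump (norm y)) has_integral 0) (cbox (-u) u)"
    using continuous_compact_support_integral[OF c z] 0
      integrable_continuous[of "-u" u "\<lambda>y. bump (norm y)"] continuous_on_subset[OF c]
    by (metis integrable_integral subset_UNIV)
  moreover have "box (-u) u \<noteq> {}" by (auto simp: box_ne_empty u_def)
  moreover obtain e :: 'a where e: "norm e = 1" using vector_choose_size[of 1] by auto
  moreover have "(3/2) *\<^sub>R e \<in> cbox (-u) u" by (rule box) (simp add: e)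
  ultimately have "bump (norm ((3/2) *\<^sub>R e)) = 0"
    using has_integral_0_cbox_imp_0[of "-u" u "\<lambda>y. bump (norm y)"] bump_nonneg
      continuous_on_subset[OF c] by blast
  then show False using e bump_pos by simp
qed

section \<open>Volume of the unit ball as a function of the base point\<close>

context finsler_domain
begin

lemma f_bounds:
  assumes x0: "x0 \<in> V"
  shows "\<exists>r>0. \<exists>m>0. \<exists>M>0. cball x0 r \<subseteq> V \<and>
    (\<forall>x\<in>cball x0 r. \<forall>y. m * norm y \<le> f (x, y) \<and> f (x, y) \<le> M * norm y)"
proof -
  obtain r where r: "r > 0" "cball x0 r \<subseteq> V" using open_V x0 open_contains_cball by blast
  let ?K = "cball x0 r \<times> sphere (0::real^'n) 1"
  have K: "compact ?K" by (intro compact_Times) auto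
  have sub: "?K \<subseteq> W" using r by (auto simp: W_def)
  have ne: "?K \<noteq> {}" using r by auto
  have cont: "continuous_on ?K f" using smooth_on_continuous[OF smooth_f] sub continuous_on_subset by blast
  obtain p where p: "p \<in> ?K" "\<And>q. q \<in> ?K \<Longrightarrow> f p \<le> f q"
    using continuous_attains_inf[OF K ne cont] by blast
  obtain q where q: "q \<in> ?K" "\<And>p. p \<in> ?K \<Longrightarrow> f p \<le> f q"
    using continuous_attains_sup[OF K ne cont] by blast
  have fp: "f p > 0" using f_pos[of "fst p" "snd p"] p(1) sub by auto
  have fq: "f q > 0" using f_pos[of "fst q" "snd q"] q(1) sub by auto
  have "f p * norm y \<le> f (x, y) \<and> f (x, y) \<le> f q * norm y" if x: "x \<in> cball x0 r" for x y
  proof (cases "y = 0")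
    case True
    then show ?thesis using f_eq_0[of x 0] x r by auto
  next
    case False
    let ?u = "(1 / norm y) *\<^sub>R y"
    have "(x, ?u) \<in> ?K" using x False by simp
    then have "f p \<le> f (x, ?u)" "f (x, ?u) \<le> f q" using p q by auto
    moreover have "f (x, ?u) = f (x, y) / norm y" using f_scale[of x "1 / norm y" y] x r by auto
    ultimately show ?thesis using False by (simp add: field_simps)
  qed
  then show ?thesis using r fp fq by blast
qed

lemma continuous_f: assumes x: "x \<in> V" shows "continuous_on UNIV (\<lambda>y. f (x, y))"
proof -
  obtain r m M where r: "r > 0" and *: "\<forall>z\<in>cball x r. \<forall>y. m * norm y \<le> f (z, y) \<and> f (z, y) \<le> M * norm y"
    using f_bounds[OF x] by blast
  then have b: "f (x, y) \<le> M * norm y" for y by simp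
  have "isCont (\<lambda>y. f (x, y)) y" for y
  proof (cases "y = 0")
    case True
    have "((\<lambda>y::real^'n. M * norm y) \<longlongrightarrow> M * norm (0::real^'n)) (at 0)" by (intro tendsto_intros)
    then have M0: "((\<lambda>y::real^'n. M * norm y) \<longlongrightarrow> 0) (at 0)" by simp
    have "((\<lambda>y. f (x, y)) \<longlongrightarrow> 0) (at 0)"
      by (rule tendsto_sandwich[OF _ _ tendsto_const M0])
        (use b f_nonneg[OF x] in \<open>auto intro!: always_eventually\<close>)
    then show ?thesis using True f_eq_0[OF x, of 0] by (simp add: isCont_def)
  next
    case False
    then have "f differentiable (at (x, y))" using f_diff in_W x by blast
    from dird_slice_snd(2)[OF this] show ?thesis
      by (rule differentiable_imp_continuous_within)
  qed
  then show ?thesis by (simp add: continuous_on_eq_continuous_at)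
qed

text \<open>The x-derivative of \<open>bump \<circ> f\<close>, extended by 0 to the zero section.
  The extension is continuous because \<open>bump'\<close> vanishes on values up to 1, which
  \<open>f\<close> does not exceed near the zero section.\<close>

definition dbump :: "real^'n \<Rightarrow> (real^'n) \<times> (real^'n) \<Rightarrow> real" where
  "dbump v p = (if snd p = 0 then 0 else bump' (f p) * dird (v, 0) f p)"

lemma continuous_dbump: "continuous_on (V \<times> UNIV) (dbump v)"
proof -
  have o: "open (V \<times> (UNIV::(real^'n) set))" by (intro open_Times open_V open_UNIV)
  have "isCont (dbump v) (x, y)" if x: "x \<in> V" for x y
  proof (cases "y = 0")
    case True
    obtain r m M where b: "r > 0" "M > 0" "cball x r \<subseteq> V"
      "\<And>z y. z \<in> cball x r \<Longrightarrow> f (z, y) \<le> M * norm y"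
      using f_bounds[OF x] by metis
    let ?O = "ball x r \<times> ball (0::real^'n) (1 / M)"
    have "dbump v p = 0" if "p \<in> ?O" for p
    proof -
      have "f p \<le> M * norm (snd p)" using b(4)[of "fst p" "snd p"] that by auto
      also have "\<dots> \<le> 1" using that b(2) by (auto simp: field_simps)
      finally show ?thesis using bump_outside(2) by (simp add: dbump_def)
    qed
    moreover have "open ?O" "(x, y) \<in> ?O" using b True by (auto intro: open_Times)
    ultimately have ev: "\<forall>\<^sub>F p in nhds (x, y). dbump v p = 0"
      unfolding eventually_nhds by blast
    show ?thesis using isCont_cong[OF ev] by simp
  next
    case False
    then have p: "(x, y) \<in> W" using x by (simp add: in_W)
    have "continuous_on W (\<lambda>p. bump' (f p) * dird (v, 0) f p)"
      by (intro continuous_on_mult continuous_on_compose2[OF continuous_bump'[of UNIV]]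
          smooth_on_continuous[OF smooth_f] smooth_on_continuous[OF smooth_on_dird[OF smooth_f]]) auto
    then have c: "isCont (\<lambda>p. bump' (f p) * dird (v, 0) f p) (x, y)"
      using open_W p continuous_on_eq_continuous_at by blast
    have ev: "\<forall>\<^sub>F p in nhds (x, y). dbump v p = bump' (f p) * dird (v, 0) f p"
      unfolding eventually_nhds using open_W p
      by (intro exI[of _ W]) (auto simp: dbump_def W_def)
    show ?thesis using isCont_cong[OF ev] c by simp
  qed
  then show ?thesis using continuous_on_eq_continuous_at[OF o, of "dbump v"] by auto
qed

lemma bump_f_has_derivative:
  assumes x: "x \<in> V"
  shows "((\<lambda>x. bump (f (x, y))) has_derivative (\<lambda>v. dbump v (x, y))) (at x)"
proof (cases "y = 0")
  case True
  have "((\<lambda>x. 0) has_derivative (\<lambda>v. dbump v (x, y))) (at x)" using True by (simp add: dbump_def)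
  then show ?thesis
    by (rule has_derivative_transform_within_open[OF _ open_V x])
      (use True f_eq_0[of _ 0] bump_outside(1)[of 0] in auto)
next
  case False
  then have p: "(x, y) \<in> W" using x by (simp add: in_W)
  have fd: "((\<lambda>x. f (x, y)) has_derivative (\<lambda>v. dird (v, 0) f (x, y))) (at x)"
    using has_derivative_dird[OF dird_slice_fst(2)[OF f_diff[OF p]]]
    by (simp add: dird_slice_fst(1)[OF f_diff[OF p]])
  show ?thesis
    using has_derivative_compose[OF fd DERIV_bump[of "f (x, y)", unfolded has_field_derivative_def]]
      False by (simp add: dbump_def)
qed

text \<open>By \<open>integral_radial\<close> the volume is a constant multiple of the integral of
  \<open>bump \<circ> f\<close> in \<open>y\<close>. That integral has a fixed domain and an
  integrand with continuous x-derivative, so it can be differentiated under the integral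
  sign.\<close>

lemma sublevel_measure_differentiable:
  assumes x0: "x0 \<in> V"
  shows "(\<lambda>x. measure lborel {y. F x y < 1}) differentiable (at x0)"
    and "measure lborel {y. F x0 y < 1} > 0"
proof -
  obtain r m M where r: "r > 0" "m > 0" "M > 0" "cball x0 r \<subseteq> V"
    and b: "\<And>x y. x \<in> cball x0 r \<Longrightarrow> m * norm y \<le> f (x, y) \<and> f (x, y) \<le> M * norm y"
    using f_bounds[OF x0] by metis
  \<comment> \<open>Outside this box \<open>norm y \<ge> 2 / m\<close>, hence
    \<open>f (x, y) \<ge> 2\<close> and the cutoff is 0, for all \<open>x\<close> in the ball at
    once.\<close>
  define u :: "real^'n" where "u = (\<Sum>i\<in>Basis. (2 / m) *\<^sub>R i)"
  have box: "y \<in> cbox (-u) u" if "norm y < 2 / m" for y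
    using that Basis_le_norm[of _ y] by (fastforce simp: mem_box u_def abs_le_iff)
  have z: "bump (f (x, y)) = 0" if "x \<in> cball x0 r" "y \<notin> cbox (-u) u" for x y
  proof -
    have "norm y \<ge> 2 / m" using box[of y] that by force
    then have "f (x, y) \<ge> 2" using b[OF that(1), of y] r(2) by (simp add: field_simps) 
    then show ?thesis by (rule bump_outside(1)[OF disjI2])
  qed
  have cb: "continuous_on UNIV (\<lambda>y. bump (f (x, y)))" if "x \<in> cball x0 r" for x
    by (rule continuous_on_compose2[OF continuous_bump[of UNIV] continuous_f]) (use that r in auto)
  define I where "I x = integral (cbox (-u) u) (\<lambda>y. bump (f (x, y)))" for x
  define fx where "fx x y = Blinfun (\<lambda>v. dbump v (x, y))" for x y
  have fx: "blinfun_apply (fx x y) = (\<lambda>v. dbump v (x, y))" if "x \<in> V" for x y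
    unfolding fx_def
    by (rule bounded_linear_Blinfun_apply, rule has_derivative_bounded_linear[OF bump_f_has_derivative[OF that]])
  have "(I has_derivative integral (cbox (-u) u) (fx x0)) (at x0 within ball x0 r)"
    unfolding I_def
  proof (rule leibniz_rule)
    fix x y assume "x \<in> ball x0 r"
    then have x: "x \<in> V" using r by auto
    show "((\<lambda>x. bump (f (x, y))) has_derivative blinfun_apply (fx x y)) (at x within ball x0 r)"
      unfolding fx[OF x] by (rule has_derivative_at_withinI[OF bump_f_has_derivative[OF x]])
  next
    fix x assume "x \<in> ball x0 r"
    then show "(\<lambda>y. bump (f (x, y))) integrable_on cbox (-u) u"
      using continuous_on_subset[OF cb[of x]] by (intro integrable_continuous) auto
  next
    show "continuous_on (ball x0 r \<times> cbox (- u) u) (\<lambda>(x, y). fx x y)"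
    proof (rule continuous_on_blinfun_componentwise)
      fix i :: "real^'n"
      have "continuous_on (ball x0 r \<times> cbox (- u) u) (dbump i)"
        by (rule continuous_on_subset[OF continuous_dbump]) (use r in auto)
      then show "continuous_on (ball x0 r \<times> cbox (- u) u) (\<lambda>p. blinfun_apply (case p of (x, y) \<Rightarrow> fx x y) i)"
      proof (rule continuous_on_eq)
        fix p assume "p \<in> ball x0 r \<times> cbox (- u) u"
        then have "fst p \<in> V" using r(4) by auto
        then show "dbump i p = blinfun_apply (case p of (x, y) \<Rightarrow> fx x y) i"
          using fx[of "fst p" "snd p"] by (simp add: case_prod_beta)
      qed
    qed
  qed (use r in auto)
  then have Id: "I differentiable (at x0)"
    using r by (metis at_within_open centre_in_ball differentiable_def open_ball)
  define C where "C = (LINT y|lborel. bump (norm (y::real^'n)))"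
  have C: "C \<noteq> 0" unfolding C_def by (rule integral_bump_norm)
  have vol: "I x * measure lborel (ball (0::real^'n) 1) / C = measure lborel {y. F x y < 1}
      \<and> measure lborel {y. F x y < 1} > 0"
    if x: "x \<in> ball x0 r" for x
  proof -
    have x': "x \<in> V" "x \<in> cball x0 r" using x r by auto
    have mb: "(\<lambda>y. f (x, y)) \<in> borel_measurable borel"
      by (rule borel_measurable_continuous_onI[OF continuous_f[OF x'(1)]])
    have S: "{y. f (x, y) < 1} \<in> sets lborel" using mb by measurable
    have sub1: "{y. f (x, y) < 1} \<subseteq> ball 0 (1 / m)"
    proof
      fix y assume "y \<in> {y. f (x, y) < 1}"
      then have "m * norm y < 1" using b[OF x'(2), of y] by auto
      then show "y \<in> ball 0 (1 / m)" using r(2) by (simp add: field_simps)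
    qed
    have sub2: "ball 0 (1 / M) \<subseteq> {y. f (x, y) < 1}"
    proof
      fix y :: "real^'n" assume "y \<in> ball 0 (1 / M)"
      then have "M * norm y < 1" using r(3) by (simp add: field_simps)
      then show "y \<in> {y. f (x, y) < 1}" using b[OF x'(2), of y] by auto
    qed
    have fin: "emeasure lborel {y. f (x, y) < 1} < \<infinity>"
      using emeasure_mono[OF sub1, of lborel] emeasure_lborel_ball_finite[of "0::real^'n" "1/m"]
      by (metis (no_types) infinity_ennreal_def le_less_trans lmeasurable_iff_integrable_on sets_lborel borel_open open_ball)
    have "I x = (LINT y|lborel. bump (f (x, y)))"
      unfolding I_def by (rule continuous_compact_support_integral[OF cb z]) (use x' in auto)
    then have "I x * measure lborel (ball (0::real^'n) 1) = measure lborel {y. f (x, y) < 1} * C"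
      using integral_radial[of "\<lambda>y. f (x, y)" bump] f_scale[OF x'(1)] f_nonneg[OF x'(1)] mb fin
        borel_measurable_continuous_onI[OF continuous_bump] by (simp add: C_def)
    moreover have "measure lborel {y. f (x, y) < 1} > 0"
    proof -
      have "0 < measure lborel (ball (0::real^'n) (1 / M))" using content_ball_pos[of "1/M" 0] r(3) by simp
      also have "\<dots> \<le> measure lborel {y. f (x, y) < 1}"
        by (rule measure_mono_fmeasurable[OF sub2]) (use S fin in \<open>auto simp: fmeasurable_def\<close>)
      finally show ?thesis .
    qed
    ultimately show ?thesis using C by (simp add: f_eq)
  qed
  show "measure lborel {y. F x0 y < 1} > 0" using vol[of x0] r by simp
  have "(\<lambda>x. I x * (measure lborel (ball (0::real^'n) 1) / C)) differentiable (at x0)"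
    by (intro differentiable_mult Id) simp
  then show "(\<lambda>x. measure lborel {y. F x y < 1}) differentiable (at x0)"
    by (rule differentiable_cong_open[of "ball x0 r", rotated 3]) (use vol r in auto)
qed

lemma sublevel_borel: assumes "x \<in> V" shows "{y. F x y < 1} \<in> sets borel"
  using borel_measurable_continuous_onI[OF continuous_f[OF assms]] by (simp add: f_eq)

text \<open>Only this makes the second sum in \<open>S_curvature\<close> the value at
  \<open>y\<close> of a linear form, which becomes part of \<theta>.\<close>

lemma ln_busemann_hausdorff_differentiable:
  assumes x0: "x0 \<in> V"
  shows "(\<lambda>x. ln (busemann_hausdorff F x)) differentiable (at x0)"
proof -
  let ?m = "\<lambda>x. measure lborel {y. F x y < 1}" and ?b = "measure lborel (ball (0::real^'n) 1)"
  obtain D where D: "(?m has_derivative D) (at x0)"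
    using sublevel_measure_differentiable(1)[OF x0] differentiable_def by blast
  have pos: "?m x > 0" if "x \<in> V" for x using sublevel_measure_differentiable(2)[OF that] .
  have "((\<lambda>x. ln ?b - ln (?m x)) has_derivative (\<lambda>v. 0 - D v * inverse (?m x0))) (at x0)"
    using pos[OF x0] by (auto intro!: derivative_eq_intros D simp: field_simps)
  then have "(\<lambda>x. ln ?b - ln (?m x)) differentiable (at x0)" using differentiable_def by blast
  then show ?thesis
  proof (rule differentiable_cong_open[OF open_V x0, rotated])
    fix x assume x: "x \<in> V"
    have "?b > 0" using content_ball_pos[of 1 "0::real^'n"] by simp
    then show "ln ?b - ln (?m x) = ln (busemann_hausdorff F x)"
      using pos[OF x] sublevel_borel[OF x] by (simp add: busemann_hausdorff_def ln_div measure_completion)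
  qed
qed

end

section \<open>The projective equation\<close>

text \<open>In projectively flat coordinates the spray is \<open>G(x, y) = P y\<close>, the \<open>S\<close>-curvature condition reads
  \<open>P = c F + \<theta>\<close> with \<open>\<theta> = \<eta> + d ln \<sigma> / (n + 1)\<close>, and \<open>pde\<close> is Hamel's equation
  \<open>F\<^sub>x = (P F)\<^sub>y\<close>.\<close>

locale projective_pde = finsler_domain V F for V :: "(real^'n) set" and F +
  fixes c :: "real^'n \<Rightarrow> real" and th :: "real^'n \<Rightarrow> real^'n \<Rightarrow> real"
  assumes smooth_c: "smooth_on V c"
    and linear_th: "\<And>x. x \<in> V \<Longrightarrow> linear (th x)"
    and smooth_th: "\<And>v. smooth_on V (\<lambda>x. th x v)"
    and closed_th: "\<And>x u v. x \<in> V \<Longrightarrow> dird u (\<lambda>x. th x v) x = dird v (\<lambda>x. th x u) x"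
    and pde: "\<And>x y w. (x, y) \<in> W \<Longrightarrow> dird (w, 0) f (x, y) =
      (2 * c x * f (x, y) + th x y) * dird (0, w) f (x, y) + th x w * f (x, y)"

context finsler_domain
begin

lemma has_derivative_fst:
  assumes "smooth_on W g" "(x, y) \<in> W"
  shows "((\<lambda>x. g (x, y)) has_derivative (\<lambda>u. dird (u, 0) g (x, y))) (at x)"
  using has_derivative_dird[OF dird_slice_fst(2)[OF smooth_on_differentiable[OF assms]]]
  unfolding dird_slice_fst(1)[OF smooth_on_differentiable[OF assms]] .

lemma has_derivative_snd:
  assumes "smooth_on W g" "(x, y) \<in> W"
  shows "((\<lambda>y. g (x, y)) has_derivative (\<lambda>w. dird (0, w) g (x, y))) (at y)"
  using has_derivative_dird[OF dird_slice_snd(2)[OF smooth_on_differentiable[OF assms]]]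
  unfolding dird_slice_snd(1)[OF smooth_on_differentiable[OF assms]] .

lemma dird_fst: "smooth_on W g \<Longrightarrow> (x, y) \<in> W \<Longrightarrow> dird (u, 0) g (x, y) = dird u (\<lambda>x. g (x, y)) x"
  by (rule dird_eqI[OF has_derivative_fst, symmetric])

lemma dird_snd: "smooth_on W g \<Longrightarrow> (x, y) \<in> W \<Longrightarrow> dird (0, w) g (x, y) = dird w (\<lambda>y. g (x, y)) y"
  by (rule dird_eqI[OF has_derivative_snd, symmetric])

lemma smooth_on_fst_slice:
  assumes "smooth_on W g" "y \<noteq> 0" shows "smooth_on V (\<lambda>x. g (x, y))"
proof -
  have "bounded_linear (\<lambda>x::real^'n. (x, 0::real^'n))"
    by (intro bounded_linear_Pair bounded_linear_ident bounded_linear_zero)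
  from smooth_on_affine[OF open_V _ this assms(1), of "(0, y)"] show ?thesis
    using assms(2) by (simp add: in_W)
qed

text \<open>The S-curvature identity reads \<open>P = c F + \<theta>\<close> with \<theta> the sum
  of \<eta> and \<open>d L / N\<close>. Inserted into Hamel's equation it gives the required
  equation; the work lies in showing that \<theta> is smooth and closed although \<open>L\<close> is
  only known to be differentiable.\<close>

lemma projective_pde_of_S_curvature:
  assumes pf: "projectively_flat_on V F" and c: "smooth_on V c"
    and lin: "\<And>x. x \<in> V \<Longrightarrow> linear (\<eta> x)" and sm: "\<And>i. smooth_on V (\<lambda>x. \<eta> x (axis i 1))"
    and closed: "\<And>x i j. x \<in> V \<Longrightarrow> partial_deriv i (\<lambda>x. \<eta> x (axis j 1)) x = partial_deriv j (\<lambda>x. \<eta> x (axis i 1)) x"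
    and S: "\<And>x y. x \<in> V \<Longrightarrow> y \<noteq> 0 \<Longrightarrow> S_curvature F x y = (real CARD('n) + 1) * (c x * F x y + \<eta> x y)"
  shows "\<exists>th. projective_pde V F c th"
proof -
  define L where "L x = ln (busemann_hausdorff F x)" for x
  define N where "N = real CARD('n) + 1"
  have N: "N > 0" by (simp add: N_def)
  define th where "th x v = \<eta> x v + dird v L x / N" for x v
  have Ld: "L differentiable (at x)" if "x \<in> V" for x
    using ln_busemann_hausdorff_differentiable[OF that] by (simp add: L_def[abs_def])
  have linL: "linear (\<lambda>v. dird v L x)" if "x \<in> V" for x by (rule linear_dird[OF Ld[OF that]])
  have linth: "linear (th x)" if "x \<in> V" for x
    using lin[OF that] linL[OF that] unfolding th_def[abs_def]
    by (simp add: linear_iff algebra_simps add_divide_distrib)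
  have P_eq: "P (x, y) = c x * f (x, y) + th x y" if p: "(x, y) \<in> W" for x y
  proof -
    have x: "x \<in> V" and y: "y \<noteq> 0" using p by (auto simp: in_W)
    have "(\<Sum>m\<in>UNIV. y $ m * partial_deriv m (\<lambda>x. ln (busemann_hausdorff F x)) x) = dird y L x"
      using linear_vec_expand[OF linL[OF x], of y] by (simp add: partial_deriv_dird L_def[abs_def])
    then have "N * (c x * F x y + \<eta> x y) = N * P (x, y) - dird y L x"
      using S_curvature_eq[OF pf p] S[OF x y] by (simp add: N_def)
    then have "N * P (x, y) = N * (c x * f (x, y) + th x y)"
      using N by (simp add: th_def f_eq algebra_simps)
    then show ?thesis using N by simp
  qed
  \<comment> \<open>Smoothness in \<open>x\<close> is read off from
    \<open>\<theta>(v) = P(x, v) - c F(x, v)\<close> at a fixed vector. The zero vector is separate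
    because \<open>F\<close> is smooth only off the zero section.\<close>
  have smth: "smooth_on V (\<lambda>x. th x v)" for v
  proof (cases "v = 0")
    case True
    show ?thesis
      by (rule smooth_on_cong[OF smooth_on_const[of _ 0] open_V]) (use True linth linear_0 in metis)
  next
    case False
    show ?thesis
    proof (rule smooth_on_cong[OF _ open_V])
      show "smooth_on V (\<lambda>x. P (x, v) - c x * f (x, v))"
        by (intro smooth_on_diff smooth_on_mult open_V c smooth_on_fst_slice smooth_P smooth_f False)
      show "P (x, v) - c x * f (x, v) = th x v" if "x \<in> V" for x
        using P_eq[of x v] that False by (simp add: in_W)
    qed
  qed
  have eta_sum: "\<eta> x v = (\<Sum>i\<in>UNIV. v $ i * \<eta> x (axis i 1))" if "x \<in> V" for x v
    by (rule linear_vec_expand[OF lin[OF that]])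
  have smeta: "smooth_on V (\<lambda>x. \<eta> x v)" for v
    by (rule smooth_on_cong[OF _ open_V eta_sum[symmetric]])
      (auto intro!: smooth_on_sum smooth_on_mult smooth_on_const open_V sm)
  have deta: "dird u (\<lambda>x. \<eta> x v) x = (\<Sum>i\<in>UNIV. v $ i * (\<Sum>j\<in>UNIV. u $ j * dird (axis j 1) (\<lambda>x. \<eta> x (axis i 1)) x))"
    if x: "x \<in> V" for u v x
  proof -
    have d: "(\<lambda>x. \<eta> x (axis i 1)) differentiable (at x)" for i by (rule smooth_on_differentiable[OF sm x])
    have "dird u (\<lambda>x. \<eta> x v) x = dird u (\<lambda>x. \<Sum>i\<in>UNIV. v $ i * \<eta> x (axis i 1)) x"
      by (rule dird_cong_open[OF open_V x eta_sum])
    also have "\<dots> = (\<Sum>i\<in>UNIV. v $ i * dird u (\<lambda>x. \<eta> x (axis i 1)) x)"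
      by (simp add: dird_sum d dird_mult dird_const differentiable_mult)
    also have "\<dots> = (\<Sum>i\<in>UNIV. v $ i * (\<Sum>j\<in>UNIV. u $ j * dird (axis j 1) (\<lambda>x. \<eta> x (axis i 1)) x))"
      by (intro sum.cong refl arg_cong2[of _ _ _ _ "(*)"] linear_vec_expand linear_dird d)
    finally show ?thesis .
  qed
  have eta_closed: "dird u (\<lambda>x. \<eta> x v) x = dird v (\<lambda>x. \<eta> x u) x" if x: "x \<in> V" for u v x
  proof -
    have "dird u (\<lambda>x. \<eta> x v) x =
        (\<Sum>i\<in>UNIV. \<Sum>j\<in>UNIV. v $ i * (u $ j * dird (axis j 1) (\<lambda>x. \<eta> x (axis i 1)) x))"
      unfolding deta[OF x, of u v] by (simp only: sum_distrib_left)
    also have "\<dots> = (\<Sum>j\<in>UNIV. \<Sum>i\<in>UNIV. v $ i * (u $ j * dird (axis j 1) (\<lambda>x. \<eta> x (axis i 1)) x))"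
      by (rule sum.swap)
    also have "\<dots> = (\<Sum>j\<in>UNIV. \<Sum>i\<in>UNIV. u $ j * (v $ i * dird (axis i 1) (\<lambda>x. \<eta> x (axis j 1)) x))"
      using closed[OF x] by (intro sum.cong refl) (simp add: partial_deriv_dird)
    also have "\<dots> = dird v (\<lambda>x. \<eta> x u) x"
      unfolding deta[OF x, of v u] by (simp only: sum_distrib_left)
    finally show ?thesis .
  qed
  \<comment> \<open>The bootstrap: \<open>d L\<close> is \<open>N\<close> times the difference of
    two smooth forms. So \<open>L\<close> is \<open>C^2\<close>, its second derivatives commute, and
    \<open>d L\<close> is closed.\<close>
  have L_smooth: "smooth_on V (dird v L)" for v
  proof (rule smooth_on_cong[OF _ open_V])
    show "smooth_on V (\<lambda>x. N * (th x v - \<eta> x v))"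
      by (intro smooth_on_mult smooth_on_const smooth_on_diff open_V smth smeta)
    show "N * (th x v - \<eta> x v) = dird v L x" for x using N by (simp add: th_def)
  qed
  have L2: "Ck_on 2 V L"
    unfolding numeral_2_eq_2 using Ld L_smooth by (subst Ck_on_Suc_dird) (auto simp: smooth_on_def)
  have th_closed: "dird u (\<lambda>x. th x v) x = dird v (\<lambda>x. th x u) x" if x: "x \<in> V" for u v x
  proof -
    have "dird u (\<lambda>x. th x v) x = dird u (\<lambda>x. \<eta> x v) x + dird u (dird v L) x / N" for u v
      using smooth_on_differentiable[OF smeta x, of v] smooth_on_differentiable[OF L_smooth x, of v]
      by (simp add: th_def divide_inverse dird_add dird_mult dird_const differentiable_mult)
    then show ?thesis using eta_closed[OF x] dird_commute[OF open_V x L2] by simp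
  qed
  have pde': "dird (w, 0) f (x, y) = (2 * c x * f (x, y) + th x y) * dird (0, w) f (x, y) + th x w * f (x, y)"
    if p: "(x, y) \<in> W" for x y w
  proof -
    have x: "x \<in> V" and y: "y \<noteq> 0" using p by (auto simp: in_W)
    have sPf: "smooth_on W (\<lambda>p. P p * f p)" by (intro smooth_on_mult open_W smooth_P smooth_f)
    have dth: "(th x has_derivative th x) (at y)"
      using linth[OF x] by (simp add: bounded_linear_imp_has_derivative linear_conv_bounded_linear)
    have "dird (w, 0) f (x, y) = dird w (\<lambda>y. P (x, y) * f (x, y)) y"
      using hamel[OF pf p, of w] dird_snd[OF sPf p] by simp
    also have "\<dots> = dird w (\<lambda>y. (c x * f (x, y) + th x y) * f (x, y)) y"
      by (rule dird_cong_open[of "UNIV - {0}"]) (use x y P_eq in_W in auto)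
    also have "\<dots> = (c x * f (x, y) + th x y) * dird (0, w) f (x, y)
        + (c x * dird (0, w) f (x, y) + th x w) * f (x, y)"
      by (rule dird_eqI) (rule derivative_eq_intros dth has_derivative_snd[OF smooth_f p] refl | simp)+
    finally show ?thesis by (simp add: algebra_simps)
  qed
  have "projective_pde V F c th"
    by (rule projective_pde.intro[OF finsler_domain_axioms projective_pde_axioms.intro])
      (rule c smth | (rule linth th_closed pde', assumption))+
  then show ?thesis by blast
qed

end

section \<open>Integrability and the quadratic equation for \<open>F\<close>\<close>

context projective_pde
begin

definition th' :: "real^'n \<Rightarrow> real^'n \<Rightarrow> real^'n \<Rightarrow> real" where
  "th' u v x = dird u (\<lambda>x. th x v) x"

text \<open>The curvature form \<open>\<Theta>\<close> of the projectively flat connection with spray coefficients \<open>\<theta>(y) y\<close>.\<close>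

definition Th :: "real^'n \<Rightarrow> real^'n \<Rightarrow> real^'n \<Rightarrow> real" where
  "Th x u v = th x u * th x v - th' u v x"

lemma c_deriv: "x \<in> V \<Longrightarrow> (c has_derivative (\<lambda>u. dird u c x)) (at x)"
  by (intro has_derivative_dird smooth_on_differentiable[OF smooth_c])

lemma th_deriv: "x \<in> V \<Longrightarrow> ((\<lambda>x. th x v) has_derivative (\<lambda>u. th' u v x)) (at x)"
  unfolding th'_def by (intro has_derivative_dird smooth_on_differentiable[OF smooth_th])

lemma linear_c': "x \<in> V \<Longrightarrow> linear (\<lambda>u. dird u c x)"
  by (rule has_derivative_linear[OF c_deriv])

lemma th'_sym: "x \<in> V \<Longrightarrow> th' u v x = th' v u x"
  unfolding th'_def by (rule closed_th)

lemma linear_th'_left: "x \<in> V \<Longrightarrow> linear (\<lambda>u. th' u v x)"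
  by (rule has_derivative_linear[OF th_deriv])

lemma linear_th'_right: "x \<in> V \<Longrightarrow> linear (\<lambda>v. th' u v x)"
  using linear_th'_left[of x u] by (simp add: th'_sym)

lemma Th_sym: "x \<in> V \<Longrightarrow> Th x u v = Th x v u"
  by (simp add: Th_def th'_sym)

lemma Th_add: "x \<in> V \<Longrightarrow> Th x (u + v) w = Th x u w + Th x v w" "x \<in> V \<Longrightarrow> Th x w (u + v) = Th x w u + Th x w v"
  and Th_scale: "x \<in> V \<Longrightarrow> Th x (r *\<^sub>R u) w = r * Th x u w" "x \<in> V \<Longrightarrow> Th x w (r *\<^sub>R u) = r * Th x w u"
  by (simp_all add: Th_def linear_add[OF linear_th] linear_add[OF linear_th'_left] linear_add[OF linear_th'_right]
      linear_cmul[OF linear_th] linear_cmul[OF linear_th'_left] linear_cmul[OF linear_th'_right] algebra_simps)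

lemma Th_minus: "x \<in> V \<Longrightarrow> Th x (- u) w = - Th x u w" "x \<in> V \<Longrightarrow> Th x w (- u) = - Th x w u"
  using Th_scale(1)[of x "-1" u w] Th_scale(2)[of x w "-1" u] by simp_all

lemma bilinear_Th: "x \<in> V \<Longrightarrow> bounded_bilinear (Th x)"
  unfolding bilinear_conv_bounded_bilinear[symmetric] bilinear_def linear_iff by (simp add: Th_add Th_scale)

lemma dxdx_f:
  assumes p: "(x, y) \<in> W"
  shows "dird (u, 0) (dird (v, 0) f) (x, y) =
    (2 * dird u c x * f (x, y) + 2 * c x * dird (u, 0) f (x, y) + th' u y x) * dird (0, v) f (x, y)
    + (2 * c x * f (x, y) + th x y) * dird (u, 0) (dird (0, v) f) (x, y)
    + th' u v x * f (x, y) + th x v * dird (u, 0) f (x, y)"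
proof -
  have x: "x \<in> V" and y: "y \<noteq> 0" using p by (auto simp: in_W)
  have "dird (u, 0) (dird (v, 0) f) (x, y) = dird u (\<lambda>x. dird (v, 0) f (x, y)) x"
    by (rule dird_fst[OF smooth_on_dird[OF smooth_f] p])
  also have "\<dots> = dird u (\<lambda>x. (2 * c x * f (x, y) + th x y) * dird (0, v) f (x, y) + th x v * f (x, y)) x"
    by (rule dird_cong_open[OF open_V x]) (use y pde in_W in auto)
  also have "\<dots> = (2 * c x * f (x, y) + th x y) * dird (u, 0) (dird (0, v) f) (x, y) +
      (2 * c x * dird (u, 0) f (x, y) + (2 * dird u c x) * f (x, y) + th' u y x) * dird (0, v) f (x, y) +
      (th x v * dird (u, 0) f (x, y) + th' u v x * f (x, y))"
    by (rule dird_eqI) (rule derivative_eq_intros c_deriv[OF x] th_deriv[OF x]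
        has_derivative_fst[OF smooth_f p] has_derivative_fst[OF smooth_on_dird[OF smooth_f] p] refl | simp)+
  finally show ?thesis by (simp add: algebra_simps)
qed

lemma dydx_f:
  assumes p: "(x, y) \<in> W"
  shows "dird (u, 0) (dird (0, v) f) (x, y) =
    (2 * c x * dird (0, v) f (x, y) + th x v) * dird (0, u) f (x, y)
    + (2 * c x * f (x, y) + th x y) * dird (0, v) (dird (0, u) f) (x, y)
    + th x u * dird (0, v) f (x, y)"
proof -
  have x: "x \<in> V" and y: "y \<noteq> 0" using p by (auto simp: in_W)
  have dth: "(th x has_derivative th x) (at y)"
    using linear_th[OF x] by (simp add: bounded_linear_imp_has_derivative linear_conv_bounded_linear)
  have "dird (u, 0) (dird (0, v) f) (x, y) = dird v (\<lambda>y. dird (u, 0) f (x, y)) y"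
    by (subst dird_f_commute[OF p]) (rule dird_snd[OF smooth_on_dird[OF smooth_f] p])
  also have "\<dots> = dird v (\<lambda>y. (2 * c x * f (x, y) + th x y) * dird (0, u) f (x, y) + th x u * f (x, y)) y"
    by (rule dird_cong_open[of "UNIV - {0}"]) (use x y pde in_W in auto)
  also have "\<dots> = (2 * c x * f (x, y) + th x y) * dird (0, v) (dird (0, u) f) (x, y) +
      (2 * c x * dird (0, v) f (x, y) + th x v) * dird (0, u) f (x, y) + th x u * dird (0, v) f (x, y)"
    by (rule dird_eqI) (rule derivative_eq_intros dth has_derivative_snd[OF smooth_f p]
        has_derivative_snd[OF smooth_on_dird[OF smooth_f] p] refl | simp)+
  finally show ?thesis by (simp add: algebra_simps)
qed

text \<open>The second x-derivatives of \<open>f\<close> in directions \<open>u\<close> and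
  \<open>y\<close> commute. Expanding both orders by \<open>pde\<close>, homogeneity removes the
  second y-derivatives and all undifferentiated occurrences of \<open>c\<close> cancel, so that only
  dc and \<Theta> remain.\<close>

lemma integrability:
  assumes p: "(x, y) \<in> W"
  shows "(2 * f (x, y) * dird u c x - Th x u y) * f (x, y) =
    (2 * f (x, y) * dird y c x - Th x y y) * dird (0, u) f (x, y)"
proof -
  have x: "x \<in> V" using p by (auto simp: in_W)
  define z fu cu cy tu ty tuy tyy C where "z = f (x, y)" and "fu = dird (0, u) f (x, y)"
    and "cu = dird u c x" and "cy = dird y c x" and "tu = th x u" and "ty = th x y"
    and "tuy = th' u y x" and "tyy = th' y y x" and "C = c x"
  note defs = z_def fu_def cu_def cy_def tu_def ty_def tuy_def tyy_def C_def
  have fy: "dird (0, y) f (x, y) = z" using euler[OF p] by (simp add: z_def)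
  have yu: "dird (0, y) (dird (0, u) f) (x, y) = 0" "dird (0, u) (dird (0, y) f) (x, y) = 0"
    using euler_yy[OF p] dird_f_commute[OF p] by auto
  have fxu: "dird (u, 0) f (x, y) = (2 * C * z + ty) * fu + tu * z"
    and fxy: "dird (y, 0) f (x, y) = (2 * C * z + ty) * z + ty * z"
    using pde[OF p] fy by (simp_all add: defs)
  have tyu: "th' y u x = tuy" using th'_sym[OF x] by (simp add: tuy_def)
  have 1: "dird (u, 0) (dird (0, y) f) (x, y) = (2 * C * z + ty) * fu + tu * z"
    using dydx_f[OF p, of u y] yu fy by (simp add: defs)
  have 2: "dird (y, 0) (dird (0, u) f) (x, y) = (2 * C * fu + tu) * z + ty * fu"
    using dydx_f[OF p, of y u] yu fy by (simp add: defs)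
  have A: "dird (u, 0) (dird (y, 0) f) (x, y) =
      (2 * cu * z + 2 * C * ((2 * C * z + ty) * fu + tu * z) + tuy) * z
      + (2 * C * z + ty) * ((2 * C * z + ty) * fu + tu * z) + tuy * z + ty * ((2 * C * z + ty) * fu + tu * z)"
    using dxdx_f[OF p, of u y] fxu fy 1 by (simp add: defs)
  have B: "dird (y, 0) (dird (u, 0) f) (x, y) =
      (2 * cy * z + 2 * C * ((2 * C * z + ty) * z + ty * z) + tyy) * fu
      + (2 * C * z + ty) * ((2 * C * fu + tu) * z + ty * fu) + tuy * z + tu * ((2 * C * z + ty) * z + ty * z)"
    using dxdx_f[OF p, of y u] fxy 2 tyu by (simp add: defs)
  have "(2 * z * cu - (tu * ty - tuy)) * z = (2 * z * cy - (ty * ty - tyy)) * fu"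
    using A B dird_f_commute[OF p, of "(u, 0)" "(y, 0)"] by (simp add: algebra_simps)
  then show ?thesis by (simp add: defs Th_def)
qed

text \<open>By \<open>integrability\<close>, the quotient \<open>(\<Theta>(y, y) - 4 dc(y) F) / F\<^sup>2\<close> has vanishing \<open>y\<close>-derivative;
  \<open>\<tau>\<close> is its value at some fixed \<open>y\<close>.\<close>

definition tau :: "real^'n \<Rightarrow> real" where
  "tau x = (let e = axis undefined 1 in (Th x e e - 4 * dird e c x * f (x, e)) / (f (x, e))\<^sup>2)"

text \<open>For \<open>N = \<Theta>(y, y) - 4 dc(y) F\<close> integrability says
  \<open>N_u F = 2 N F_u\<close>, which fixes the coefficient 4 and makes \<open>N / F^2\<close>
  locally constant in \<open>y\<close>. The punctured space is connected for
  \<open>n \<ge> 2\<close>, so the constant is \<open>tau x\<close>.\<close>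

lemma Th_eq:
  assumes n: "CARD('n) \<ge> 2" and x: "x \<in> V"
  shows "Th x y y = 4 * dird y c x * f (x, y) + tau x * (f (x, y))\<^sup>2"
proof (cases "y = 0")
  case True
  then show ?thesis using Th_scale(1)[OF x, of 0] f_eq_0[OF x, of 0] by simp
next
  case False
  define g where "g y = (Th x y y - 4 * dird y c x * f (x, y)) / (f (x, y))\<^sup>2" for y
  let ?e = "axis undefined 1 :: real^'n"
  have e: "?e \<noteq> 0" by (simp add: axis_eq_0_iff)
  have "(g has_derivative (\<lambda>_. 0)) (at y)" if y: "y \<in> UNIV - {0}" for y
  proof -
    have p: "(x, y) \<in> W" using x y by (simp add: in_W)
    have pos: "f (x, y) > 0" by (rule f_pos[OF p])
    have dTh: "((\<lambda>y. Th x y y) has_derivative (\<lambda>u. Th x y u + Th x u y)) (at y)"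
      by (rule bounded_bilinear.FDERIV[OF bilinear_Th[OF x] has_derivative_ident has_derivative_ident])
    have dc: "((\<lambda>y. dird y c x) has_derivative (\<lambda>y. dird y c x)) (at y)"
      using linear_c'[OF x] by (simp add: bounded_linear_imp_has_derivative linear_conv_bounded_linear)
    define z where "z = f (x, y)"
    have dN: "((\<lambda>y. Th x y y - 4 * dird y c x * f (x, y)) has_derivative
        (\<lambda>u. 2 * Th x u y - 4 * (dird u c x * z + dird y c x * dird (0, u) f (x, y)))) (at y)"
      unfolding z_def
      by (rule has_derivative_eq_rhs,
          (rule derivative_eq_intros dTh dc has_derivative_snd[OF smooth_f p] refl)+)
        (simp add: Th_sym[OF x, of y] fun_eq_iff algebra_simps)
    have dD: "((\<lambda>y. (f (x, y))\<^sup>2) has_derivative (\<lambda>u. 2 * z * dird (0, u) f (x, y))) (at y)"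
      unfolding z_def power2_eq_square
      by (rule has_derivative_eq_rhs, (rule derivative_eq_intros has_derivative_snd[OF smooth_f p] refl)+)
        (simp add: fun_eq_iff)
    have eq: "(2 * Th x u y - 4 * (dird u c x * z + dird y c x * dird (0, u) f (x, y))) * z\<^sup>2 -
        (Th x y y - 4 * dird y c x * z) * (2 * z * dird (0, u) f (x, y)) = 0" for u
    proof -
      have "(2 * Th x u y - 4 * (dird u c x * z + dird y c x * dird (0, u) f (x, y))) * z =
          (Th x y y - 4 * dird y c x * z) * (2 * dird (0, u) f (x, y))"
        using integrability[OF p, of u] by (simp add: z_def algebra_simps)
      then have "((2 * Th x u y - 4 * (dird u c x * z + dird y c x * dird (0, u) f (x, y))) * z) * z =
          ((Th x y y - 4 * dird y c x * z) * (2 * dird (0, u) f (x, y))) * z" by simp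
      then show ?thesis by (simp add: power2_eq_square mult_ac)
    qed
    have "(f (x, y))\<^sup>2 \<noteq> 0" using pos by simp
    from has_derivative_divide'[OF dN dD this] show ?thesis
      unfolding g_def[abs_def] z_def[symmetric] eq by simp
  qed
  moreover have "connected (UNIV - {0::real^'n})"
    using connected_punctured_universe[of "0::real^'n"] n by (simp add: Compl_eq_Diff_UNIV)
  ultimately have "g y = g ?e"
    by (intro has_derivative_zero_unique_connected[of "UNIV - {0}"]) (use False e in auto)
  also have "\<dots> = tau x" by (simp add: g_def tau_def Let_def)
  finally show ?thesis using f_pos[of x y] x False by (simp add: g_def in_W field_simps)
qed

end

section \<open>Parity and the function \<open>\<tau>\<close>\<close>

text \<open>For \<open>g = \<alpha> + \<beta>\<close> the odd part of \<open>g\<close> is \<beta>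
  and the even part is \<alpha>, so \<open>b\<close> represents \<beta> and \<open>h\<close>
  represents \<open>\<alpha>^2\<close>. This pointwise form leaves positivity and the bound on
  \<beta> to the positivity of \<open>F\<close>, and regularity in \<open>x\<close> to the
  smoothness of \<open>F\<close>.\<close>

definition randers_norm :: "(real^'n \<Rightarrow> real) \<Rightarrow> bool" where
  "randers_norm g \<longleftrightarrow> (\<exists>(h::real^'n^'n) b. \<forall>y. g y - g (- y) = 2 * (b \<bullet> y) \<and> (g y + g (- y))\<^sup>2 = 4 * (y \<bullet> (h *v y)))"

lemma linear_inner_vec:
  fixes B :: "real^'n \<Rightarrow> real"
  assumes "linear B" shows "(\<chi> i. B (axis i 1)) \<bullet> y = B y"
  using linear_vec_expand[OF assms, of y] by (simp add: inner_vec_def mult.commute)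

lemma bilinear_matrix:
  fixes Q :: "real^'n \<Rightarrow> real^'n \<Rightarrow> real"
  assumes "\<And>z. linear (\<lambda>y. Q y z)" "\<And>y. linear (Q y)"
  shows "y \<bullet> ((\<chi> i j. Q (axis i 1) (axis j 1)) *v z) = Q y z"
proof -
  have "Q y z = (\<Sum>i\<in>UNIV. y $ i * (\<Sum>j\<in>UNIV. z $ j * Q (axis i 1) (axis j 1)))"
    unfolding linear_vec_expand[OF assms(1), of y z]
    by (intro sum.cong refl arg_cong2[of _ _ _ _ "(*)"] linear_vec_expand assms(2))
  then show ?thesis by (simp add: inner_vec_def matrix_vector_mult_def mult.commute)
qed

text \<open>Replacing \<open>y\<close> by \<open>-y\<close> in a quadratic equation for \<open>g\<close> separates its even and odd parts.\<close>

lemma randers_norm_of_quadratic: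
  fixes g :: "real^'n \<Rightarrow> real"
  assumes pos: "\<And>y. y \<noteq> 0 \<Longrightarrow> g y > 0" and zero: "g 0 = 0" and r: "r \<noteq> 0"
    and B: "linear B" and Q: "\<And>z. linear (\<lambda>y. Q y z)" "\<And>y. linear (Q y)"
    and eq: "\<And>y. r * (g y)\<^sup>2 + B y * g y + Q y y = 0"
  shows "randers_norm g"
proof -
  \<comment> \<open>Completing the square gives
    \<open>g = - B / (2 r) + sqrt (B^2 / (4 r^2) - Q / r)\<close>: the linear term is
    \<open>b\<close>, the radicand is the diagonal of \<open>R\<close>.\<close>
  define b where "b = (\<chi> i. - B (axis i 1) / (2 * r))"
  define R where "R y z = B y * B z / (4 * r\<^sup>2) - Q y z / r" for y z
  define h where "h = (\<chi> i j. R (axis i 1) (axis j 1))"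
  have B0: "B (y + z) = B y + B z" "B (k *\<^sub>R y) = k * B y" "B (- y) = - B y" for y z k
    using linear_add[OF B] linear_cmul[OF B] linear_neg[OF B] by auto
  have Q0: "Q (- y) (- y) = Q y y" for y
    using linear_neg[OF Q(1)[of "- y"], of y] linear_neg[OF Q(2), of y y] by (metis minus_minus)
  have R: "linear (\<lambda>y. R y z)" "linear (R y)" for y z
    using Q[unfolded linear_iff] B0 unfolding R_def[abs_def] linear_iff
    by (simp_all add: add_divide_distrib algebra_simps)
  have hR: "y \<bullet> (h *v y) = R y y" for y unfolding h_def by (rule bilinear_matrix[OF R])
  have "linear (\<lambda>y. - B y / (2 * r))" using B0 by (simp add: linear_iff add_divide_distrib)
  from linear_inner_vec[OF this] have bB: "b \<bullet> y = - B y / (2 * r)" for y by (simp add: b_def)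
  have "g y - g (- y) = 2 * (b \<bullet> y) \<and> (g y + g (- y))\<^sup>2 = 4 * (y \<bullet> (h *v y))" for y
  proof (cases "y = 0")
    case True
    then show ?thesis using zero by simp
  next
    case False
    define p q where "p = g y" and "q = g (- y)"
    have pq: "p > 0" "q > 0" using pos[of y] pos[of "- y"] False by (simp_all add: p_def q_def)
    have 1: "r * p\<^sup>2 + B y * p + Q y y = 0" using eq[of y] by (simp add: p_def)
    have 2: "r * q\<^sup>2 - B y * q + Q y y = 0" using eq[of "- y"] by (simp add: q_def B0 Q0)
    have "(p + q) * (r * (p - q) + B y) = 0"
      using 1 2 by (simp add: algebra_simps power2_eq_square)
    then have 3: "r * (p - q) = - B y" using pq by (simp add: eq_neg_iff_add_eq_0)
    then have d: "p - q = - B y / r" using r by (simp add: field_simps)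
    have "r * (p + q)\<^sup>2 = 2 * (r * p\<^sup>2 + r * q\<^sup>2) - (r * (p - q)) * (p - q)"
      by (simp add: algebra_simps power2_eq_square)
    also have "r * p\<^sup>2 + r * q\<^sup>2 = - B y * (p - q) - 2 * Q y y" using 1 2 by (simp add: algebra_simps)
    finally have "r * (p + q)\<^sup>2 = - B y * (p - q) - 4 * Q y y" unfolding 3 by (simp add: algebra_simps)
    then have "(p + q)\<^sup>2 = 4 * R y y"
      unfolding d R_def using r by (simp add: field_simps power2_eq_square)
    then show ?thesis using d r by (simp add: p_def q_def bB hR)
  qed
  then show ?thesis unfolding randers_norm_def by blast
qed

text \<open>The equation is assumed only where \<open>h\<close> is nonzero, since the formula for
  the derivative of \<tau> is available only there. After the last zero \<open>s\<close> of
  \<open>h\<close> the function \<open>h^2 exp (- 2 K t)\<close> is nonincreasing and starts at 0,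
  so \<open>h b = 0\<close>.\<close>

lemma linear_ode_zero:
  fixes h h' q :: "real \<Rightarrow> real"
  assumes b: "0 \<le> b" and h: "\<And>t. t \<in> {0..b} \<Longrightarrow> (h has_real_derivative h' t) (at t)"
    and q: "continuous_on {0..b} q" and eq: "\<And>t. t \<in> {0..b} \<Longrightarrow> h t \<noteq> 0 \<Longrightarrow> h' t = q t * h t"
    and h0: "h 0 = 0"
  shows "h b = 0"
proof (rule ccontr)
  assume hb: "h b \<noteq> 0"
  have "bounded (q ` {0..b})" by (intro compact_imp_bounded compact_continuous_image q) auto
  then obtain K where K: "\<And>t. t \<in> {0..b} \<Longrightarrow> \<bar>q t\<bar> \<le> K"
    unfolding bounded_iff by fastforce
  have hc: "continuous_on {0..b} h"
    by (intro continuous_at_imp_continuous_on ballI DERIV_isCont[OF h])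
  let ?Z = "{t \<in> {0..b}. h t = 0}"
  have "closed ?Z" by (intro continuous_closed_preimage_constant hc) auto
  then have Z: "compact ?Z" by (auto simp: compact_eq_bounded_closed intro: bounded_subset[of "{0..b}"])
  have "0 \<in> ?Z" using b h0 by simp
  then obtain s where s: "s \<in> ?Z" "\<And>t. t \<in> ?Z \<Longrightarrow> t \<le> s"
    using compact_attains_sup[OF Z] by blast
  define m where "m t = (h t)\<^sup>2 * exp (- 2 * K * t)" for t
  have "m s \<ge> m b"
  proof (rule DERIV_nonpos_imp_decreasing_open[of s b m])
    show "s \<le> b" using s by simp
    show "continuous_on {s..b} m"
      unfolding m_def by (intro continuous_intros continuous_on_subset[OF hc]) (use s in auto)
    fix t assume t: "s < t" "t < b"
    then have tb: "t \<in> {0..b}" using s by auto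
    have ht: "h t \<noteq> 0" using s(2)[of t] tb t by force
    have "(m has_real_derivative (2 * h t * h' t - 2 * K * (h t)\<^sup>2) * exp (- 2 * K * t)) (at t)"
      unfolding m_def by (auto intro!: derivative_eq_intros h[OF tb] simp: algebra_simps power2_eq_square)
    moreover have "2 * h t * h' t - 2 * K * (h t)\<^sup>2 = 2 * (q t - K) * (h t)\<^sup>2"
      using eq[OF tb ht] by (simp add: algebra_simps power2_eq_square)
    moreover have "2 * (q t - K) * (h t)\<^sup>2 \<le> 0"
      by (rule mult_nonpos_nonneg) (use K[OF tb] in auto)
    ultimately show "\<exists>y. (m has_real_derivative y) (at t) \<and> y \<le> 0"
      by (metis exp_ge_zero mult_nonpos_nonneg)
  qed
  then have "(h b)\<^sup>2 * exp (- 2 * K * b) \<le> 0" using s by (simp add: m_def)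
  then show False using hb by (simp add: mult_le_0_iff)
qed

section \<open>The differential of \<open>tau\<close>\<close>

context projective_pde
begin

lemma dc_eq:
  assumes n: "CARD('n) \<ge> 2" and x: "x \<in> V"
  shows "4 * dird y c x = tau x * (f (x, - y) - f (x, y))"
proof (cases "y = 0")
  case True
  then show ?thesis using linear_0[OF linear_c'[OF x]] by simp
next
  case False
  define p q where "p = f (x, y)" and "q = f (x, - y)"
  have pq: "p > 0" "q > 0" using f_pos[of x y] f_pos[of x "- y"] False x by (simp_all add: p_def q_def in_W)
  have 1: "Th x y y = 4 * dird y c x * p + tau x * p\<^sup>2" using Th_eq[OF n x] by (simp add: p_def)
  have 2: "Th x y y = - (4 * dird y c x * q) + tau x * q\<^sup>2"
    using Th_eq[OF n x, of "- y"] linear_neg[OF linear_c'[OF x]] by (simp add: q_def Th_minus[OF x])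
  have "(p + q) * (4 * dird y c x - tau x * (q - p)) = 0"
    using 1 2 by (simp add: algebra_simps power2_eq_square)
  then show ?thesis using pq by (simp add: p_def q_def)
qed

lemma randers_norm_of_tau:
  assumes n: "CARD('n) \<ge> 2" and x: "x \<in> V" and t: "tau x \<noteq> 0"
  shows "randers_norm (F x)"
proof (rule randers_norm_of_quadratic[OF _ _ t])
  show "F x y > 0" if "y \<noteq> 0" for y using f_pos[of x y] x that by (simp add: in_W f_eq)
  show "F x 0 = 0" using f_eq_0[OF x, of 0] by (simp add: f_eq)
  show "linear (\<lambda>y. 4 * dird y c x)"
    using linear_c'[OF x] by (simp add: linear_iff algebra_simps)
  show "linear (\<lambda>y. - Th x y z)" "linear (\<lambda>z. - Th x y z)" for y z
    by (simp_all add: linear_iff Th_add[OF x] Th_scale[OF x])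
  show "tau x * (F x y)\<^sup>2 + 4 * dird y c x * F x y + - Th x y y = 0" for y
    using Th_eq[OF n x, of y] by (simp add: f_eq)
qed

lemma smooth_th': "smooth_on V (\<lambda>x. th' u v x)"
  unfolding th'_def by (rule smooth_on_dird[OF smooth_th])

lemma smooth_Th: "smooth_on V (\<lambda>x. Th x u v)"
  unfolding Th_def by (intro smooth_on_diff smooth_on_mult open_V smooth_th smooth_th')

lemma smooth_tau: "smooth_on V tau"
proof -
  let ?e = "axis undefined 1 :: real^'n"
  have e: "?e \<noteq> 0" by (simp add: axis_eq_0_iff)
  have "smooth_on V (\<lambda>x. (Th x ?e ?e - 4 * dird ?e c x * f (x, ?e)) / (f (x, ?e) * f (x, ?e)))"
    using f_pos[of _ ?e] e
    by (intro smooth_on_divide smooth_on_diff smooth_on_mult smooth_on_const open_V smooth_Th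
        smooth_on_dird[OF smooth_c] smooth_on_fst_slice[OF smooth_f e]) (auto simp: in_W less_le)
  then show ?thesis by (simp add: tau_def[abs_def] Let_def power2_eq_square)
qed

lemma tau_deriv: "x \<in> V \<Longrightarrow> (tau has_derivative (\<lambda>u. dird u tau x)) (at x)"
  by (intro has_derivative_dird smooth_on_differentiable[OF smooth_tau])

definition th'' :: "real^'n \<Rightarrow> real^'n \<Rightarrow> real^'n \<Rightarrow> real^'n \<Rightarrow> real" where
  "th'' u v w x = dird u (\<lambda>x. th' v w x) x"

lemma th''_sym:
  assumes x: "x \<in> V" shows "th'' u v w x = th'' v u w x" "th'' u v w x = th'' u w v x"
proof -
  show "th'' u v w x = th'' v u w x"
    unfolding th''_def th'_def by (rule smooth_on_dird_commute[OF open_V x smooth_th])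
  show "th'' u v w x = th'' u w v x"
    unfolding th''_def by (rule dird_cong_open[OF open_V x th'_sym])
qed

lemma th''_add: "x \<in> V \<Longrightarrow> th'' u v (w + z) x = th'' u v w x + th'' u v z x"
  using linear_add[OF linear_dird[OF smooth_on_differentiable[OF smooth_th']], of x w z u v] th''_sym
  unfolding th''_def by metis

lemma th''_neg: "x \<in> V \<Longrightarrow> th'' u v (- w) x = - th'' u v w x"
  using linear_neg[OF linear_dird[OF smooth_on_differentiable[OF smooth_th']], of x w u v] th''_sym
  unfolding th''_def by metis

lemma Th_x_deriv:
  assumes x: "x \<in> V"
  shows "dird u (\<lambda>x. Th x v w) x = th' u v x * th x w + th x v * th' u w x - th'' u v w x"
proof -
  have 2: "((\<lambda>x. th' v w x) has_derivative (\<lambda>u. th'' u v w x)) (at x)"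
    unfolding th''_def by (intro has_derivative_dird smooth_on_differentiable[OF smooth_th' x])
  have "((\<lambda>x. Th x v w) has_derivative
      (\<lambda>u. th' u v x * th x w + th x v * th' u w x - th'' u v w x)) (at x)"
    unfolding Th_def
    by (rule has_derivative_eq_rhs, (rule derivative_eq_intros th_deriv[OF x] 2 refl)+) (simp add: fun_eq_iff)
  then show ?thesis by (rule dird_eqI)
qed

text \<open>The covariant derivative \<open>(\<nabla>\<^sub>u\<Theta>)(v, w)\<close> for the projectively flat connection with spray
  coefficients \<open>\<theta>(y) y\<close>.\<close>

definition TT :: "real^'n \<Rightarrow> real^'n \<Rightarrow> real^'n \<Rightarrow> real^'n \<Rightarrow> real" where
  "TT x u v w = dird u (\<lambda>x. Th x v w) x - 2 * th x u * Th x v w - th x v * Th x u w - th x w * Th x u v"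

text \<open>Expanded, \<open>TT\<close> is \<open>- 4 \<theta>(u) \<theta>(v) \<theta>(w)\<close>,
  plus twice the cyclic sum of \<open>\<theta>(u) \<partial>\<theta>(v, w)\<close>, minus the second
  derivative of \<theta>. Each term is totally symmetric because \<theta> is closed.\<close>

lemma TT_sym:
  assumes x: "x \<in> V" shows "TT x u v w = TT x v u w" "TT x u v w = TT x u w v"
  unfolding TT_def Th_x_deriv[OF x] using x
  by (simp_all add: Th_def th'_sym[of x v u] th'_sym[of x w v] th''_sym(1)[of x u v]
      th''_sym(2)[of x u w v] algebra_simps)

lemma TT_add:
  assumes x: "x \<in> V" shows "TT x u v (w + z) = TT x u v w + TT x u v z"
  unfolding TT_def Th_x_deriv[OF x]
  by (simp add: Th_add[OF x] th''_add[OF x] linear_add[OF linear_th[OF x]]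
      linear_add[OF linear_th'_right[OF x]] algebra_simps)

lemma TT_neg:
  assumes x: "x \<in> V" shows "TT x u (- v) (- v) = TT x u v v"
proof -
  have "th'' u (- v) (- v) x = th'' u v v x"
    using th''_neg[OF x] th''_sym(2)[OF x] by (metis minus_minus)
  then show ?thesis
    unfolding TT_def Th_x_deriv[OF x]
    by (simp add: Th_minus[OF x] linear_neg[OF linear_th[OF x]] linear_neg[OF linear_th'_right[OF x]])
qed

text \<open>The y-derivative of \<open>Th_eq\<close> in direction \<open>u\<close>, obtained without
  differentiating: \<open>Th_eq\<close> is inserted into \<open>integrability\<close> and a factor
  \<open>F\<close> is cancelled.\<close>

lemma Th_y_deriv:
  assumes n: "CARD('n) \<ge> 2" and p: "(x, y) \<in> W"
  shows "2 * Th x u y = 4 * dird u c x * f (x, y) + (4 * dird y c x + 2 * tau x * f (x, y)) * dird (0, u) f (x, y)"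
proof -
  have x: "x \<in> V" using p by (simp add: in_W)
  define z where "z = f (x, y)"
  have z: "z > 0" using f_pos[OF p] by (simp add: z_def)
  have "(2 * z * dird u c x - Th x u y) * z = - (2 * dird y c x + tau x * z) * z * dird (0, u) f (x, y)"
    using integrability[OF p, of u] Th_eq[OF n x, of y] unfolding z_def[symmetric]
    by (simp add: algebra_simps power2_eq_square)
  then have "(2 * z * dird u c x - Th x u y) * z = (- (2 * dird y c x + tau x * z) * dird (0, u) f (x, y)) * z"
    by (simp add: algebra_simps)
  then have "2 * z * dird u c x - Th x u y = - (2 * dird y c x + tau x * z) * dird (0, u) f (x, y)"
    using z by (metis mult_right_cancel less_irrefl)
  then show ?thesis unfolding z_def[symmetric] by (simp add: algebra_simps)
qed

text \<open>The left-hand side is even in \<open>y\<close> and the bracket is odd, so both vanish.\<close>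

lemma differentiated_Th_eq:
  assumes n: "CARD('n) \<ge> 2" and p: "(x, y) \<in> W" and t: "tau x \<noteq> 0"
    and l: "dird u tau x = tau x * l + 8 * c x * dird u c x"
  shows "TT x u y y - l * Th x y y = 4 * f (x, y) *
    (dird u (dird y c) x + c x * Th x u y - th x y * dird u c x - th x u * dird y c x - l * dird y c x)"
proof -
  have x: "x \<in> V" and y: "y \<noteq> 0" using p by (auto simp: in_W)
  define z fu where "z = f (x, y)" and "fu = dird (u, 0) f (x, y)"
  have dc: "(dird y c has_derivative (\<lambda>u. dird u (dird y c) x)) (at x)"
    by (intro has_derivative_dird smooth_on_differentiable[OF smooth_on_dird[OF smooth_c] x])
  have "dird u (\<lambda>x. Th x y y) x = dird u (\<lambda>x. 4 * dird y c x * f (x, y) + tau x * (f (x, y) * f (x, y))) x"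
    by (rule dird_cong_open[OF open_V x]) (simp add: Th_eq[OF n] power2_eq_square)
  also have "\<dots> = 4 * dird y c x * fu + (4 * dird u (dird y c) x) * z +
      (tau x * (z * fu + fu * z) + dird u tau x * (z * z))"
    unfolding z_def fu_def
    by (rule dird_eqI) (rule derivative_eq_intros dc tau_deriv[OF x] has_derivative_fst[OF smooth_f p] refl | simp)+
  finally have 1: "dird u (\<lambda>x. Th x y y) x =
      4 * dird u (dird y c) x * z + (4 * dird y c x + 2 * tau x * z) * fu + dird u tau x * z\<^sup>2"
    by (simp add: algebra_simps power2_eq_square)
  define g where "g = dird (0, u) f (x, y)"
  have 2: "fu = (2 * c x * z + th x y) * g + th x u * z" using pde[OF p] by (simp add: fu_def z_def g_def)
  have 3: "(4 * dird y c x + 2 * tau x * z) * g = 2 * Th x u y - 4 * dird u c x * z"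
    using Th_y_deriv[OF n p, of u] by (simp add: z_def g_def)
  have 4: "tau x * z\<^sup>2 = Th x y y - 4 * dird y c x * z" using Th_eq[OF n x, of y] by (simp add: z_def)
  have "(4 * dird y c x + 2 * tau x * z) * fu = (2 * c x * z + th x y) * ((4 * dird y c x + 2 * tau x * z) * g)
      + th x u * (4 * dird y c x * z + 2 * (tau x * z\<^sup>2))"
    unfolding 2 by (simp add: algebra_simps power2_eq_square)
  also have "\<dots> = (2 * c x * z + th x y) * (2 * Th x u y - 4 * dird u c x * z)
      + th x u * (2 * Th x y y - 4 * dird y c x * z)"
    unfolding 3 4 by (simp add: algebra_simps)
  finally have 5: "(4 * dird y c x + 2 * tau x * z) * fu = \<dots>" .
  \<comment> \<open>The term \<open>8 c dc F^2\<close> here cancels its negative in 5. This is the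
    origin of the 8 in the ansatz for the differential of \<tau>: it makes the final right-hand side
    linear in \<open>F\<close>.\<close>
  have 6: "dird u tau x * z\<^sup>2 = l * (Th x y y - 4 * dird y c x * z) + 8 * c x * dird u c x * z\<^sup>2"
    unfolding l 4[symmetric] by (simp add: algebra_simps)
  show ?thesis
    unfolding TT_def 1 5 6 z_def[symmetric] by (simp add: algebra_simps power2_eq_square)
qed

text \<open>The form \<open>l\<close> measures the failure of the claim. Parity gives
  \<open>\<nabla>\<Theta> = l \<otimes> \<Theta>\<close>; total symmetry of \<open>TT\<close> and of
  the second derivatives of \<open>c\<close> then gives
  \<open>l(u) \<Theta>(y, y) = l(y) \<Theta>(u, y)\<close> and
  \<open>l(u) dc(y) = l(y) dc(u)\<close>. If \<open>l(u) \<noteq> 0\<close>, a vector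
  \<open>y \<noteq> 0\<close> with \<open>l(y) = 0\<close>, which exists as
  \<open>n \<ge> 2\<close>, has \<open>\<Theta>(y, y) = 0\<close> and \<open>dc(y) = 0\<close>. By
  \<open>Th_eq\<close> this contradicts \<open>tau x \<noteq> 0\<close>.\<close>

lemma dtau_eq:
  assumes n: "CARD('n) \<ge> 2" and x: "x \<in> V" and t: "tau x \<noteq> 0"
  shows "dird v tau x = 8 * c x * dird v c x"
proof -
  define l where "l u = (dird u tau x - 8 * c x * dird u c x) / tau x" for u
  have lin: "linear l"
    using has_derivative_linear[OF tau_deriv[OF x]] linear_c'[OF x]
    by (simp add: l_def[abs_def] linear_iff diff_divide_distrib add_divide_distrib algebra_simps)
  have leq: "dird u tau x = tau x * l u + 8 * c x * dird u c x" for u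
    using t by (simp add: l_def)
  have both: "TT x u y y = l u * Th x y y"
    "dird u (dird y c) x + c x * Th x u y = th x y * dird u c x + th x u * dird y c x + l u * dird y c x"
    if y: "y \<noteq> 0" for u y
  proof -
    let ?b = "\<lambda>y. dird u (dird y c) x + c x * Th x u y - th x y * dird u c x - th x u * dird y c x - l u * dird y c x"
    have p: "(x, y) \<in> W" "(x, - y) \<in> W" using x y by (auto simp: in_W)
    have dn: "dird u (dird (- y) c) x = - dird u (dird y c) x"
      using linear_neg[OF linear_dird[OF smooth_on_differentiable[OF smooth_on_dird[OF smooth_c, of u] x]], of y]
        smooth_on_dird_commute[OF open_V x smooth_c] by metis
    have 1: "TT x u y y - l u * Th x y y = 4 * f (x, y) * ?b y"
      by (rule differentiated_Th_eq[OF n p(1) t leq])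
    have bn: "?b (- y) = - ?b y"
      by (simp add: dn Th_minus[OF x] linear_neg[OF linear_th[OF x]] linear_neg[OF linear_c'[OF x]])
    have Tn: "Th x (- y) (- y) = Th x y y" by (simp add: Th_minus[OF x])
    have 2: "TT x u y y - l u * Th x y y = 4 * f (x, - y) * - ?b y"
      using differentiated_Th_eq[OF n p(2) t leq, of u] unfolding bn TT_neg[OF x] Tn .
    have "b = 0" if "a = 4 * p * b" "a = 4 * q * - b" "p > 0" "q > 0" for a b p q :: real
    proof -
      have "(p + q) * b = 0" using that(1,2) by (simp add: algebra_simps)
      then show ?thesis using that(3,4) by simp
    qed
    from this[OF 1 2 f_pos[OF p(1)] f_pos[OF p(2)]] have b: "?b y = 0" .
    then show "dird u (dird y c) x + c x * Th x u y = th x y * dird u c x + th x u * dird y c x + l u * dird y c x"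
      by simp
    show "TT x u y y = l u * Th x y y" using 1 b by simp
  qed
  have TT0: "TT x u y y = l u * Th x y y" for u y
  proof (cases "y = 0")
    case True
    have "TT x u 0 0 = 0" using TT_add[OF x, of u 0 0 0] by simp
    then show ?thesis using True Th_scale(1)[OF x, of 0] by simp
  qed (rule both)
  have pol: "TT x u y z = l u * Th x y z" for u y z
  proof -
    have "TT x u (y + z) (y + z) = TT x u y y + 2 * TT x u y z + TT x u z z"
      using TT_add[OF x] TT_sym(2)[OF x] by (smt (verit))
    moreover have "Th x (y + z) (y + z) = Th x y y + 2 * Th x y z + Th x z z"
      using Th_sym[OF x, of z y] by (simp add: Th_add[OF x])
    ultimately show ?thesis using TT0[of u "y + z"] TT0[of u y] TT0[of u z] by (simp add: algebra_simps)
  qed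
  have lT: "l u * Th x y y = l y * Th x u y" for u y
    using pol[of u y y] pol[of y u y] TT_sym(1)[OF x] by simp
  have lc: "l u * dird y c x = l y * dird u c x" if "u \<noteq> 0" "y \<noteq> 0" for u y
    using both(2)[OF that(2), of u] both(2)[OF that(1), of y] smooth_on_dird_commute[OF open_V x smooth_c, of u y]
      Th_sym[OF x, of u y] by simp
  have "l u = 0" for u
  proof (rule ccontr)
    assume u: "l u \<noteq> 0"
    then have u0: "u \<noteq> 0" using linear_0[OF lin] by auto
    obtain i j :: 'n where ij: "i \<noteq> j"
      using n by (metis One_nat_def Suc_1 card_le_Suc0_iff_eq finite_class.finite_UNIV not_less_eq_eq UNIV_I)
    have "\<exists>y. y \<noteq> 0 \<and> l y = 0"
    proof (cases "l (axis i 1) = 0")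
      case True
      then show ?thesis by (metis axis_eq_0_iff zero_neq_one)
    next
      case False
      let ?y = "l (axis j 1) *\<^sub>R axis i 1 - l (axis i 1) *\<^sub>R axis j 1 :: real^'n"
      have "?y $ j \<noteq> 0" using ij False by (simp add: axis_def)
      then have "?y \<noteq> 0" by (metis zero_index)
      moreover have "l ?y = 0" using linear_diff[OF lin] linear_cmul[OF lin] by simp
      ultimately show ?thesis by blast
    qed
    then obtain y where y: "y \<noteq> 0" "l y = 0" by blast
    have "Th x y y = 0" using lT[of u y] u y by simp
    moreover have "dird y c x = 0" using lc[OF u0 y(1)] u y by simp
    ultimately have "tau x * (f (x, y))\<^sup>2 = 0" using Th_eq[OF n x, of y] by simp
    then show False using t f_pos[of x y] x y by (simp add: in_W)
  qed
  then show ?thesis using leq[of v] by simp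
qed

lemma tau_zero_on_ball:
  assumes n: "CARD('n) \<ge> 2" and B: "ball x0 r \<subseteq> V" and t: "tau x0 = 0" and x: "x \<in> ball x0 r"
  shows "tau x = 0"
proof (cases "x = x0")
  case False
  define v where "v = x - x0"
  have v: "v \<noteq> 0" using False by (simp add: v_def)
  have seg: "x0 + s *\<^sub>R v \<in> V" if "s \<in> {0..1}" for s
  proof -
    have "norm (s *\<^sub>R v) \<le> norm v" using that by (simp add: mult_left_le_one_le)
    then have "x0 + s *\<^sub>R v \<in> ball x0 r" using x by (simp add: v_def dist_norm norm_minus_commute)
    then show ?thesis using B by blast
  qed
  \<comment> \<open>Substituting \<open>dc_eq\<close> for \<open>4 dc(v)\<close> in
    \<open>d\<tau>(v) = 8 c dc(v)\<close> leaves a factor \<tau>; \<open>q\<close> is its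
    coefficient along the segment.\<close>
  define q where "q s = 2 * c (x0 + s *\<^sub>R v) * (f (x0 + s *\<^sub>R v, - v) - f (x0 + s *\<^sub>R v, v))" for s
  have "continuous_on V (\<lambda>x. 2 * c x * (f (x, - v) - f (x, v)))"
    using v by (intro continuous_intros smooth_on_continuous[OF smooth_c]
        smooth_on_continuous[OF smooth_on_fst_slice[OF smooth_f]]) auto
  then have qc: "continuous_on {0..1} q" unfolding q_def
    by (rule continuous_on_compose2) (use seg in \<open>auto intro!: continuous_intros\<close>)
  have "tau (x0 + 1 *\<^sub>R v) = 0"
  proof (rule linear_ode_zero[of 1 "\<lambda>s. tau (x0 + s *\<^sub>R v)", OF _ _ qc])
    show "((\<lambda>s. tau (x0 + s *\<^sub>R v)) has_real_derivative dird v tau (x0 + s *\<^sub>R v)) (at s)" if "s \<in> {0..1}" for s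
      by (rule real_has_derivative_line[OF smooth_on_differentiable[OF smooth_tau seg[OF that]]])
    show "dird v tau (x0 + s *\<^sub>R v) = q s * tau (x0 + s *\<^sub>R v)"
      if "s \<in> {0..1}" "tau (x0 + s *\<^sub>R v) \<noteq> 0" for s
    proof -
      have "dird v tau (x0 + s *\<^sub>R v) = 2 * c (x0 + s *\<^sub>R v) * (4 * dird v c (x0 + s *\<^sub>R v))"
        using dtau_eq[OF n seg[OF that(1)] that(2), of v] by simp
      then show ?thesis unfolding dc_eq[OF n seg[OF that(1)]] q_def by simp
    qed
  qed (use t in auto)
  then show ?thesis by (simp add: v_def)
qed (use t in simp)

end

section \<open>Transport between indicatrices\<close>

text \<open>The equation says that \<open>y \<mapsto> y - (C + t y) v\<close> maps the indicatrix of
  \<open>g\<close> into the level set \<open>1 / \<rho>\<close> of \<open>g0\<close>. Inserting the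
  Randers form of \<open>g0\<close> and squaring produces a quadratic equation for
  \<open>g y\<close>. Its leading coefficient factors into the two quantities assumed positive, so
  \<open>randers_norm_of_quadratic\<close> applies.\<close>

lemma randers_norm_of_transport:
  fixes g :: "real^'n \<Rightarrow> real" and g0 :: "real^'n \<Rightarrow> real"
  assumes pos: "\<And>y. y \<noteq> 0 \<Longrightarrow> g y > 0" and zero: "g 0 = 0" and g0: "randers_norm g0"
    and t: "linear t" and \<rho>: "\<rho> > 0"
    and eq: "\<And>y. g y = \<rho> * g0 (y - (C * g y + t y) *\<^sub>R v)"
    and r: "1 / \<rho> + C * g0 v > 0" "1 / \<rho> - C * g0 (- v) > 0"
  shows "randers_norm g"
proof -
  obtain h :: "real^'n^'n" and b where gb: "\<And>y. g0 y - g0 (- y) = 2 * (b \<bullet> y)"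
    and gh: "\<And>y. (g0 y + g0 (- y))\<^sup>2 = 4 * (y \<bullet> (h *v y))"
    using g0 unfolding randers_norm_def by blast
  have q0: "(g0 y - b \<bullet> y)\<^sup>2 = y \<bullet> (h *v y)" for y
  proof -
    have *: "g0 y - b \<bullet> y = (g0 y + g0 (- y)) / 2" using gb[of y] by simp
    show ?thesis unfolding * power_divide gh by simp
  qed
  define H where "H y z = y \<bullet> (h *v z)" for y z
  have H: "H (y + z) w = H y w + H z w" "H w (y + z) = H w y + H w z"
    "H (k *\<^sub>R y) z = k * H y z" "H y (k *\<^sub>R z) = k * H y z" for y z w k
    by (simp_all add: H_def inner_add_left inner_add_right matrix_vector_right_distrib matrix_vector_mult_scaleR)
  have Hd: "H (y - z) w = H y w - H z w" "H w (y - z) = H w y - H w z" for y z w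
    by (simp_all add: H_def inner_diff_left inner_diff_right matrix_vector_mult_diff_distrib)
  define L where "L y = y - t y *\<^sub>R v" for y
  have L: "L (y + z) = L y + L z" "L (k *\<^sub>R y) = k *\<^sub>R L y" for y z k
    by (simp_all add: L_def linear_add[OF t] linear_cmul[OF t] algebra_simps)
  define m where "m = 1 / \<rho> + C * (b \<bullet> v)"
  show ?thesis
  proof (rule randers_norm_of_quadratic[of g "m\<^sup>2 - C\<^sup>2 * H v v"
      "\<lambda>y. C * (H (L y) v + H v (L y)) - 2 * m * (b \<bullet> L y)" "\<lambda>y z. (b \<bullet> L y) * (b \<bullet> L z) - H (L y) (L z)"])
    show "m\<^sup>2 - C\<^sup>2 * H v v \<noteq> 0"
    proof -
      have "m\<^sup>2 - C\<^sup>2 * H v v = m\<^sup>2 - (C * (g0 v - b \<bullet> v))\<^sup>2"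
        by (simp add: H_def q0[symmetric] power_mult_distrib)
      also have "\<dots> = (m + C * (g0 v - b \<bullet> v)) * (m - C * (g0 v - b \<bullet> v))"
        by (simp add: power2_eq_square algebra_simps)
      also have "\<dots> = (1 / \<rho> + C * g0 v) * (1 / \<rho> - C * g0 (- v))"
      proof -
        have gv: "g0 v = g0 (- v) + 2 * (b \<bullet> v)" using gb[of v] by simp
        show ?thesis unfolding m_def gv by (simp add: algebra_simps)
      qed
      finally show ?thesis using r by simp
    qed
    show "linear (\<lambda>y. C * (H (L y) v + H v (L y)) - 2 * m * (b \<bullet> L y))"
      "linear (\<lambda>y. (b \<bullet> L y) * (b \<bullet> L z) - H (L y) (L z))" "linear (\<lambda>z. (b \<bullet> L y) * (b \<bullet> L z) - H (L y) (L z))"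
      for y z by (simp_all add: linear_iff L H inner_add_right algebra_simps)
    show "(m\<^sup>2 - C\<^sup>2 * H v v) * (g y)\<^sup>2 + (C * (H (L y) v + H v (L y)) - 2 * m * (b \<bullet> L y)) * g y
        + ((b \<bullet> L y) * (b \<bullet> L y) - H (L y) (L y)) = 0" for y
    proof -
      define s where "s = g y"
      let ?Y = "L y - (C * s) *\<^sub>R v"
      have Y: "y - (C * g y + t y) *\<^sub>R v = ?Y" by (simp add: L_def s_def algebra_simps)
      have "s = \<rho> * g0 ?Y" using eq[of y] unfolding Y s_def .
      then have "g0 ?Y = s / \<rho>" using \<rho> by (metis nonzero_mult_div_cancel_left less_irrefl)
      then have 1: "(s / \<rho> - b \<bullet> ?Y)\<^sup>2 = H ?Y ?Y" using q0[of ?Y] by (simp add: H_def)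
      have 2: "s / \<rho> - b \<bullet> ?Y = m * s - b \<bullet> L y"
        by (simp add: m_def inner_diff_right algebra_simps)
      have 3: "H ?Y ?Y = H (L y) (L y) - C * s * (H (L y) v + H v (L y)) + C\<^sup>2 * s\<^sup>2 * H v v"
        by (simp add: H Hd algebra_simps power2_eq_square)
      show ?thesis using 1[unfolded 2 3] unfolding s_def[symmetric] by (simp add: algebra_simps power2_eq_square)
    qed
  qed (use pos zero in auto)
qed

context projective_pde
begin

text \<open>Where \<open>\<Theta>\<close> and \<open>dc\<close> vanish, \<open>\<theta>\<close> satisfies a Riccati equation along lines and the indicatrices
  of \<open>F\<close> are carried to each other by explicit affine maps.\<close>

lemma flat_transport:
  assumes x: "x \<in> V" and seg: "\<And>s. s \<in> {0..1} \<Longrightarrow> x + s *\<^sub>R v \<in> V"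
    and Th0: "\<And>s u w. s \<in> {0..1} \<Longrightarrow> Th (x + s *\<^sub>R v) u w = 0"
    and cC: "\<And>s. s \<in> {0..1} \<Longrightarrow> c (x + s *\<^sub>R v) = C"
    and small: "\<bar>th x v\<bar> < 1" and y: "y \<noteq> 0" and k: "\<bar>2 * C * f (x, y) + th x y\<bar> * norm v < norm y"
  shows "f (x, y) = (1 - th x v) * f (x + v, y - (2 * C * f (x, y) + th x y) *\<^sub>R v)"
proof -
  \<comment> \<open>Method of characteristics for \<open>pde\<close> along the line
    \<open>X\<close>: the curve \<open>z\<close> is chosen so that \<open>f\<close> keeps its
    initial value, which may therefore be frozen in the coefficient \<open>k\<close>. The bound on
    \<open>k\<close> keeps \<open>Y\<close>, hence \<open>z\<close>, away from the origin.\<close>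
  define k where "k = 2 * C * f (x, y) + th x y"
  define \<rho> where "\<rho> s = 1 - s * th x v" for s
  define X where "X s = x + s *\<^sub>R v" for s
  define Y where "Y s = y - (s * k) *\<^sub>R v" for s
  define z where "z s = \<rho> s *\<^sub>R Y s" for s
  have XV: "X s \<in> V" if "s \<in> {0..1}" for s using seg[OF that] by (simp add: X_def)
  have \<rho>: "\<rho> s > 0" if "s \<in> {0..1}" for s
  proof -
    have "\<bar>s * th x v\<bar> \<le> \<bar>th x v\<bar>" using that by (simp add: abs_mult mult_left_le_one_le)
    then show ?thesis using small by (simp add: \<rho>_def)
  qed
  have Y0: "Y s \<noteq> 0" if "s \<in> {0..1}" for s
  proof
    assume "Y s = 0"
    then have "y = (s * k) *\<^sub>R v" by (simp add: Y_def)
    then have "norm y = \<bar>s\<bar> * (\<bar>k\<bar> * norm v)" by (simp add: abs_mult)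
    also have "\<dots> \<le> \<bar>k\<bar> * norm v" using that by (intro mult_left_le_one_le) auto
    finally show False using k by (simp add: k_def)
  qed
  have zW: "(X s, z s) \<in> W" if "s \<in> {0..1}" for s
    using XV[OF that] \<rho>[OF that] Y0[OF that] by (simp add: in_W z_def)
  have th'_eq: "th' u w (X s) = th (X s) u * th (X s) w" if "s \<in> {0..1}" for s u w
    using Th0[OF that, of u w] by (simp add: Th_def X_def)
  have dth: "((\<lambda>s. th (X s) w) has_real_derivative th (X s) v * th (X s) w) (at s)" if "s \<in> {0..1}" for s w
    using real_has_derivative_line[of "\<lambda>x. th x w" x s v] smooth_on_differentiable[OF smooth_th seg[OF that]]
      th'_eq[OF that, of v w] by (simp add: th'_def X_def)
  have d\<rho>: "(\<rho> has_real_derivative - th x v) (at s)" for s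
    unfolding \<rho>_def[abs_def] by (auto intro!: derivative_eq_intros)
  have sub: "b \<in> {0..1} \<Longrightarrow> t \<in> {0..b} \<Longrightarrow> t \<in> {0..1}" for b t :: real by auto
  have Xc: "continuous_on A X" for A unfolding X_def by (intro continuous_intros)
  \<comment> \<open>With \<Theta> = 0 the value \<theta>(v) along the line solves the Riccati
    equation \<open>u' = u^2\<close>, whose solution is the initial value divided by \<rho>. The
    deviation from that solution satisfies a homogeneous linear equation.\<close>
  have th_v: "th (X b) v * \<rho> b - th x v = 0" if b: "b \<in> {0..1}" for b
  proof (rule linear_ode_zero[of b "\<lambda>s. th (X s) v * \<rho> s - th x v" _ "\<lambda>s. th (X s) v"])
    show "((\<lambda>s. th (X s) v * \<rho> s - th x v) has_real_derivative
        th (X s) v * (th (X s) v * \<rho> s - th x v)) (at s)" if "s \<in> {0..b}" for s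
      by (auto intro!: derivative_eq_intros dth[OF sub[OF b that]] d\<rho> simp: algebra_simps)
    show "continuous_on {0..b} (\<lambda>s. th (X s) v)"
      by (rule continuous_on_compose2[OF smooth_on_continuous[OF smooth_th] Xc]) (use XV sub[OF b] in auto)
  qed (use b in \<open>auto simp: X_def \<rho>_def\<close>)
  have th_w: "th (X b) w * \<rho> b - th x w = 0" if b: "b \<in> {0..1}" for b w
  proof (rule linear_ode_zero[of b "\<lambda>s. th (X s) w * \<rho> s - th x w" _ "\<lambda>s. 0"])
    show "((\<lambda>s. th (X s) w * \<rho> s - th x w) has_real_derivative 0) (at s)" if s: "s \<in> {0..b}" for s
    proof -
      have "((\<lambda>s. th (X s) w * \<rho> s - th x w) has_real_derivative
          th (X s) w * (th (X s) v * \<rho> s - th x v)) (at s)"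
        by (auto intro!: derivative_eq_intros dth[OF sub[OF b s]] d\<rho> simp: algebra_simps)
      then show ?thesis using th_v[OF sub[OF b s]] by simp
    qed
  qed (use b in \<open>auto simp: X_def \<rho>_def\<close>)
  define q where "q s = 2 * C * dird (0, v) f (X s, z s)" for s
  have "f (X 1, z 1) - f (x, y) = 0"
  proof (rule linear_ode_zero[of 1 "\<lambda>s. f (X s, z s) - f (x, y)" "\<lambda>s. q s * (f (X s, z s) - f (x, y))" q])
    have "continuous_on {0..1} (\<lambda>s. (X s, z s))"
      unfolding X_def z_def \<rho>_def Y_def by (intro continuous_intros)
    then have "continuous_on {0..1} (\<lambda>s. dird (0, v) f (X s, z s))"
      by (rule continuous_on_compose2[OF smooth_on_continuous[OF smooth_on_dird[OF smooth_f]]]) (use zW in auto)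
    then show "continuous_on {0..1} q" unfolding q_def by (intro continuous_intros)
  next
    fix s :: real assume s: "s \<in> {0..1}"
    let ?z' = "- th x v *\<^sub>R Y s - (\<rho> s * k) *\<^sub>R v"
    have "(X has_vector_derivative v) (at s)"
      unfolding X_def[abs_def] by (auto intro!: derivative_eq_intros)
    moreover have "(z has_vector_derivative ?z') (at s)"
    proof -
      have "(Y has_vector_derivative - (k *\<^sub>R v)) (at s)"
        unfolding Y_def[abs_def] by (auto intro!: derivative_eq_intros)
      from has_vector_derivative_scaleR[OF d\<rho> this] show ?thesis
        unfolding z_def[abs_def] by (simp add: algebra_simps)
    qed
    ultimately have "((\<lambda>s. (X s, z s)) has_vector_derivative (v, ?z')) (at s)"
      by (rule has_vector_derivative_Pair)
    then have "((\<lambda>s. (X s, z s)) has_derivative (\<lambda>h. h *\<^sub>R (v, ?z'))) (at s)"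
      by (simp add: has_vector_derivative_def)
    from has_derivative_compose[OF this has_derivative_dird[OF f_diff[OF zW[OF s]]]]
    have d: "((\<lambda>s. f (X s, z s)) has_derivative (\<lambda>h. dird (h *\<^sub>R (v, ?z')) f (X s, z s))) (at s)" .
    note lin = linear_dird[OF f_diff[OF zW[OF s]]]
    have dq: "dird (v, ?z') f (X s, z s) = q s * (f (X s, z s) - f (x, y))"
    proof -
      have z': "?z' = - th (X s) v *\<^sub>R z s - (\<rho> s * k) *\<^sub>R v"
        using th_v[OF s] by (simp add: z_def)
      have lw: "dird (0, a *\<^sub>R w + b *\<^sub>R w') f (X s, z s) = a * dird (0, w) f (X s, z s) + b * dird (0, w') f (X s, z s)"
        for a b w w'
        using linear_add[OF lin, of "a *\<^sub>R (0, w)" "b *\<^sub>R (0, w')"] linear_cmul[OF lin, of a "(0, w)"]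
          linear_cmul[OF lin, of b "(0, w')"] by simp
      have "dird (v, ?z') f (X s, z s) = dird (v, 0) f (X s, z s) + dird (0, ?z') f (X s, z s)"
        using linear_add[OF lin, of "(v, 0)" "(0, ?z')"] by simp
      also have "dird (0, ?z') f (X s, z s) = - th (X s) v * f (X s, z s) - \<rho> s * k * dird (0, v) f (X s, z s)"
        using lw[of "- th (X s) v" "z s" "- (\<rho> s * k)" v] euler[OF zW[OF s]] unfolding z' by simp
      also have "dird (v, 0) f (X s, z s) = (2 * C * f (X s, z s) + th (X s) (z s)) * dird (0, v) f (X s, z s)
          + th (X s) v * f (X s, z s)"
        using pde[OF zW[OF s], of v] cC[OF s] by (simp add: X_def)
      also have "th (X s) (z s) = th x y - s * k * th x v"
      proof -
        have "th (X s) (z s) = th (X s) (Y s) * \<rho> s"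
          by (simp add: z_def linear_cmul[OF linear_th[OF XV[OF s]]])
        also have "\<dots> = th x (Y s)" using th_w[OF s, of "Y s"] by simp
        finally show ?thesis
          by (simp add: Y_def linear_diff[OF linear_th[OF x]] linear_cmul[OF linear_th[OF x]])
      qed
      also have "th x y = k - 2 * C * f (x, y)" by (simp add: k_def)
      finally show ?thesis by (simp add: q_def \<rho>_def algebra_simps)
    qed
    have "((\<lambda>s. f (X s, z s)) has_real_derivative q s * (f (X s, z s) - f (x, y))) (at s)"
      unfolding has_field_derivative_def
      by (rule has_derivative_eq_rhs[OF d])
        (simp only: fun_eq_iff linear_cmul[OF lin] dq real_scaleR_def, simp add: mult.commute)
    then show "((\<lambda>s. f (X s, z s) - f (x, y)) has_real_derivative q s * (f (X s, z s) - f (x, y))) (at s)"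
      by (auto intro!: derivative_eq_intros)
  qed (auto simp: X_def z_def \<rho>_def Y_def)
  then show ?thesis
    using f_scale[of "x + v" "1 - th x v" "Y 1"] XV[of 1] \<rho>[of 1]
    by (simp add: X_def z_def \<rho>_def Y_def k_def)
qed

lemma th_bound:
  assumes S: "cball x0 r \<subseteq> V"
  shows "\<exists>K\<ge>0. \<forall>x\<in>cball x0 r. \<forall>v. \<bar>th x v\<bar> \<le> K * norm v"
proof -
  have "\<exists>K. \<forall>x\<in>cball x0 r. \<bar>th x (axis i 1)\<bar> \<le> K" for i
  proof -
    have "continuous_on (cball x0 r) (\<lambda>x. th x (axis i 1))"
      by (rule continuous_on_subset[OF smooth_on_continuous[OF smooth_th] S])
    then have "bounded ((\<lambda>x. th x (axis i 1)) ` cball x0 r)"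
      by (intro compact_imp_bounded compact_continuous_image) auto
    then show ?thesis by (auto simp: bounded_iff)
  qed
  then obtain K where K: "\<And>i x. x \<in> cball x0 r \<Longrightarrow> \<bar>th x (axis i 1)\<bar> \<le> K i" by metis
  have "\<bar>th x v\<bar> \<le> (\<Sum>i\<in>UNIV. \<bar>K i\<bar>) * norm v" if x: "x \<in> cball x0 r" for x v
  proof -
    have xV: "x \<in> V" using x S by blast
    have "\<bar>th x v\<bar> \<le> (\<Sum>i\<in>UNIV. \<bar>v $ i * th x (axis i 1)\<bar>)"
      by (subst linear_vec_expand[OF linear_th[OF xV]]) (rule sum_abs)
    also have "\<dots> \<le> (\<Sum>i\<in>UNIV. \<bar>K i\<bar> * norm v)"
    proof (rule sum_mono)
      fix i
      have "\<bar>th x (axis i 1)\<bar> \<le> \<bar>K i\<bar>" using K[OF x, of i] by simp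
      then show "\<bar>v $ i * th x (axis i 1)\<bar> \<le> \<bar>K i\<bar> * norm v"
        using component_le_norm_cart[of v i] by (simp add: abs_mult mult.commute mult_mono)
    qed
    finally show ?thesis by (simp add: sum_distrib_right)
  qed
  moreover have "(\<Sum>i\<in>UNIV. \<bar>K i\<bar>) \<ge> 0" by (simp add: sum_nonneg)
  ultimately show ?thesis by blast
qed

text \<open>If \<tau> is nonzero at the point, it is nonzero nearby and the quadratic equation
  applies. Otherwise \<tau> vanishes on a ball, so dc and \<Theta> do too, and
  \<open>flat_transport\<close> relates any two nearby points in either direction.\<close>

lemma local_dichotomy:
  assumes n: "CARD('n) \<ge> 2" and x0: "x0 \<in> V"
  shows "\<exists>U. open U \<and> x0 \<in> U \<and> U \<subseteq> V \<and> ((\<forall>x\<in>U. randers_norm (F x)) \<or>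
    (\<forall>x\<in>U. c x = c x0) \<and> (\<forall>x\<in>U. \<forall>x'\<in>U. randers_norm (F x') \<longrightarrow> randers_norm (F x)))"
proof (cases "tau x0 = 0")
  case False
  have "open (V \<inter> tau -` (UNIV - {0}))"
    by (rule continuous_open_preimage[OF smooth_on_continuous[OF smooth_tau] open_V]) auto
  then show ?thesis
    using False x0 randers_norm_of_tau[OF n] by (intro exI[of _ "V \<inter> tau -` (UNIV - {0})"]) auto
next
  case True
  obtain r m M where r: "r > 0" "M > 0" "cball x0 r \<subseteq> V"
    and M: "\<And>x y. x \<in> cball x0 r \<Longrightarrow> f (x, y) \<le> M * norm y"
    using f_bounds[OF x0] by metis
  obtain K where K: "K \<ge> 0" "\<And>x v. x \<in> cball x0 r \<Longrightarrow> \<bar>th x v\<bar> \<le> K * norm v"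
    using th_bound[OF r(3)] by metis
  have B: "ball x0 r \<subseteq> V" using r by auto
  have tau0: "tau x = 0" if "x \<in> ball x0 r" for x by (rule tau_zero_on_ball[OF n B True that])
  have dc0: "dird y c x = 0" if "x \<in> ball x0 r" for x y
    using dc_eq[OF n, of x y] tau0[OF that] that B by auto
  have Th0: "Th x u w = 0" if "x \<in> ball x0 r" for x u w
  proof -
    have x: "x \<in> V" using that B by auto
    have "Th x y y = 0" for y using Th_eq[OF n x, of y] tau0[OF that] dc0[OF that] by simp
    from this[of "u + w"] this[of u] this[of w] show ?thesis
      using Th_sym[OF x, of w u] by (simp add: Th_add[OF x])
  qed
  have cc: "c x = c x0" if "x \<in> ball x0 r" for x
  proof (rule has_derivative_zero_unique_connected[of "ball x0 r"])
    show "(c has_derivative (\<lambda>x. 0)) (at x)" if "x \<in> ball x0 r" for x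
      using c_deriv[of x] dc0[OF that] that B by auto
  qed (use that r in auto)
  define C where "C = c x0"
  \<comment> \<open>Two points of the small ball differ by less than \<open>2 e\<close>, so
    \<open>norm v * N < 1/2\<close>. This covers three needs: \<open>\<bar>th x v\<bar> < 1\<close>,
    the bound on \<open>k\<close> in \<open>flat_transport\<close>, and
    \<open>2 \<bar>C\<bar> F(v) \<le> 1/2 < 1 / \<rho>\<close>, which keeps the leading coefficient
    of the transported equation positive.\<close>
  define N where "N = 4 * \<bar>C\<bar> * M + 2 * K + 1"
  have N: "N > 0" using r K by (simp add: N_def add_nonneg_pos)
  define e where "e = min r (1 / (4 * N))"
  have e: "e > 0" "e \<le> r" using r N by (auto simp: e_def)
  have "randers_norm (F x)" if x: "x \<in> ball x0 e" and x': "x' \<in> ball x0 e" and R: "randers_norm (F x')" for x x'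
  proof -
    define v where "v = x' - x"
    have xr: "x \<in> ball x0 r" "x' \<in> ball x0 r" using x x' e by auto
    have xV: "x \<in> V" "x' \<in> V" using xr B by auto
    have xc: "x \<in> cball x0 r" "x' \<in> cball x0 r" using xr by auto
    have "norm v < 2 * e"
      using x x' dist_triangle[of x' x x0] unfolding v_def dist_norm[symmetric] by (simp add: dist_commute)
    also have "\<dots> \<le> 1 / (2 * N)" using N by (simp add: e_def)
    finally have "norm v * N < 1 / 2" using N by (simp add: field_simps)
    then have nv: "4 * \<bar>C\<bar> * M * norm v + 2 * K * norm v + norm v < 1 / 2" by (simp add: N_def algebra_simps)
    have nn: "\<bar>C\<bar> * M * norm v \<ge> 0" "K * norm v \<ge> 0" using r K by auto
    have small: "\<bar>th x v\<bar> < 1" using K(2)[OF xc(1), of v] nv nn norm_ge_zero[of v]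
      unfolding mult.assoc by linarith
    have seg: "x + s *\<^sub>R v \<in> ball x0 r" if "s \<in> {0..1}" for s
    proof -
      have "(1 - s) *\<^sub>R x + s *\<^sub>R x' \<in> ball x0 r"
        using convexD_alt[OF convex_ball xr, of s] that by auto
      then show ?thesis by (simp add: v_def algebra_simps)
    qed
    have eq: "F x y = (1 - th x v) * F x' (y - (2 * C * F x y + th x y) *\<^sub>R v)" for y
    proof (cases "y = 0")
      case True
      then show ?thesis using f_eq_0[OF xV(1), of 0] f_eq_0[OF xV(2), of 0] linear_0[OF linear_th[OF xV(1)]]
        by (simp add: f_eq)
    next
      case False
      have "\<bar>2 * C * f (x, y) + th x y\<bar> \<le> 2 * \<bar>C\<bar> * f (x, y) + \<bar>th x y\<bar>"
        using f_nonneg[OF xV(1), of y] abs_triangle_ineq[of "2 * C * f (x, y)" "th x y"] by (simp add: abs_mult)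
      also have "\<dots> \<le> 2 * \<bar>C\<bar> * (M * norm y) + K * norm y"
        using M[OF xc(1), of y] K(2)[OF xc(1), of y] by (intro add_mono mult_left_mono) auto
      finally have "\<bar>2 * C * f (x, y) + th x y\<bar> * norm v \<le> (2 * \<bar>C\<bar> * (M * norm y) + K * norm y) * norm v"
        by (rule mult_right_mono) simp
      also have "\<dots> = (2 * (\<bar>C\<bar> * M * norm v) + K * norm v) * norm y" by (simp add: algebra_simps)
      also have "\<dots> < 1 * norm y"
      proof (rule mult_strict_right_mono)
        have "4 * (\<bar>C\<bar> * M * norm v) + 2 * (K * norm v) + norm v < 1 / 2" using nv by (simp add: mult.assoc)
        then show "2 * (\<bar>C\<bar> * M * norm v) + K * norm v < 1" using nn norm_ge_zero[of v] by linarith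
      qed (use False in simp)
      finally have kk: "\<bar>2 * C * f (x, y) + th x y\<bar> * norm v < norm y" by simp
      have "f (x, y) = (1 - th x v) * f (x + v, y - (2 * C * f (x, y) + th x y) *\<^sub>R v)"
        by (rule flat_transport[OF xV(1) _ _ _ small False kk]) (use seg B Th0 cc in \<open>auto simp: C_def\<close>)
      then show ?thesis by (simp add: f_eq v_def)
    qed
    show ?thesis
    proof (rule randers_norm_of_transport[OF _ _ R linear_th[OF xV(1)],
          where \<rho> = "1 - th x v" and C = "2 * C" and v = v])
      show "F x y > 0" if "y \<noteq> 0" for y using f_pos[of x y] xV that by (simp add: in_W f_eq)
      show "F x 0 = 0" using f_eq_0[OF xV(1), of 0] by (simp add: f_eq)
      show "1 - th x v > 0" using small by simp
      show "F x y = (1 - th x v) * F x' (y - (2 * C * F x y + th x y) *\<^sub>R v)" for y by (rule eq)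
      have inv: "1 / (1 - th x v) > 1 / 2" using small by (simp add: field_simps)
      have bound: "\<bar>2 * C * F x' w\<bar> \<le> 1 / 2" if "norm w = norm v" for w
      proof -
        have "\<bar>2 * C * F x' w\<bar> = 2 * \<bar>C\<bar> * f (x', w)"
          using f_nonneg[OF xV(2), of w] by (simp add: abs_mult f_eq)
        also have "\<dots> \<le> 2 * \<bar>C\<bar> * (M * norm v)" using M[OF xc(2), of w] that by (intro mult_left_mono) auto
        finally have "\<bar>2 * C * F x' w\<bar> \<le> 2 * (\<bar>C\<bar> * M * norm v)" by (simp add: mult.assoc)
        moreover have "4 * (\<bar>C\<bar> * M * norm v) + 2 * (K * norm v) + norm v < 1 / 2" using nv by (simp add: mult.assoc)
        ultimately show ?thesis using nn norm_ge_zero[of v] by linarith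
      qed
      show "1 / (1 - th x v) + 2 * C * F x' v > 0" using inv bound[of v] by linarith
      show "1 / (1 - th x v) - 2 * C * F x' (- v) > 0" using inv bound[of "- v"] by simp
    qed
  qed
  note R = this
  have sub: "ball x0 e \<subseteq> ball x0 r" using e(2) by (rule subset_ball)
  show ?thesis
  proof (intro exI[of _ "ball x0 e"] conjI disjI2 ballI impI)
    show "x0 \<in> ball x0 e" using e(1) by simp
    show "ball x0 e \<subseteq> V" using sub B by (rule order_trans)
    show "c x = c x0" if "x \<in> ball x0 e" for x using that sub by (intro cc) (rule subsetD)
    show "randers_norm (F x)" if "x \<in> ball x0 e" "x' \<in> ball x0 e" "randers_norm (F x')" for x x'
      by (rule R[OF that])
  qed (rule open_ball)
qed

end

section \<open>Randers norms on a single tangent space\<close>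

lemma randers_norm_linear:
  fixes g :: "real^'n \<Rightarrow> real"
  assumes "randers_norm g" and L: "linear (L :: real^'n \<Rightarrow> real^'n)"
  shows "randers_norm (\<lambda>y. g (L y))"
proof -
  obtain h :: "real^'n^'n" and b where gb: "\<And>y. g y - g (- y) = 2 * (b \<bullet> y)"
    and gh: "\<And>y. (g y + g (- y))\<^sup>2 = 4 * (y \<bullet> (h *v y))"
    using assms(1) unfolding randers_norm_def by blast
  have bl: "linear (\<lambda>y. b \<bullet> L y)"
    by (simp add: linear_iff linear_add[OF L] linear_cmul[OF L] inner_add_right)
  have hl: "linear (\<lambda>y. L y \<bullet> (h *v L z))" "linear (\<lambda>z. L y \<bullet> (h *v L z))" for y z
    by (simp_all add: linear_iff linear_add[OF L] linear_cmul[OF L] inner_add_left inner_add_right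
        matrix_vector_right_distrib matrix_vector_mult_scaleR)
  show ?thesis unfolding randers_norm_def
  proof (intro exI allI conjI)
    fix y
    show "g (L y) - g (L (- y)) = 2 * ((\<chi> i. b \<bullet> L (axis i 1)) \<bullet> y)"
      unfolding linear_inner_vec[OF bl] linear_neg[OF L] by (rule gb)
    show "(g (L y) + g (L (- y)))\<^sup>2 =
        4 * (y \<bullet> ((\<chi> i j. L (axis i 1) \<bullet> (h *v L (axis j 1))) *v y))"
      unfolding bilinear_matrix[OF hl] linear_neg[OF L] by (rule gh)
  qed
qed

text \<open>On a line a positively homogeneous function is determined by its values at
  \<open>e\<close> and \<open>- e\<close>; its odd part is linear and its even part is a multiple of
  the absolute value. This settles the dimension that \<open>Th_eq\<close> excludes.\<close>

lemma randers_norm_dim1: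
  fixes g :: "real^'n \<Rightarrow> real"
  assumes n: "CARD('n) = 1" and hom: "\<And>r y. r \<ge> 0 \<Longrightarrow> g (r *\<^sub>R y) = r * g y"
  shows "randers_norm g"
proof -
  obtain i :: 'n where i: "UNIV = {i}" using n card_1_singletonE by metis
  define e :: "real^'n" where "e = axis i 1"
  have y: "y = (y $ i) *\<^sub>R e" for y :: "real^'n"
    using i by (simp add: vec_eq_iff e_def axis_def) (metis UNIV_I singletonD)
  define s d where "s = g e + g (- e)" and "d = g e - g (- e)"
  have pos: "g y - g (- y) = y $ i * d \<and> (g y + g (- y))\<^sup>2 = (y $ i)\<^sup>2 * s\<^sup>2" if "y $ i \<ge> 0" for y
  proof -
    have "g y = y $ i * g e" using hom[OF that, of e] unfolding y[symmetric] .
    moreover have "g (- y) = y $ i * g (- e)" using hom[OF that, of "- e"]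
      unfolding scaleR_minus_right y[symmetric] .
    ultimately show ?thesis by (simp add: s_def d_def algebra_simps power2_eq_square)
  qed
  have main: "g y - g (- y) = y $ i * d \<and> (g y + g (- y))\<^sup>2 = (y $ i)\<^sup>2 * s\<^sup>2" for y
    using pos[of y] pos[of "- y"] by (cases "y $ i \<ge> 0") (auto simp: add.commute)
  have b: "2 * (((d / 2) *\<^sub>R e) \<bullet> y) = y $ i * d" for y by (simp add: e_def inner_axis')
  have h: "4 * (y \<bullet> ((\<chi> i j. s\<^sup>2 / 4) *v y)) = (y $ i)\<^sup>2 * s\<^sup>2" for y :: "real^'n"
    by (simp add: inner_vec_def matrix_vector_mult_def i power2_eq_square)
  show ?thesis unfolding randers_norm_def
  proof (intro exI allI)
    show "g y - g (- y) = 2 * (((d / 2) *\<^sub>R e) \<bullet> y) \<and>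
        (g y + g (- y))\<^sup>2 = 4 * (y \<bullet> ((\<chi> i j. s\<^sup>2 / 4) *v y))" for y
      unfolding b h by (rule main)
  qed
qed

text \<open>Polarizing the squared even part recovers the inner product from \<open>F\<close> alone,
  without the witnesses \<open>h\<close> and \<open>b\<close>; the global metric and 1-form are
  defined by these formulas.\<close>

lemma (in finsler_domain) randers_norm_data:
  fixes x
  assumes x: "x \<in> V" and R: "randers_norm (F x)"
  defines "q \<equiv> \<lambda>y. ((F x y + F x (- y)) / 2)\<^sup>2"
  shows "linear (\<lambda>y. (q (y + z) - q y - q z) / 2)" "linear (\<lambda>z. (q (y + z) - q y - q z) / 2)"
    "linear (\<lambda>y. (F x y - F x (- y)) / 2)" "(q (y + y) - q y - q y) / 2 = q y"
proof -
  obtain h :: "real^'n^'n" and b where gb: "\<And>y. F x y - F x (- y) = 2 * (b \<bullet> y)"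
    and gh: "\<And>y. (F x y + F x (- y))\<^sup>2 = 4 * (y \<bullet> (h *v y))"
    using R unfolding randers_norm_def by blast
  have q: "q y = y \<bullet> (h *v y)" for y unfolding q_def power_divide gh by simp
  have Q: "(q (y + z) - q y - q z) / 2 = (y \<bullet> (h *v z) + z \<bullet> (h *v y)) / 2" for y z
    by (simp add: q inner_add_left inner_add_right matrix_vector_right_distrib)
  show "linear (\<lambda>y. (q (y + z) - q y - q z) / 2)" "linear (\<lambda>z. (q (y + z) - q y - q z) / 2)"
    unfolding Q by (simp_all add: linear_iff inner_add_left inner_add_right matrix_vector_right_distrib
        matrix_vector_mult_scaleR algebra_simps add_divide_distrib)
  show "linear (\<lambda>y. (F x y - F x (- y)) / 2)"
    unfolding gb by (simp add: linear_iff inner_add_right)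
  show "(q (y + y) - q y - q y) / 2 = q y" unfolding Q by (simp add: q)
qed

text \<open>Each quotient is below 1 because \<open>F\<close> is positive in both directions. The
  norm of \<beta> is a supremum, so a uniform bound below 1 is required; compactness of the unit
  sphere and homogeneity provide it.\<close>

lemma (in finsler_domain) randers_ratio_bound:
  assumes x: "x \<in> V"
  shows "\<exists>s<1. \<forall>y. y \<noteq> 0 \<longrightarrow> \<bar>F x y - F x (- y)\<bar> / (F x y + F x (- y)) \<le> s"
proof -
  define \<psi> where "\<psi> y = \<bar>f (x, y) - f (x, - y)\<bar> / (f (x, y) + f (x, - y))" for y
  have pos: "f (x, y) > 0" if "y \<noteq> 0" for y using f_pos[of x y] x that by (simp add: in_W)
  have cm: "continuous_on UNIV (\<lambda>y. f (x, - y))"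
    by (rule continuous_on_compose2[OF continuous_f[OF x]]) (auto intro: continuous_intros)
  have nz: "f (x, y) + f (x, - y) \<noteq> 0" if "y \<in> sphere 0 1" for y
    using pos[of y] pos[of "- y"] that by fastforce
  have "continuous_on (sphere 0 1) \<psi>"
    unfolding \<psi>_def using nz
    by (intro continuous_intros continuous_on_subset[OF continuous_f[OF x]] continuous_on_subset[OF cm]) auto
  moreover have "sphere (0::real^'n) 1 \<noteq> {}" by simp
  ultimately obtain u where u: "u \<in> sphere 0 1" "\<And>y. y \<in> sphere 0 1 \<Longrightarrow> \<psi> y \<le> \<psi> u"
    using continuous_attains_sup[OF compact_sphere] by blast
  have "u \<noteq> 0" using u(1) by auto
  then have "\<psi> u < 1" using pos[of u] pos[of "- u"] by (simp add: \<psi>_def divide_less_eq abs_less_iff)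
  moreover have "\<psi> y \<le> \<psi> u" if "y \<noteq> 0" for y
  proof -
    let ?k = "1 / norm y"
    have "f (x, ?k *\<^sub>R y) = ?k * f (x, y)" "f (x, - (?k *\<^sub>R y)) = ?k * f (x, - y)"
      using f_scale[OF x, of ?k y] f_scale[OF x, of ?k "- y"] by auto
    then have "\<psi> (?k *\<^sub>R y) = (?k * \<bar>f (x, y) - f (x, - y)\<bar>) / (?k * (f (x, y) + f (x, - y)))"
      by (simp only: \<psi>_def right_diff_distrib[symmetric] distrib_left[symmetric] abs_mult) simp
    also have "\<dots> = \<psi> y" using that by (simp add: \<psi>_def)
    finally show ?thesis using u(2)[of "?k *\<^sub>R y"] that by simp
  qed
  ultimately show ?thesis unfolding \<psi>_def f_eq by blast
qed

section \<open>Charts\<close>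

context
  fixes T :: "'a topology" and A :: "('a, 'n::finite) chart set"
  assumes M: "smooth_manifold T A"
begin

lemma chart_facts:
  assumes "\<kappa> \<in> A"
  shows chart_openin: "openin T (fst \<kappa>)" and chart_open: "open (chart_image \<kappa>)"
    and chart_inv_snd: "p \<in> fst \<kappa> \<Longrightarrow> chart_inv \<kappa> (snd \<kappa> p) = p"
    and chart_snd_inv: "x \<in> chart_image \<kappa> \<Longrightarrow> snd \<kappa> (chart_inv \<kappa> x) = x"
    and chart_inv_in: "x \<in> chart_image \<kappa> \<Longrightarrow> chart_inv \<kappa> x \<in> fst \<kappa>"
    and chart_in: "p \<in> fst \<kappa> \<Longrightarrow> snd \<kappa> p \<in> chart_image \<kappa>"
    and chart_preimage: "open U \<Longrightarrow> openin T {p \<in> fst \<kappa>. snd \<kappa> p \<in> U}"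
proof -
  have c: "is_chart T \<kappa>" using M assms by (auto simp: smooth_manifold_def)
  show o: "openin T (fst \<kappa>)" and "open (chart_image \<kappa>)" using c by (auto simp: is_chart_def)
  have h: "homeomorphic_map (subtopology T (fst \<kappa>)) (top_of_set (chart_image \<kappa>)) (snd \<kappa>)"
    using c by (auto simp: is_chart_def)
  have ts: "topspace (subtopology T (fst \<kappa>)) = fst \<kappa>" using openin_subset[OF o] by auto
  have inj: "inj_on (snd \<kappa>) (fst \<kappa>)" using homeomorphic_imp_injective_map[OF h] ts by simp
  show "chart_inv \<kappa> (snd \<kappa> p) = p" if "p \<in> fst \<kappa>" using inj that by (simp add: chart_inv_def)
  show "snd \<kappa> (chart_inv \<kappa> x) = x" if "x \<in> chart_image \<kappa>"
    using that by (simp add: chart_inv_def chart_image_def f_inv_into_f)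
  show "chart_inv \<kappa> x \<in> fst \<kappa>" if "x \<in> chart_image \<kappa>"
    using that by (simp add: chart_inv_def chart_image_def inv_into_into)
  show "snd \<kappa> p \<in> chart_image \<kappa>" if "p \<in> fst \<kappa>" using that by (simp add: chart_image_def)
  show "openin T {p \<in> fst \<kappa>. snd \<kappa> p \<in> U}" if U: "open U"
  proof -
    have "openin (top_of_set (chart_image \<kappa>)) (chart_image \<kappa> \<inter> U)" using U by (rule openin_open_Int)
    then have "openin (subtopology T (fst \<kappa>)) {p \<in> topspace (subtopology T (fst \<kappa>)). snd \<kappa> p \<in> chart_image \<kappa> \<inter> U}"
      by (rule openin_continuous_map_preimage[OF homeomorphic_imp_continuous_map[OF h]])
    moreover have "{p \<in> topspace (subtopology T (fst \<kappa>)). snd \<kappa> p \<in> chart_image \<kappa> \<inter> U} = {p \<in> fst \<kappa>. snd \<kappa> p \<in> U}"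
      unfolding ts by (auto simp: chart_image_def)
    ultimately show ?thesis using openin_trans_full o by metis
  qed
qed

lemma transition_linear:
  assumes "\<kappa> \<in> A" "\<mu> \<in> A" "p \<in> fst \<kappa>" "p \<in> fst \<mu>"
  shows "linear (frechet_derivative (transition \<kappa> \<mu>) (at (snd \<kappa> p)))"
proof -
  have "compatible \<kappa> \<mu>" using M assms by (auto simp: smooth_manifold_def)
  then have "transition \<kappa> \<mu> differentiable (at (snd \<kappa> p))"
    using assms by (intro smooth_on_differentiable[of "snd \<kappa> ` (fst \<kappa> \<inter> fst \<mu>)"]) (auto simp: compatible_def)
  then show ?thesis by (rule linear_frechet_derivative)
qed

lemma tangent_vector_linear:
  assumes \<kappa>: "\<kappa> \<in> A" "p \<in> fst \<kappa>"
  shows "tangent_vector A \<kappa> p (y + z) = (\<lambda>\<mu>. tangent_vector A \<kappa> p y \<mu> + tangent_vector A \<kappa> p z \<mu>)"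
    and "tangent_vector A \<kappa> p (- y) = (\<lambda>\<mu>. - tangent_vector A \<kappa> p y \<mu>)"
    and "tangent_vector A \<kappa> p 0 = (\<lambda>\<mu>. 0)"
  using linear_add[OF transition_linear[OF \<kappa>(1) _ \<kappa>(2)]] linear_neg[OF transition_linear[OF \<kappa>(1) _ \<kappa>(2)]]
    linear_0[OF transition_linear[OF \<kappa>(1) _ \<kappa>(2)]]
  by (auto simp: tangent_vector_def fun_eq_iff)

text \<open>Two charts express \<open>F p\<close> on the same tangent space up to a linear change of
  components, so Randers type at a point may be tested in any chart.\<close>

lemma randers_norm_chart_change:
  assumes \<kappa>: "\<kappa> \<in> A" "p \<in> fst \<kappa>" and \<mu>: "\<mu> \<in> A" "p \<in> fst \<mu>"
    and R: "randers_norm (in_chart A \<mu> F (snd \<mu> p))"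
  shows "randers_norm (in_chart A \<kappa> F (snd \<kappa> p))"
proof -
  define L where "L y = tangent_vector A \<kappa> p y \<mu>" for y
  have L: "linear L"
    using transition_linear[OF \<kappa>(1) \<mu>(1) \<kappa>(2) \<mu>(2)] \<mu> by (simp add: L_def[abs_def] tangent_vector_def)
  have tv: "tangent_vector A \<kappa> p y = tangent_vector A \<mu> p (L y)" for y
    unfolding L_def by (rule tangent_space_eq_tangent_vector[OF \<mu> tangent_vector_in_tangent_space(1)[OF M \<kappa>]])
  have "in_chart A \<kappa> F (snd \<kappa> p) = (\<lambda>y. in_chart A \<mu> F (snd \<mu> p) (L y))"
    by (rule ext) (simp only: in_chart_def chart_inv_snd[OF \<kappa>] chart_inv_snd[OF \<mu>] tv)
  then show ?thesis using randers_norm_linear[OF R L] by simp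
qed

lemma finsler_domain_chart: "finsler_metric A F \<Longrightarrow> \<kappa> \<in> A \<Longrightarrow> finsler_domain (chart_image \<kappa>) (in_chart A \<kappa> F)"
  by (simp add: finsler_domain_def chart_open finsler_metric_def)

text \<open>The forms \<open>a\<close> and \<beta> are the even-odd formulas applied to tangent
  vectors, with sum and negation taken in each chart component. They are thus defined without
  choosing a chart, and linearity of \<open>tangent_vector\<close> turns them into the coordinate
  formulas.\<close>

lemma randers_metricI:
  assumes F: "finsler_metric A F"
    and R: "\<And>\<kappa> x. \<kappa> \<in> A \<Longrightarrow> x \<in> chart_image \<kappa> \<Longrightarrow> randers_norm (in_chart A \<kappa> F x)"
  shows "randers_metric T A F"
proof -
  define q where "q p v = ((F p v + F p (\<lambda>\<mu>. - v \<mu>)) / 2)\<^sup>2" for p v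
  define a where "a p v w = (q p (\<lambda>\<mu>. v \<mu> + w \<mu>) - q p v - q p w) / 2" for p v w
  define \<beta> where "\<beta> p v = (F p v - F p (\<lambda>\<mu>. - v \<mu>)) / 2" for p v
  define qc where "qc \<kappa> x y = ((in_chart A \<kappa> F x y + in_chart A \<kappa> F x (- y)) / 2)\<^sup>2" for \<kappa> x y
  have q_tv: "q (chart_inv \<kappa> x) (tangent_vector A \<kappa> (chart_inv \<kappa> x) y) = qc \<kappa> x y"
    and a_tv: "a (chart_inv \<kappa> x) (tangent_vector A \<kappa> (chart_inv \<kappa> x) y) (tangent_vector A \<kappa> (chart_inv \<kappa> x) z) =
      (qc \<kappa> x (y + z) - qc \<kappa> x y - qc \<kappa> x z) / 2"
    and \<beta>_tv: "in_chart A \<kappa> \<beta> x y = (in_chart A \<kappa> F x y - in_chart A \<kappa> F x (- y)) / 2"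
    if \<kappa>: "\<kappa> \<in> A" "x \<in> chart_image \<kappa>" for \<kappa> x y z
  proof -
    note tv = tangent_vector_linear[OF \<kappa>(1) chart_inv_in[OF \<kappa>]]
    show q_tv: "q (chart_inv \<kappa> x) (tangent_vector A \<kappa> (chart_inv \<kappa> x) y) = qc \<kappa> x y" for y
      by (simp add: q_def qc_def in_chart_def tv(2))
    show "a (chart_inv \<kappa> x) (tangent_vector A \<kappa> (chart_inv \<kappa> x) y) (tangent_vector A \<kappa> (chart_inv \<kappa> x) z) =
      (qc \<kappa> x (y + z) - qc \<kappa> x y - qc \<kappa> x z) / 2"
      unfolding a_def tv(1)[symmetric] q_tv ..
    show "in_chart A \<kappa> \<beta> x y = (in_chart A \<kappa> F x y - in_chart A \<kappa> F x (- y)) / 2"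
      by (simp add: in_chart_def \<beta>_def tv(2))
  qed
  have data: "linear (\<lambda>y. (qc \<kappa> x (y + z) - qc \<kappa> x y - qc \<kappa> x z) / 2)"
    "linear (\<lambda>z. (qc \<kappa> x (y + z) - qc \<kappa> x y - qc \<kappa> x z) / 2)"
    "linear (\<lambda>y. (in_chart A \<kappa> F x y - in_chart A \<kappa> F x (- y)) / 2)"
    "(qc \<kappa> x (y + y) - qc \<kappa> x y - qc \<kappa> x y) / 2 = qc \<kappa> x y"
    if \<kappa>: "\<kappa> \<in> A" "x \<in> chart_image \<kappa>" for \<kappa> x y z
    using finsler_domain.randers_norm_data[OF finsler_domain_chart[OF F \<kappa>(1)] \<kappa>(2) R[OF \<kappa>]]
    unfolding qc_def by blast+
  have Fpos: "in_chart A \<kappa> F x y > 0" if "\<kappa> \<in> A" "x \<in> chart_image \<kappa>" "y \<noteq> 0" for \<kappa> x y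
  proof -
    have "finsler_on (chart_image \<kappa>) (in_chart A \<kappa> F)" using F that by (simp add: finsler_metric_def)
    then show ?thesis using that unfolding finsler_on_def by (metis less_le)
  qed
  have smF: "smooth_on (chart_image \<kappa>) (\<lambda>x. in_chart A \<kappa> F x y)" if "\<kappa> \<in> A" "y \<noteq> 0" for \<kappa> y
  proof -
    interpret finsler_domain "chart_image \<kappa>" "in_chart A \<kappa> F" by (rule finsler_domain_chart[OF F that(1)])
    show ?thesis using smooth_on_fst_slice[OF smooth_f that(2)] by (simp add: f_eq)
  qed
  have smq: "smooth_on (chart_image \<kappa>) (\<lambda>x. qc \<kappa> x y)" if "\<kappa> \<in> A" "y \<noteq> 0" for \<kappa> y
    unfolding qc_def power2_eq_square using that chart_open[OF that(1)]
    by (intro smooth_on_mult smooth_on_divide smooth_on_add smF smooth_on_const) auto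
  \<comment> \<open>\<open>F\<close> is known to be smooth only off the zero section, so every
    vector entering the polarization formula must be nonzero; \<open>e_i + e_j\<close> is, even for
    \<open>i = j\<close>.\<close>
  have ax: "axis i 1 \<noteq> (0::real^'n)" "axis i 1 + axis j 1 \<noteq> (0::real^'n)" for i j :: 'n
  proof -
    show "axis i 1 \<noteq> (0::real^'n)" by (simp add: axis_eq_0_iff)
    have "(axis i 1 + axis j 1 :: real^'n) $ i > 0" by (simp add: axis_def)
    then show "axis i 1 + axis j 1 \<noteq> (0::real^'n)" by force
  qed
  have "riemannian_metric A a"
    unfolding riemannian_metric_def
  proof
    fix \<kappa> assume \<kappa>: "\<kappa> \<in> A"
    define h :: "real^'n \<Rightarrow> real^'n^'n" where "h x = (\<chi> i j. (qc \<kappa> x (axis i 1 + axis j 1)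
      - qc \<kappa> x (axis i 1) - qc \<kappa> x (axis j 1)) / 2)" for x
    have hQ: "y \<bullet> (h x *v z) = (qc \<kappa> x (y + z) - qc \<kappa> x y - qc \<kappa> x z) / 2" if "x \<in> chart_image \<kappa>" for x y z
      unfolding h_def
      by (rule bilinear_matrix[of "\<lambda>y z. (qc \<kappa> x (y + z) - qc \<kappa> x y - qc \<kappa> x z) / 2"])
        (rule data[OF \<kappa> that])+
    show "\<exists>h. (\<forall>i j. smooth_on (chart_image \<kappa>) (\<lambda>x. h x $ i $ j)) \<and>
      (\<forall>x\<in>chart_image \<kappa>. transpose (h x) = h x \<and> (\<forall>y. y \<noteq> 0 \<longrightarrow> y \<bullet> (h x *v y) > 0) \<and>
        (\<forall>y z. a (chart_inv \<kappa> x) (tangent_vector A \<kappa> (chart_inv \<kappa> x) y)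
                  (tangent_vector A \<kappa> (chart_inv \<kappa> x) z) = y \<bullet> (h x *v z)))"
    proof (intro exI[of _ h] conjI allI ballI impI)
      show "smooth_on (chart_image \<kappa>) (\<lambda>x. h x $ i $ j)" for i j
        unfolding h_def using ax chart_open[OF \<kappa>]
        by (simp, intro smooth_on_divide smooth_on_diff smq smooth_on_const \<kappa>) auto
      fix x assume x: "x \<in> chart_image \<kappa>"
      show "transpose (h x) = h x" by (simp add: h_def transpose_def vec_eq_iff add.commute)
      show "y \<bullet> (h x *v y) > 0" if "y \<noteq> 0" for y
        unfolding hQ[OF x] data(4)[OF \<kappa> x] using Fpos[OF \<kappa> x that] Fpos[OF \<kappa> x, of "- y"] that
        by (simp add: qc_def)
      show "a (chart_inv \<kappa> x) (tangent_vector A \<kappa> (chart_inv \<kappa> x) y)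
                  (tangent_vector A \<kappa> (chart_inv \<kappa> x) z) = y \<bullet> (h x *v z)" for y z
        unfolding hQ[OF x] by (rule a_tv[OF \<kappa> x])
    qed
  qed
  moreover have "one_form A \<beta>"
    unfolding one_form_def
  proof (intro ballI conjI allI)
    fix \<kappa> assume \<kappa>: "\<kappa> \<in> A"
    show "linear (in_chart A \<kappa> \<beta> x)" if "x \<in> chart_image \<kappa>" for x
    proof -
      have "in_chart A \<kappa> \<beta> x = (\<lambda>y. (in_chart A \<kappa> F x y - in_chart A \<kappa> F x (- y)) / 2)"
        by (rule ext) (rule \<beta>_tv[OF \<kappa> that])
      then show ?thesis using data(3)[OF \<kappa> that] by simp
    qed
    show "smooth_on (chart_image \<kappa>) (\<lambda>x. in_chart A \<kappa> \<beta> x (axis i 1))" for i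
    proof (rule smooth_on_cong[OF _ chart_open[OF \<kappa>] \<beta>_tv[OF \<kappa>, symmetric]])
      show "smooth_on (chart_image \<kappa>) (\<lambda>x. (in_chart A \<kappa> F x (axis i 1) - in_chart A \<kappa> F x (- axis i 1)) / 2)"
        using ax chart_open[OF \<kappa>] by (intro smooth_on_divide smooth_on_diff smF smooth_on_const \<kappa>) auto
    qed
  qed
  moreover have "one_form_norm A a \<beta> p < 1 \<and> (\<forall>v\<in>tangent_space A p. F p v = sqrt (a p v v) + \<beta> p v)"
    if p: "p \<in> topspace T" for p
  proof -
    obtain \<kappa> where \<kappa>: "\<kappa> \<in> A" "p \<in> fst \<kappa>" using M p unfolding smooth_manifold_def by blast
    define x where "x = snd \<kappa> p"
    have x: "x \<in> chart_image \<kappa>" using chart_in[OF \<kappa>] by (simp add: x_def)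
    have px: "chart_inv \<kappa> x = p" using chart_inv_snd[OF \<kappa>] by (simp add: x_def)
    note tv = tangent_space_eq_tangent_vector[OF \<kappa>]
    let ?G = "in_chart A \<kappa> F x"
    have Fv: "F p v = ?G (v \<kappa>)" and \<beta>v: "\<beta> p v = (?G (v \<kappa>) - ?G (- v \<kappa>)) / 2"
      and av: "sqrt (a p v v) = (?G (v \<kappa>) + ?G (- v \<kappa>)) / 2" if v: "v \<in> tangent_space A p" for v
    proof -
      have v: "v = tangent_vector A \<kappa> p (v \<kappa>)" by (rule tv[OF v])
      show "F p v = ?G (v \<kappa>)" by (subst v) (simp add: in_chart_def px)
      show "\<beta> p v = (?G (v \<kappa>) - ?G (- v \<kappa>)) / 2"
        using \<beta>_tv[OF \<kappa>(1) x, of "v \<kappa>"] v by (simp add: in_chart_def px)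
      have "a p v v = qc \<kappa> x (v \<kappa>)"
        using a_tv[OF \<kappa>(1) x, of "v \<kappa>" "v \<kappa>"] data(4)[OF \<kappa>(1) x] v px by simp
      moreover have "?G y \<ge> 0" for y
      proof -
        have "finsler_on (chart_image \<kappa>) (in_chart A \<kappa> F)" using F \<kappa> by (simp add: finsler_metric_def)
        then show ?thesis using x unfolding finsler_on_def by blast
      qed
      ultimately show "sqrt (a p v v) = (?G (v \<kappa>) + ?G (- v \<kappa>)) / 2"
        by (simp add: qc_def real_sqrt_unique)
    qed
    obtain s where s: "s < 1" "\<And>y. y \<noteq> 0 \<Longrightarrow> \<bar>?G y - ?G (- y)\<bar> / (?G y + ?G (- y)) \<le> s"
      using finsler_domain.randers_ratio_bound[OF finsler_domain_chart[OF F \<kappa>(1)] x] by blast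
    let ?S = "{\<bar>\<beta> p v\<bar> / sqrt (a p v v) | v. v \<in> tangent_space A p \<and> v \<noteq> (\<lambda>_. 0)}"
    have "Sup ?S \<le> s"
    proof (rule cSup_least)
      obtain i :: 'n where True by simp
      define v where "v = tangent_vector A \<kappa> p (axis i 1)"
      have "v \<in> tangent_space A p" "v \<kappa> = axis i 1"
        using tangent_vector_in_tangent_space[OF M \<kappa>] by (simp_all add: v_def)
      moreover have "v \<noteq> (\<lambda>_. 0)" using \<open>v \<kappa> = axis i 1\<close> ax(1) by metis
      ultimately show "?S \<noteq> {}" by blast
    next
      fix t assume "t \<in> ?S"
      then obtain v where v: "v \<in> tangent_space A p" "v \<noteq> (\<lambda>_. 0)" "t = \<bar>\<beta> p v\<bar> / sqrt (a p v v)" by blast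
      have "v \<kappa> \<noteq> 0" using tv[OF v(1)] v(2) tangent_vector_linear(3)[OF \<kappa>] by metis
      from s(2)[OF this] show "t \<le> s"
        unfolding v(3) \<beta>v[OF v(1)] av[OF v(1)] by (simp add: abs_divide)
    qed
    then have "one_form_norm A a \<beta> p < 1" using s(1) by (simp add: one_form_norm_def)
    moreover have "F p v = sqrt (a p v v) + \<beta> p v" if "v \<in> tangent_space A p" for v
      unfolding Fv[OF that] \<beta>v[OF that] av[OF that] by (simp add: field_simps)
    ultimately show ?thesis by blast
  qed
  ultimately show ?thesis using F unfolding randers_metric_def by blast
qed

end

section \<open>Globalization over a connected manifold\<close>

theorem corollary1p4:
  fixes T :: "'a topology"
    and A :: "('a, 'n::finite) chart set"
    and F :: "'a \<Rightarrow> ('a, 'n) tvec \<Rightarrow> real"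
    and c :: "'a \<Rightarrow> real"
    and \<eta> :: "'a \<Rightarrow> ('a, 'n) tvec \<Rightarrow> real"
  assumes "smooth_manifold T A"
    and "connected_space T"
    and "finsler_metric A F"
    and "locally_projectively_flat T A F"
    and "almost_isotropic_S_curvature A F c \<eta>"
    and "\<not> c constant_on topspace T"
  shows "randers_metric T A F"
proof -
  note M = assms(1) and conn = assms(2) and F = assms(3)
  define R where "R p \<longleftrightarrow> (\<exists>\<kappa>\<in>A. p \<in> fst \<kappa> \<and> randers_norm (in_chart A \<kappa> F (snd \<kappa> p)))" for p
  have R_chart: "R p \<longleftrightarrow> randers_norm (in_chart A \<kappa> F (snd \<kappa> p))" if "\<kappa> \<in> A" "p \<in> fst \<kappa>" for \<kappa> p
    unfolding R_def using randers_norm_chart_change[OF M that] that by blast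
  have local: "\<exists>O'. openin T O' \<and> p \<in> O' \<and> ((\<forall>q\<in>O'. R q) \<or>
      (\<forall>q\<in>O'. c q = c p) \<and> (\<forall>q\<in>O'. \<forall>q'\<in>O'. R q' \<longrightarrow> R q))"
    if n: "CARD('n) \<ge> 2" and p: "p \<in> topspace T" for p
  proof -
    obtain \<kappa> where \<kappa>: "\<kappa> \<in> A" "p \<in> fst \<kappa>"
      and pf: "projectively_flat_on (chart_image \<kappa>) (in_chart A \<kappa> F)"
      using assms(4) p unfolding locally_projectively_flat_def by blast
    note S = assms(5)[unfolded almost_isotropic_S_curvature_def closed_one_form_def one_form_def smooth_function_def]
    interpret finsler_domain "chart_image \<kappa>" "in_chart A \<kappa> F" by (rule finsler_domain_chart[OF M F \<kappa>(1)])
    have "\<exists>th. projective_pde (chart_image \<kappa>) (in_chart A \<kappa> F) (c \<circ> chart_inv \<kappa>) th"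
      by (rule projective_pde_of_S_curvature[OF pf, where \<eta> = "in_chart A \<kappa> \<eta>"]) (use S \<kappa>(1) in auto)
    then obtain th where "projective_pde (chart_image \<kappa>) (in_chart A \<kappa> F) (c \<circ> chart_inv \<kappa>) th" ..
    then interpret projective_pde "chart_image \<kappa>" "in_chart A \<kappa> F" "c \<circ> chart_inv \<kappa>" th .
    obtain U where U: "open U" "snd \<kappa> p \<in> U" "U \<subseteq> chart_image \<kappa>"
      and dich: "(\<forall>x\<in>U. randers_norm (in_chart A \<kappa> F x)) \<or>
        (\<forall>x\<in>U. (c \<circ> chart_inv \<kappa>) x = (c \<circ> chart_inv \<kappa>) (snd \<kappa> p)) \<and>
        (\<forall>x\<in>U. \<forall>x'\<in>U. randers_norm (in_chart A \<kappa> F x') \<longrightarrow> randers_norm (in_chart A \<kappa> F x))"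
      using local_dichotomy[OF n chart_in[OF M \<kappa>]] by blast
    define O' where "O' = {q \<in> fst \<kappa>. snd \<kappa> q \<in> U}"
    have O': "q \<in> fst \<kappa>" "snd \<kappa> q \<in> U" if "q \<in> O'" for q using that by (auto simp: O'_def)
    have "openin T O'" unfolding O'_def by (rule chart_preimage[OF M \<kappa>(1) U(1)])
    moreover have "p \<in> O'" using \<kappa>(2) U(2) by (simp add: O'_def)
    moreover have "(\<forall>q\<in>O'. R q) \<or> (\<forall>q\<in>O'. c q = c p) \<and> (\<forall>q\<in>O'. \<forall>q'\<in>O'. R q' \<longrightarrow> R q)"
      using dich
    proof (elim disjE conjE)
      assume "\<forall>x\<in>U. randers_norm (in_chart A \<kappa> F x)"
      then have "\<forall>q\<in>O'. R q" using O' R_chart[OF \<kappa>(1)] by blast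
      then show ?thesis ..
    next
      assume c: "\<forall>x\<in>U. (c \<circ> chart_inv \<kappa>) x = (c \<circ> chart_inv \<kappa>) (snd \<kappa> p)"
        and r: "\<forall>x\<in>U. \<forall>x'\<in>U. randers_norm (in_chart A \<kappa> F x') \<longrightarrow> randers_norm (in_chart A \<kappa> F x)"
      have "c q = c p" if "q \<in> O'" for q
        using bspec[OF c O'(2)[OF that]] chart_inv_snd[OF M \<kappa>(1)] O'(1)[OF that] \<kappa>(2) by simp
      moreover have "R q" if "q \<in> O'" "q' \<in> O'" "R q'" for q q'
        using r O' that R_chart[OF \<kappa>(1)] by blast
      ultimately show ?thesis by blast
    qed
    ultimately show ?thesis by blast
  qed
  have "R p" if p: "p \<in> topspace T" for p
  proof (cases "CARD('n) \<ge> 2")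
    case False
    have "CARD('n) > 0" by simp
    then have n: "CARD('n) = 1" using False by linarith
    obtain \<kappa> where \<kappa>: "\<kappa> \<in> A" "p \<in> fst \<kappa>" using M p unfolding smooth_manifold_def by blast
    have "finsler_on (chart_image \<kappa>) (in_chart A \<kappa> F)" using F \<kappa> by (simp add: finsler_metric_def)
    then have "randers_norm (in_chart A \<kappa> F (snd \<kappa> p))"
      using chart_in[OF M \<kappa>] by (intro randers_norm_dim1[OF n]) (simp add: finsler_on_def)
    then show ?thesis using R_chart[OF \<kappa>] by simp
  next
    case n: True
    let ?N = "{p \<in> topspace T. \<not> R p}"
    \<comment> \<open>In both cases of the local dichotomy \<open>R\<close> is constant on
      \<open>O'\<close>, so \<open>R\<close> and its negation both define open sets.\<close>
    have openN: "openin T ?N"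
    proof (subst openin_subopen, intro ballI)
      fix p assume p: "p \<in> ?N"
      obtain O' where O': "openin T O'" "p \<in> O'" "(\<forall>q\<in>O'. R q) \<or> (\<forall>q\<in>O'. \<forall>q'\<in>O'. R q' \<longrightarrow> R q)"
        using local[OF n, of p] p by blast
      have "O' \<subseteq> ?N" using O' p openin_subset[OF O'(1)] by blast
      then show "\<exists>U. openin T U \<and> p \<in> U \<and> U \<subseteq> ?N" using O' by blast
    qed
    have "openin T {p \<in> topspace T. R p}"
    proof (subst openin_subopen, intro ballI)
      fix p assume p: "p \<in> {p \<in> topspace T. R p}"
      obtain O' where O': "openin T O'" "p \<in> O'" "(\<forall>q\<in>O'. R q) \<or> (\<forall>q\<in>O'. \<forall>q'\<in>O'. R q' \<longrightarrow> R q)"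
        using local[OF n, of p] p by blast
      have "O' \<subseteq> {p \<in> topspace T. R p}" using O' p openin_subset[OF O'(1)] by blast
      then show "\<exists>U. openin T U \<and> p \<in> U \<and> U \<subseteq> {p \<in> topspace T. R p}" using O' by blast
    qed
    moreover have "topspace T - ?N = {p \<in> topspace T. R p}" by blast
    ultimately have "closedin T ?N" by (simp add: closedin_def)
    then have "?N = {} \<or> ?N = topspace T"
      using conn openN unfolding connected_space_clopen_in by blast
    moreover have "?N \<noteq> topspace T"
    proof
      \<comment> \<open>If \<open>R\<close> failed everywhere, only the second case of the dichotomy
        could occur and \<open>c\<close> would be locally constant; connectedness then makes it
        constant, against the hypothesis.\<close>
      assume N: "?N = topspace T"
      have lc: "\<exists>O'. openin T O' \<and> q \<in> O' \<and> (\<forall>r\<in>O'. c r = c q)" if q: "q \<in> topspace T" for q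
      proof -
        have "\<not> R q" using N q by blast
        then show ?thesis using local[OF n q] by blast
      qed
      have op: "openin T {q \<in> topspace T. Q (c q)}" for Q
      proof (subst openin_subopen, intro ballI)
        fix q assume q: "q \<in> {q \<in> topspace T. Q (c q)}"
        obtain O' where O': "openin T O'" "q \<in> O'" "\<forall>r\<in>O'. c r = c q" using lc[of q] q by blast
        have "O' \<subseteq> {q \<in> topspace T. Q (c q)}" using O'(3) q openin_subset[OF O'(1)] by auto
        then show "\<exists>U. openin T U \<and> q \<in> U \<and> U \<subseteq> {q \<in> topspace T. Q (c q)}" using O' by blast
      qed
      let ?C = "{q \<in> topspace T. c q = c p}"
      have "topspace T - ?C = {q \<in> topspace T. c q \<noteq> c p}" by blast
      then have "closedin T ?C" using op[of "\<lambda>t. t \<noteq> c p"] by (simp add: closedin_def)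
      then have "?C = {} \<or> ?C = topspace T"
        using conn op[of "\<lambda>t. t = c p"] unfolding connected_space_clopen_in by blast
      then have "c constant_on topspace T" using p unfolding constant_on_def by blast
      then show False using assms(6) by simp
    qed
    ultimately show ?thesis using p by blast
  qed
  then show ?thesis
  proof (intro randers_metricI[OF M F])
    fix \<kappa> x assume \<kappa>: "\<kappa> \<in> A" "x \<in> chart_image \<kappa>"
      and R: "\<And>p. p \<in> topspace T \<Longrightarrow> R p"
    have "chart_inv \<kappa> x \<in> topspace T"
      using chart_inv_in[OF M \<kappa>] openin_subset[OF chart_openin[OF M \<kappa>(1)]] by blast
    then show "randers_norm (in_chart A \<kappa> F x)"
      using R R_chart[OF \<kappa>(1) chart_inv_in[OF M \<kappa>]] chart_snd_inv[OF M \<kappa>] by simp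
  qed
qed

end
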